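(* Let $n, r$ be integers with $r \ge n+2 > 4$ and let $E \subseteq [n]\times[r]$ have cardinality $nr - \binom{n+1}{2} - r + 1$. If $E$ is a basis of (the algebraic matroid underlying) $X_{n,r}$, then the bipartite graph $G_E$ is connected. Moreover, when $n = 3$ the converse also holds: if $G_E$ is connected, then $E$ is a basis of $X_{3,r}$.
   Context: Notation: $[m]=\{1,\dots,m\}$. The affine finite unit norm tight frame variety is $$X_{n,r} = \{ W \in \mathbb{C}^{n\times r} : W W^T = \tfrac{r}{n}\,\mathrm{Id}_n,\ \operatorname{diag}(W^T W) = \operatorname{diag}(\mathrm{Id}_r)\},$$ where $W^T$ is the ordinary transpose (no complex conjugation) and $\operatorname{diag}(M)$ denotes the diagonal entries of $M$. It is known that for $r \ge n+2 > 4$ the variety $X_{n,r}$ is irreducible of dimension $nr - \binom{n+1}{2} - r + 1$. For $S\subseteq [n]\times[r]$, let $\pi_S : \mathbb{C}^{n\times r}\to\mathbb{C}^S$ be the coordinate projection. For an irreducible variety $X\subseteq\mathbb{C}^{n\times r}$, the set $S$ is independent in $X$ if the only polynomial vanishing on $\pi_S(X)$ is the zero polynomial; $S$ is spanning in $X$ if $\dim \pi_S(X) = \dim X$; and $S$ is a basis of $X$ if it is both independent and spanning. For $E\subseteq[n]\times[r]$, $G_E$ denotes the bipartite graph with row vertices $[n]$, column vertices $[r]$ (the two vertex sets being disjoint copies), and edge set the complement $([n]\times[r])\setminus E$. Its vertex set is always all $n+r$ vertices. *)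

theory Defs
  imports
    Complex_Main
    "HOL-Library.FuncSet"
    "HOL-Library.Extended_Nat"
    "HOL-Library.Poly_Mapping"
    "Jordan_Normal_Form.Matrix"
    "Graph_Theory.Graph_Theory"
begin

section \<open>Affine space and polynomial functions\<close>

text \<open>
  For a set \<open>I\<close> of coordinates, \<open>\<complex>\<^sup>I\<close> is the set of functions that are
  \<open>undefined\<close> outside \<open>I\<close>, so that the coordinate projection
  \<open>\<pi>\<^sub>S : \<complex>\<^sup>I \<rightarrow> \<complex>\<^sup>S\<close> for \<open>S \<subseteq> I\<close> is \<open>\<lambda>x. restrict x S\<close>.
\<close>

abbreviation affine_space :: "'v set \<Rightarrow> ('v \<Rightarrow> complex) set" where
  "affine_space I \<equiv> I \<rightarrow>\<^sub>E UNIV"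

abbreviation coord_proj :: "'v set \<Rightarrow> ('v \<Rightarrow> complex) \<Rightarrow> ('v \<Rightarrow> complex)" where
  "coord_proj S \<equiv> \<lambda>x. restrict x S"

text \<open>
  A polynomial maps finitely many monomials (finitely supported exponent vectors)
  to their nonzero coefficients.
\<close>

type_synonym 'v cpoly = "('v \<Rightarrow>\<^sub>0 nat) \<Rightarrow>\<^sub>0 complex"

definition poly_vars :: "'v cpoly \<Rightarrow> 'v set" where
  "poly_vars p = (\<Union>m \<in> Poly_Mapping.keys p. Poly_Mapping.keys m)"

definition poly_eval :: "('v \<Rightarrow> complex) \<Rightarrow> 'v cpoly \<Rightarrow> complex" where
  "poly_eval x p = (\<Sum>m \<in> Poly_Mapping.keys p. Poly_Mapping.lookup p m *
     (\<Prod>v \<in> Poly_Mapping.keys m. x v ^ Poly_Mapping.lookup m v))"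

definition polys_in :: "'v set \<Rightarrow> 'v cpoly set" where
  "polys_in I = {p. poly_vars p \<subseteq> I}"


section \<open>Zariski topology and dimension\<close>

definition zero_locus :: "'v set \<Rightarrow> 'v cpoly set \<Rightarrow> ('v \<Rightarrow> complex) set" where
  "zero_locus I P = {x \<in> affine_space I. \<forall>p \<in> P. poly_eval x p = 0}"

definition zariski_closed :: "'v set \<Rightarrow> ('v \<Rightarrow> complex) set \<Rightarrow> bool" where
  "zariski_closed I Z \<longleftrightarrow> (\<exists>P \<subseteq> polys_in I. Z = zero_locus I P)"

definition zariski_closure :: "'v set \<Rightarrow> ('v \<Rightarrow> complex) set \<Rightarrow> ('v \<Rightarrow> complex) set" where
  "zariski_closure I Y = \<Inter> {Z. zariski_closed I Z \<and> Y \<subseteq> Z}"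

definition irreducible_closed :: "'v set \<Rightarrow> ('v \<Rightarrow> complex) set \<Rightarrow> bool" where
  "irreducible_closed I Z \<longleftrightarrow> zariski_closed I Z \<and> Z \<noteq> {} \<and>
     (\<forall>A B. zariski_closed I A \<and> zariski_closed I B \<and> Z = A \<union> B \<longrightarrow> Z = A \<or> Z = B)"

text \<open>
  The image of a variety under a coordinate projection need not be closed; its dimension
  is, as usual, the Krull dimension of its Zariski closure: the supremum of the lengths \<open>d\<close> of
  chains \<open>Z\<^sub>0 \<subset> \<dots> \<subset> Z\<^sub>d\<close> of irreducible closed subsets.
  The empty set gets dimension 0.
\<close>

definition variety_dim :: "'v set \<Rightarrow> ('v \<Rightarrow> complex) set \<Rightarrow> enat" where
  "variety_dim I Y = Sup {enat d | d. \<exists>Z :: nat \<Rightarrow> ('v \<Rightarrow> complex) set.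
     (\<forall>k \<le> d. irreducible_closed I (Z k) \<and> Z k \<subseteq> zariski_closure I Y) \<and>
     (\<forall>k < d. Z k \<subset> Z (Suc k))}"


section \<open>The algebraic matroid of a variety\<close>

text \<open>Here \<open>X \<subseteq> \<complex>\<^sup>I\<close> and \<open>S \<subseteq> I\<close>.\<close>

definition independent_in :: "('v \<Rightarrow> complex) set \<Rightarrow> 'v set \<Rightarrow> bool" where
  "independent_in X S \<longleftrightarrow>
     (\<forall>p \<in> polys_in S. (\<forall>y \<in> coord_proj S ` X. poly_eval y p = 0) \<longrightarrow> p = 0)"

definition spanning_in :: "'v set \<Rightarrow> ('v \<Rightarrow> complex) set \<Rightarrow> 'v set \<Rightarrow> bool" where
  "spanning_in I X S \<longleftrightarrow> variety_dim S (coord_proj S ` X) = variety_dim I X"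

definition basis_of :: "'v set \<Rightarrow> ('v \<Rightarrow> complex) set \<Rightarrow> 'v set \<Rightarrow> bool" where
  "basis_of I X S \<longleftrightarrow> independent_in X S \<and> spanning_in I X S"


section \<open>Finite unit norm tight frames\<close>

text \<open>Rows and columns are numbered from 0, as in the matrix library.\<close>

abbreviation index_grid :: "nat \<Rightarrow> nat \<Rightarrow> (nat \<times> nat) set" where
  "index_grid n r \<equiv> {..<n} \<times> {..<r}"

definition funtf_variety :: "nat \<Rightarrow> nat \<Rightarrow> (nat \<times> nat \<Rightarrow> complex) set" where
  "funtf_variety n r = {w \<in> affine_space (index_grid n r).
     let W = mat n r w in
       W * W\<^sup>T = (of_nat r / of_nat n) \<cdot>\<^sub>m 1\<^sub>m n \<and>
       diag_mat (W\<^sup>T * W) = diag_mat (1\<^sub>m r)}"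

text \<open>
  Edges are stored in the direction from rows to columns; connectivity
  \<open>Digraph_Component.connected\<close> is that of the underlying undirected graph.
\<close>

definition complement_graph :: "nat \<Rightarrow> nat \<Rightarrow> (nat \<times> nat) set \<Rightarrow> (nat + nat) pair_pre_digraph" where
  "complement_graph n r E =
     \<lparr> pverts = Inl ` {..<n} \<union> Inr ` {..<r},
       parcs = {(Inl i, Inr j) | i j. (i, j) \<in> index_grid n r - E} \<rparr>"

end

(*
  If the graph is disconnected, subtracting the squared norms of the columns of a component from those
  of its rows leaves a nonzero polynomial relation among the entries outside the graph, so E is dependent.

  For n = 3 and a connected graph G, the 5 + r equations of the variety (one of them is redundant) are
  solved for the entries in G near a suitable point. The linearisation is surjective as soon as the
  matrices u y^T + y u^T, for u a column and y orthogonal to u and supported on the neighbours of that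
  column, span the traceless symmetric matrices. Connectedness of G leaves finitely many degree patterns,
  and for each of them this holds at one of three explicit frames, enlarged by orthonormal bases.
  The resulting analytic section over an open subset of C^E shows that E is independent and, by taking
  Zariski closures of the images of a flag, that the dimension is at least card E.
  For the upper bound, two non-orthogonal columns are algebraic over the other r - 2 unit columns,
  and those satisfy one more relation: r/3 times the identity minus the sum of their v v^T is singular.
  Krull dimension enters only through counting: functions separating the members of a chain of
  irreducible closed sets are algebraically independent.
*)

theory Submission
  imports Defs "HOL-Complex_Analysis.Complex_Analysis"
begin

section \<open>Polynomial functions\<close>

text \<open>For three rows the numbers match without slack. A column of degree d in the graph offers
  d - 1 independent directions orthogonal to it; over a graph with r + 5 edges these add up to 5,
  exactly the dimension of the traceless symmetric matrices. A generic frame should do, and a finite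
  check over the integers takes the place of genericity. Tightness ignores the order of the columns,
  so only the multiset of degree patterns matters. The one kind of pattern that has to be excluded
  consists of five columns of degree 2 missing the same row; such a row is cut off from the other
  two. An orthonormal basis adds three columns, hence one starting frame for each residue of r
  modulo 3. The upper bound on the dimension is shown for each irreducible closed subset Z
  separately. The pair of non-orthogonal columns, and with it the set of coordinates over which
  everything is algebraic, depends on Z. That the relation among the other columns is not trivial is
  seen at a point outside the variety, chosen so that all square roots in the elimination vanish
  there.\<close>

declare lookup_eq_zero_in_keys_contradict [rule del]

definition monom_eval :: "('v \<Rightarrow> complex) \<Rightarrow> ('v \<Rightarrow>\<^sub>0 nat) \<Rightarrow> complex" where
  "monom_eval x m = (\<Prod>v \<in> Poly_Mapping.keys m. x v ^ Poly_Mapping.lookup m v)"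

text \<open>Enlarging the index set only adds factors with exponent zero. Two monomials can then be
  compared over one common index set.\<close>

lemma monom_eval_superset:
  assumes "finite A" "Poly_Mapping.keys m \<subseteq> A"
  shows "monom_eval x m = (\<Prod>v\<in>A. x v ^ Poly_Mapping.lookup m v)"
  unfolding monom_eval_def
  by (rule prod.mono_neutral_left) (use assms in \<open>auto simp: in_keys_iff\<close>)

lemma keys_add_nat:
  "Poly_Mapping.keys (m + n) = Poly_Mapping.keys m \<union> Poly_Mapping.keys (n :: 'v \<Rightarrow>\<^sub>0 nat)"
  by (auto simp: in_keys_iff lookup_add)

lemma monom_eval_add: "monom_eval x (m + n) = monom_eval x m * monom_eval x n"
proof -
  let ?A = "Poly_Mapping.keys m \<union> Poly_Mapping.keys n"
  show ?thesis
    by (simp add: monom_eval_superset[of ?A] keys_add_nat lookup_add power_add prod.distrib)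
qed

lemma monom_eval_0 [simp]: "monom_eval x 0 = 1"
  by (simp add: monom_eval_def)

lemma monom_eval_single [simp]: "monom_eval x (Poly_Mapping.single v i) = x v ^ i"
  by (cases "i = 0") (simp_all add: monom_eval_def)

lemma poly_eval_monom_eval:
  "poly_eval x p = (\<Sum>m\<in>Poly_Mapping.keys p. Poly_Mapping.lookup p m * monom_eval x m)"
  by (simp add: poly_eval_def monom_eval_def)

lemma poly_eval_superset:
  assumes "finite A" "Poly_Mapping.keys p \<subseteq> A"
  shows "poly_eval x p = (\<Sum>m\<in>A. Poly_Mapping.lookup p m * monom_eval x m)"
  unfolding poly_eval_monom_eval
  by (rule sum.mono_neutral_left) (use assms in \<open>auto simp: in_keys_iff\<close>)

lemma poly_eval_0 [simp]: "poly_eval x 0 = 0"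
  by (simp add: poly_eval_def)

lemma poly_eval_add: "poly_eval x (p + q) = poly_eval x p + poly_eval x q"
proof -
  let ?A = "Poly_Mapping.keys p \<union> Poly_Mapping.keys q"
  show ?thesis
    using keys_add[of p q]
    by (simp add: poly_eval_superset[of ?A] lookup_add distrib_right sum.distrib)
qed

lemma poly_eval_sum: "poly_eval x (sum f A) = (\<Sum>a\<in>A. poly_eval x (f a))"
  by (induction A rule: infinite_finite_induct) (simp_all add: poly_eval_add)

lemma poly_eval_single [simp]: "poly_eval x (Poly_Mapping.single m c) = c * monom_eval x m"
  by (cases "c = 0") (simp_all add: poly_eval_monom_eval)

lemma poly_mapping_sum_single:
  "p = (\<Sum>m\<in>Poly_Mapping.keys p. Poly_Mapping.single m (Poly_Mapping.lookup p m))"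
proof (rule poly_mapping_eqI)
  fix k
  show "Poly_Mapping.lookup p k = Poly_Mapping.lookup (\<Sum>m\<in>Poly_Mapping.keys p. Poly_Mapping.single m (Poly_Mapping.lookup p m)) k"
    by (simp add: lookup_sum lookup_single when_def sum.delta in_keys_iff)
qed

lemma poly_eval_mult: "poly_eval x (p * q) = poly_eval x p * poly_eval x q"
proof -
  have "p * q = (\<Sum>m\<in>Poly_Mapping.keys p. Poly_Mapping.single m (Poly_Mapping.lookup p m)) *
      (\<Sum>n\<in>Poly_Mapping.keys q. Poly_Mapping.single n (Poly_Mapping.lookup q n))"
    by (rule arg_cong2[where f = "(*)", OF poly_mapping_sum_single poly_mapping_sum_single])
  also have "\<dots> = (\<Sum>m\<in>Poly_Mapping.keys p. \<Sum>n\<in>Poly_Mapping.keys q.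
      Poly_Mapping.single (m + n) (Poly_Mapping.lookup p m * Poly_Mapping.lookup q n))"
    by (simp add: sum_product mult_single)
  finally have "p * q = \<dots>" .
  then show ?thesis
    by (simp add: poly_eval_sum poly_eval_monom_eval[of x p] poly_eval_monom_eval[of x q]
        sum_product monom_eval_add algebra_simps)
qed

lemma polys_in_iff: "p \<in> polys_in I \<longleftrightarrow> (\<forall>m\<in>Poly_Mapping.keys p. Poly_Mapping.keys m \<subseteq> I)"
  by (auto simp: polys_in_def poly_vars_def)

lemma polys_in_0 [simp]: "0 \<in> polys_in I"
  by (simp add: polys_in_def poly_vars_def)

lemma polys_in_single:
  "Poly_Mapping.keys m \<subseteq> I \<Longrightarrow> Poly_Mapping.single m c \<in> polys_in I"
  by (cases "c = 0") (auto simp: polys_in_iff)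

lemma polys_in_add: "p \<in> polys_in I \<Longrightarrow> q \<in> polys_in I \<Longrightarrow> p + q \<in> polys_in I"
  unfolding polys_in_iff using keys_add[of p q] by blast

lemma polys_in_sum: "(\<And>a. a \<in> A \<Longrightarrow> f a \<in> polys_in I) \<Longrightarrow> sum f A \<in> polys_in I"
  by (induction A rule: infinite_finite_induct) (auto intro: polys_in_add)

lemma polys_in_mult:
  assumes "p \<in> polys_in I" "q \<in> polys_in I"
  shows "p * q \<in> polys_in I"
  unfolding polys_in_iff
proof
  fix m assume "m \<in> Poly_Mapping.keys (p * q)"
  then obtain a b where "m = a + b" "a \<in> Poly_Mapping.keys p" "b \<in> Poly_Mapping.keys q"
    using keys_mult[of p q] by blast
  then show "Poly_Mapping.keys m \<subseteq> I"
    using assms unfolding polys_in_iff by (simp add: keys_add_nat)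
qed

lemma polys_in_mono: "I \<subseteq> J \<Longrightarrow> polys_in I \<subseteq> polys_in J"
  by (auto simp: polys_in_def)

text \<open>From here on functions are handled rather than polynomials: closure under the ring
  operations becomes a set of introduction rules, and no polynomial has to be written down.\<close>

definition polyfun :: "'v set \<Rightarrow> (('v \<Rightarrow> complex) \<Rightarrow> complex) set" where
  "polyfun I = (\<lambda>p x. poly_eval x p) ` polys_in I"

lemma polyfunI: "p \<in> polys_in I \<Longrightarrow> (\<lambda>x. poly_eval x p) \<in> polyfun I"
  by (auto simp: polyfun_def)

named_theorems polyfun_intros

lemma polyfun_const [polyfun_intros]: "(\<lambda>x. c) \<in> polyfun I"
proof -
  have "(\<lambda>x::'a \<Rightarrow> complex. poly_eval x (Poly_Mapping.single 0 c)) \<in> polyfun I"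
    by (intro polyfunI polys_in_single) simp
  then show ?thesis by simp
qed

lemma polyfun_var [polyfun_intros]: "v \<in> I \<Longrightarrow> (\<lambda>x. x v) \<in> polyfun I"
proof -
  assume "v \<in> I"
  then have "(\<lambda>x. poly_eval x (Poly_Mapping.single (Poly_Mapping.single v 1) 1)) \<in> polyfun I"
    by (intro polyfunI polys_in_single) simp
  then show ?thesis by simp
qed

lemma polyfun_add [polyfun_intros]:
  assumes "f \<in> polyfun I" "g \<in> polyfun I"
  shows "(\<lambda>x. f x + g x) \<in> polyfun I"
proof -
  obtain p q where "p \<in> polys_in I" "q \<in> polys_in I" "f = (\<lambda>x. poly_eval x p)" "g = (\<lambda>x. poly_eval x q)"
    using assms by (auto simp: polyfun_def)
  then show ?thesis using polyfunI[OF polys_in_add, of p I q] by (simp add: poly_eval_add)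
qed

lemma polyfun_mult [polyfun_intros]:
  assumes "f \<in> polyfun I" "g \<in> polyfun I"
  shows "(\<lambda>x. f x * g x) \<in> polyfun I"
proof -
  obtain p q where "p \<in> polys_in I" "q \<in> polys_in I" "f = (\<lambda>x. poly_eval x p)" "g = (\<lambda>x. poly_eval x q)"
    using assms by (auto simp: polyfun_def)
  then show ?thesis using polyfunI[OF polys_in_mult, of p I q] by (simp add: poly_eval_mult)
qed

lemma polyfun_uminus [polyfun_intros]: "f \<in> polyfun I \<Longrightarrow> (\<lambda>x. - f x) \<in> polyfun I"
  using polyfun_mult[OF polyfun_const[of "-1"], of f] by simp

lemma polyfun_diff [polyfun_intros]:
  "f \<in> polyfun I \<Longrightarrow> g \<in> polyfun I \<Longrightarrow> (\<lambda>x. f x - g x) \<in> polyfun I"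
  using polyfun_add[of f I "\<lambda>x. - g x"] polyfun_uminus[of g] by simp

lemma polyfun_divide_const [polyfun_intros]: "f \<in> polyfun I \<Longrightarrow> (\<lambda>x. f x / c) \<in> polyfun I"
  using polyfun_mult[OF _ polyfun_const[of "inverse c"], of f] by (simp add: field_simps)

lemma polyfun_power [polyfun_intros]: "f \<in> polyfun I \<Longrightarrow> (\<lambda>x. f x ^ n) \<in> polyfun I"
  by (induction n) (auto intro: polyfun_intros)

lemma polyfun_sum [polyfun_intros]:
  "(\<And>a. a \<in> A \<Longrightarrow> f a \<in> polyfun I) \<Longrightarrow> (\<lambda>x. \<Sum>a\<in>A. f a x) \<in> polyfun I"
  by (induction A rule: infinite_finite_induct) (auto intro: polyfun_intros)

lemma polyfun_prod [polyfun_intros]: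
  "(\<And>a. a \<in> A \<Longrightarrow> f a \<in> polyfun I) \<Longrightarrow> (\<lambda>x. \<Prod>a\<in>A. f a x) \<in> polyfun I"
  by (induction A rule: infinite_finite_induct) (auto intro: polyfun_intros)

lemma polyfun_mono: "I \<subseteq> J \<Longrightarrow> polyfun I \<subseteq> polyfun J"
  using polys_in_mono by (fastforce simp: polyfun_def)

text \<open>Powers, monomials and partial sums over the keys are built up in turn. \<open>Q\<close>
  carries membership along because the cases \<open>add\<close> and \<open>mult\<close> offer it as
  a hypothesis.\<close>

lemma polyfun_induct [consumes 1, case_names const var add mult]:
  assumes f: "f \<in> polyfun I"
    and const: "\<And>c. P (\<lambda>x. c)"
    and var: "\<And>v. v \<in> I \<Longrightarrow> P (\<lambda>x. x v)"
    and add: "\<And>f g. f \<in> polyfun I \<Longrightarrow> g \<in> polyfun I \<Longrightarrow> P f \<Longrightarrow> P g \<Longrightarrow> P (\<lambda>x. f x + g x)"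
    and mult: "\<And>f g. f \<in> polyfun I \<Longrightarrow> g \<in> polyfun I \<Longrightarrow> P f \<Longrightarrow> P g \<Longrightarrow> P (\<lambda>x. f x * g x)"
  shows "P f"
proof -
  define Q where "Q f \<longleftrightarrow> f \<in> polyfun I \<and> P f" for f
  have Qc: "Q (\<lambda>x. c)" for c
    by (auto simp: Q_def const intro: polyfun_intros)
  have Qa: "Q (\<lambda>x. f x + g x)" and Qm: "Q (\<lambda>x. f x * g x)" if "Q f" "Q g" for f g
    using that by (auto simp: Q_def add mult intro: polyfun_intros)
  have Qpow: "Q (\<lambda>x. x v ^ n)" if "v \<in> I" for v n
  proof (induction n)
    case (Suc n)
    have "Q (\<lambda>x. x v)" using var that by (auto simp: Q_def intro: polyfun_intros)
    from Qm[OF this Suc] show ?case by simp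
  qed (use Qc[of 1] in simp)
  have Qmon: "Q (\<lambda>x. \<Prod>v\<in>A. x v ^ n v)" if "A \<subseteq> I" for A n
    using that
  proof (induction A rule: infinite_finite_induct)
    case (insert a A)
    then show ?case using Qm[OF Qpow[of a "n a"]] by simp
  qed (use Qc[of 1] in simp_all)
  obtain p where p: "p \<in> polys_in I" "f = (\<lambda>x. poly_eval x p)"
    using f by (auto simp: polyfun_def)
  have "Q (\<lambda>x. \<Sum>m\<in>A. c m * monom_eval x m)" if "A \<subseteq> Poly_Mapping.keys p" for A c
    using that
  proof (induction A rule: infinite_finite_induct)
    case (insert a A)
    have "Poly_Mapping.keys a \<subseteq> I" using p insert.prems by (auto simp: polys_in_iff)
    then have "Q (\<lambda>x. c a * monom_eval x a)" unfolding monom_eval_def by (intro Qm Qc Qmon)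
    from Qa[OF this insert.IH] show ?case using insert by simp
  qed (use Qc[of 0] in simp_all)
  from this[of "Poly_Mapping.keys p" "Poly_Mapping.lookup p"] have "Q f"
    by (simp add: p poly_eval_monom_eval)
  then show ?thesis by (simp add: Q_def)
qed

lemma polyfun_cong: "f \<in> polyfun I \<Longrightarrow> (\<And>v. v \<in> I \<Longrightarrow> x v = y v) \<Longrightarrow> f x = f y"
  by (induction rule: polyfun_induct) simp_all

lemma poly_eval_cong:
  "p \<in> polys_in I \<Longrightarrow> (\<And>v. v \<in> I \<Longrightarrow> x v = y v) \<Longrightarrow> poly_eval x p = poly_eval y p"
  using polyfun_cong[OF polyfunI, of p I x y] by simp

text \<open>Collecting the monomials by their exponent at \<open>v\<close> turns \<open>p\<close>
  into a polynomial in one variable whose coefficients are free of \<open>v\<close>.\<close>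

lemma polys_in_expand:
  assumes p: "p \<in> polys_in (insert v S)"
  obtains n q where "\<And>i. q i \<in> polys_in (S - {v})"
    and "p = (\<Sum>i\<le>n. q i * Poly_Mapping.single (Poly_Mapping.single v i) 1)"
proof -
  define q where "q i = (\<Sum>m\<in>{m\<in>Poly_Mapping.keys p. Poly_Mapping.lookup m v = i}.
      Poly_Mapping.single (m - Poly_Mapping.single v i) (Poly_Mapping.lookup p m))" for i
  define n where "n = Max (insert 0 ((\<lambda>m. Poly_Mapping.lookup m v) ` Poly_Mapping.keys p))"
  have le: "Poly_Mapping.lookup m v \<le> n" if "m \<in> Poly_Mapping.keys p" for m
    unfolding n_def using that by (intro Max_ge) auto
  \<comment> \<open>Subtraction of exponents is truncated; it is undone here because precisely the
    exponent of \<open>v\<close> is removed.\<close>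
  have split: "m - Poly_Mapping.single v (Poly_Mapping.lookup m v) + Poly_Mapping.single v (Poly_Mapping.lookup m v) = m"
    for m :: "'a \<Rightarrow>\<^sub>0 nat"
    by (rule poly_mapping_eqI) (simp add: lookup_add lookup_minus lookup_single when_def)
  have qin: "q i \<in> polys_in (S - {v})" for i
    unfolding q_def
  proof (intro polys_in_sum polys_in_single subsetI)
    fix m w assume m: "m \<in> {m \<in> Poly_Mapping.keys p. Poly_Mapping.lookup m v = i}"
      and w: "w \<in> Poly_Mapping.keys (m - Poly_Mapping.single v i)"
    have "Poly_Mapping.lookup m w - Poly_Mapping.lookup (Poly_Mapping.single v i) w \<noteq> 0"
      using w by (simp only: in_keys_iff lookup_minus) simp
    then have "Poly_Mapping.lookup m w \<noteq> 0" "w \<noteq> v"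
      using m by (auto simp: lookup_single)
    then have "w \<noteq> v" "w \<in> Poly_Mapping.keys m" by (simp_all add: in_keys_iff)
    then show "w \<in> S - {v}" using p m unfolding polys_in_iff by blast
  qed
  have "(\<Sum>i\<le>n. q i * Poly_Mapping.single (Poly_Mapping.single v i) 1) =
      (\<Sum>i\<le>n. \<Sum>m\<in>{m\<in>Poly_Mapping.keys p. Poly_Mapping.lookup m v = i}. Poly_Mapping.single m (Poly_Mapping.lookup p m))"
    unfolding q_def sum_distrib_right
  proof (intro sum.cong refl)
    fix i m assume "m \<in> {m \<in> Poly_Mapping.keys p. Poly_Mapping.lookup m v = i}"
    then have "m - Poly_Mapping.single v i + Poly_Mapping.single v i = m" using split[of m] by blast
    then show "Poly_Mapping.single (m - Poly_Mapping.single v i) (Poly_Mapping.lookup p m) *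
        Poly_Mapping.single (Poly_Mapping.single v i) 1 = Poly_Mapping.single m (Poly_Mapping.lookup p m)"
      by (simp only: mult_single mult_1_right)
  qed
  also have "\<dots> = (\<Sum>m\<in>Poly_Mapping.keys p. Poly_Mapping.single m (Poly_Mapping.lookup p m))"
    by (rule sum.group) (use le in \<open>simp_all add: image_subset_iff\<close>)
  also have "\<dots> = p" by (rule poly_mapping_sum_single[symmetric])
  finally show thesis by (intro that[OF qin]) (rule sym)
qed

text \<open>Induction over the variables. Some coefficient with respect to \<open>v\<close> is
  nonzero and, by induction, does not vanish at a suitable point; what remains is a polynomial in
  one variable, with finitely many roots in an infinite disc.\<close>

lemma poly_eval_nonzero_polydisc:
  assumes "finite S" "p \<in> polys_in S" "p \<noteq> 0" "\<delta> > 0"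
  shows "\<exists>x. (\<forall>v\<in>S. norm (x v - c v) < \<delta>) \<and> poly_eval x p \<noteq> 0"
  using assms(1-3)
proof (induction S arbitrary: p)
  case empty
  then have k: "Poly_Mapping.keys p \<subseteq> {0}" by (auto simp: polys_in_iff)
  have "Poly_Mapping.lookup p 0 \<noteq> 0"
  proof
    assume "Poly_Mapping.lookup p 0 = 0"
    then have "Poly_Mapping.lookup p m = 0" for m
      using k not_in_keys_iff_lookup_eq_zero[of m p] by (cases "m = 0") auto
    then have "p = 0" by (intro poly_mapping_eqI) simp
    with empty show False by simp
  qed
  with k show ?case by (simp add: poly_eval_superset[of "{0}"])
next
  case (insert v S)
  obtain n q where q: "\<And>i. q i \<in> polys_in (S - {v})"
    "p = (\<Sum>i\<le>n. q i * Poly_Mapping.single (Poly_Mapping.single v i) 1)"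
    using polys_in_expand[OF insert.prems(1)] by blast
  have "\<exists>k\<le>n. q k \<noteq> 0"
  proof (rule ccontr)
    assume "\<not> ?thesis"
    then have "p = 0" unfolding q(2) by (intro sum.neutral) simp
    with insert.prems(2) show False by simp
  qed
  then obtain k where k: "k \<le> n" "q k \<noteq> 0" by blast
  have "S - {v} = S" using insert by auto
  then obtain x where x: "\<And>v. v \<in> S \<Longrightarrow> norm (x v - c v) < \<delta>" "poly_eval x (q k) \<noteq> 0"
    using insert.IH[of "q k"] q(1)[of k] k by auto
  have "finite {t. (\<Sum>i\<le>n. poly_eval x (q i) * t ^ i) = 0}"
    by (rule polyfun_roots_finite[of _ k]) (use k x in simp_all)
  moreover have "infinite (ball (c v) \<delta>)"
    using uncountable_ball[of \<delta> "c v"] assms(4) uncountable_infinite by blast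
  ultimately have "\<not> ball (c v) \<delta> \<subseteq> {t. (\<Sum>i\<le>n. poly_eval x (q i) * t ^ i) = 0}"
    using finite_subset by blast
  then obtain t where t: "t \<in> ball (c v) \<delta>" "(\<Sum>i\<le>n. poly_eval x (q i) * t ^ i) \<noteq> 0"
    by blast
  have "poly_eval (x(v := t)) (q i) = poly_eval x (q i)" for i
    by (rule poly_eval_cong[OF q(1)]) auto
  then have "poly_eval (x(v := t)) p \<noteq> 0"
    using t(2) unfolding q(2) by (simp add: poly_eval_sum poly_eval_mult)
  moreover have "\<forall>w\<in>insert v S. norm ((x(v := t)) w - c w) < \<delta>"
    using x(1) t(1) by (auto simp: dist_norm norm_minus_commute)
  ultimately show ?case by blast
qed

section \<open>Irreducible closed sets and chains\<close>

lemma zariski_closed_subset: "zariski_closed I Z \<Longrightarrow> Z \<subseteq> affine_space I"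
  by (auto simp: zariski_closed_def zero_locus_def)

lemma zariski_closed_Int_zero:
  assumes "zariski_closed I Z" "p \<in> polys_in I"
  shows "zariski_closed I {x \<in> Z. poly_eval x p = 0}"
proof -
  obtain P where P: "P \<subseteq> polys_in I" "Z = zero_locus I P"
    using assms(1) by (auto simp: zariski_closed_def)
  have "{x \<in> Z. poly_eval x p = 0} = zero_locus I (insert p P)"
    unfolding P(2) by (auto simp: zero_locus_def)
  moreover have "insert p P \<subseteq> polys_in I" using P assms by auto
  ultimately show ?thesis unfolding zariski_closed_def by blast
qed

lemma zariski_closed_affine_space: "zariski_closed I (affine_space I)"
  unfolding zariski_closed_def by (rule exI[of _ "{}"]) (auto simp: zero_locus_def)

lemma zariski_closed_separation:
  assumes "zariski_closed I A" "B \<subseteq> affine_space I" "\<not> B \<subseteq> A"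
  obtains f where "f \<in> polyfun I" "\<And>x. x \<in> A \<Longrightarrow> f x = 0" "\<exists>x\<in>B. f x \<noteq> 0"
proof -
  obtain P where P: "P \<subseteq> polys_in I" "A = zero_locus I P"
    using assms(1) by (auto simp: zariski_closed_def)
  obtain x where x: "x \<in> B" "x \<notin> A" using assms(3) by blast
  then have "x \<in> affine_space I" using assms(2) by blast
  then obtain p where p: "p \<in> P" "poly_eval x p \<noteq> 0" using x(2) unfolding P(2) zero_locus_def by blast
  show thesis
  proof (rule that[of "\<lambda>x. poly_eval x p"])
    show "(\<lambda>x. poly_eval x p) \<in> polyfun I" using p P(1) by (intro polyfunI) blast
    show "\<And>x. x \<in> A \<Longrightarrow> poly_eval x p = 0" using p unfolding P(2) zero_locus_def by blast
    show "\<exists>x\<in>B. poly_eval x p \<noteq> 0" using x p by blast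
  qed
qed

lemma subset_zariski_closure: "Y \<subseteq> zariski_closure I Y"
  unfolding zariski_closure_def by blast

lemma zariski_closure_minimal: "zariski_closed I Z \<Longrightarrow> Y \<subseteq> Z \<Longrightarrow> zariski_closure I Y \<subseteq> Z"
  unfolding zariski_closure_def by blast

lemma zariski_closure_mono: "Y \<subseteq> Y' \<Longrightarrow> zariski_closure I Y \<subseteq> zariski_closure I Y'"
  unfolding zariski_closure_def by blast

text \<open>The intersection of all closed sets containing \<open>Y\<close> is the zero locus of all
  polynomials that vanish on \<open>Y\<close>.\<close>

lemma zariski_closed_closure:
  assumes "Y \<subseteq> affine_space I"
  shows "zariski_closed I (zariski_closure I Y)"
proof -
  let ?P = "{p \<in> polys_in I. \<forall>x\<in>Y. poly_eval x p = 0}"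
  have closed: "zariski_closed I (zero_locus I ?P)"
    unfolding zariski_closed_def by (rule exI[of _ ?P]) blast
  have "zariski_closure I Y = zero_locus I ?P"
  proof
    have "Y \<subseteq> zero_locus I ?P" using assms unfolding zero_locus_def by blast
    then show "zariski_closure I Y \<subseteq> zero_locus I ?P" by (rule zariski_closure_minimal[OF closed])
    show "zero_locus I ?P \<subseteq> zariski_closure I Y"
      unfolding zariski_closure_def
    proof (intro Inter_greatest)
      fix Z assume "Z \<in> {Z. zariski_closed I Z \<and> Y \<subseteq> Z}"
      then obtain P where P: "P \<subseteq> polys_in I" "Z = zero_locus I P" "Y \<subseteq> Z"
        unfolding zariski_closed_def by blast
      then have "P \<subseteq> ?P" unfolding zero_locus_def by blast
      then show "zero_locus I ?P \<subseteq> Z" unfolding P(2) zero_locus_def by blast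
    qed
  qed
  with closed show ?thesis by simp
qed

lemma polyfun_zero_closure:
  assumes "f \<in> polyfun I" "Y \<subseteq> affine_space I" "\<And>x. x \<in> Y \<Longrightarrow> f x = 0" "x \<in> zariski_closure I Y"
  shows "f x = 0"
proof -
  obtain p where p: "p \<in> polys_in I" "\<And>x. f x = poly_eval x p"
    using assms(1) unfolding polyfun_def by auto
  have "zariski_closure I Y \<subseteq> {x \<in> affine_space I. poly_eval x p = 0}"
    by (intro zariski_closure_minimal zariski_closed_Int_zero zariski_closed_affine_space p)
      (use assms(2,3) p in auto)
  with assms(4) p show ?thesis by auto
qed

text \<open>\<open>Z\<close> is the union of the closed subsets on which \<open>f\<close> and
  \<open>g\<close> vanish. Irreducibility thus says that the coordinate ring of \<open>Z\<close> is
  an integral domain.\<close>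

lemma irreducible_closed_prime:
  assumes "irreducible_closed I Z" "f \<in> polyfun I" "g \<in> polyfun I"
    and "\<And>x. x \<in> Z \<Longrightarrow> f x * g x = 0"
  shows "(\<forall>x\<in>Z. f x = 0) \<or> (\<forall>x\<in>Z. g x = 0)"
proof -
  obtain p where p: "p \<in> polys_in I" "\<And>x. f x = poly_eval x p" using assms(2) unfolding polyfun_def by auto
  obtain q where q: "q \<in> polys_in I" "\<And>x. g x = poly_eval x q" using assms(3) unfolding polyfun_def by auto
  have Z: "zariski_closed I Z" using assms(1) by (simp add: irreducible_closed_def)
  have "zariski_closed I {x\<in>Z. f x = 0}" "zariski_closed I {x\<in>Z. g x = 0}"
    using zariski_closed_Int_zero[OF Z p(1)] zariski_closed_Int_zero[OF Z q(1)] by (simp_all add: p q)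
  moreover have "Z = {x\<in>Z. f x = 0} \<union> {x\<in>Z. g x = 0}" using assms(4) by auto
  ultimately have "Z = {x\<in>Z. f x = 0} \<or> Z = {x\<in>Z. g x = 0}"
    using assms(1) unfolding irreducible_closed_def by blast
  then show ?thesis by blast
qed

lemma irreducible_closed_cancel:
  assumes "irreducible_closed I Z" "f \<in> polyfun I" "g \<in> polyfun I" "\<exists>x\<in>Z. f x \<noteq> 0"
    and "\<And>x. x \<in> Z \<Longrightarrow> f x * g x = 0" "x \<in> Z"
  shows "g x = 0"
  using irreducible_closed_prime[OF assms(1-3,5)] assms(4,6) by blast

text \<open>Induction on \<open>d\<close>. A relation on the top set is a polynomial in the last
  function with coefficients in the earlier ones. Irreducibility of the top set allows division by a
  power of the last function; restriction to the next lower set, where that function vanishes,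
  isolates the lowest coefficient, which is a relation of the same kind for a shorter chain.\<close>

lemma chain_independent:
  fixes f :: "nat \<Rightarrow> ('v \<Rightarrow> complex) \<Rightarrow> complex"
  assumes "\<And>k. k \<le> d \<Longrightarrow> irreducible_closed I (Z k)"
    and "\<And>k. k < d \<Longrightarrow> Z k \<subseteq> Z (Suc k)"
    and "\<And>k. k < d \<Longrightarrow> f k \<in> polyfun I"
    and "\<And>k x. k < d \<Longrightarrow> x \<in> Z k \<Longrightarrow> f k x = 0"
    and "\<And>k. k < d \<Longrightarrow> \<exists>x\<in>Z (Suc k). f k x \<noteq> 0"
    and "\<And>x. x \<in> Z d \<Longrightarrow> (\<Sum>\<alpha>\<in>{..<d} \<rightarrow>\<^sub>E {..N::nat}. c \<alpha> * (\<Prod>k<d. f k x ^ \<alpha> k)) = 0"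
    and "\<alpha> \<in> {..<d} \<rightarrow>\<^sub>E {..N}"
  shows "c \<alpha> = 0"
  using assms
proof (induction d arbitrary: c \<alpha>)
  case 0
  obtain x where "x \<in> Z 0" using "0.prems"(1)[of 0] by (auto simp: irreducible_closed_def)
  from "0.prems"(6)[OF this] "0.prems"(7) show ?case by simp
next
  case (Suc d)
  define P where "P i x = (\<Sum>\<beta>\<in>{..<d} \<rightarrow>\<^sub>E {..N}. c (\<beta>(d := i)) * (\<Prod>k<d. f k x ^ \<beta> k))" for i x
  have Pf: "P i \<in> polyfun I" for i
    unfolding P_def by (intro polyfun_intros Suc.prems(3)) auto
  have expand: "(\<Sum>\<alpha>\<in>{..<Suc d} \<rightarrow>\<^sub>E {..N}. c \<alpha> * (\<Prod>k<Suc d. f k x ^ \<alpha> k)) = (\<Sum>i\<le>N. f d x ^ i * P i x)" for x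
  proof -
    have inj: "inj_on (\<lambda>(y, g). g(d := y)) ({..N} \<times> ({..<d} \<rightarrow>\<^sub>E {..N}))"
      using inj_combinator[of d "{..<d}" "\<lambda>_. {..N}"] by simp
    have eq: "{..<Suc d} \<rightarrow>\<^sub>E {..N} = (\<lambda>(y, g). g(d := y)) ` ({..N} \<times> ({..<d} \<rightarrow>\<^sub>E {..N}))"
      by (simp add: lessThan_Suc PiE_insert_eq)
    have "(\<Sum>\<alpha>\<in>{..<Suc d} \<rightarrow>\<^sub>E {..N}. c \<alpha> * (\<Prod>k<Suc d. f k x ^ \<alpha> k)) =
        (\<Sum>(i, \<beta>)\<in>{..N} \<times> ({..<d} \<rightarrow>\<^sub>E {..N}). c (\<beta>(d := i)) * (\<Prod>k<Suc d. f k x ^ (\<beta>(d := i)) k))"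
      unfolding eq by (subst sum.reindex[OF inj]) (simp add: case_prod_unfold)
    also have "\<dots> = (\<Sum>i\<le>N. \<Sum>\<beta>\<in>{..<d} \<rightarrow>\<^sub>E {..N}. c (\<beta>(d := i)) * (\<Prod>k<Suc d. f k x ^ (\<beta>(d := i)) k))"
      by (simp add: sum.cartesian_product)
    also have "\<dots> = (\<Sum>i\<le>N. f d x ^ i * P i x)"
      unfolding P_def sum_distrib_left by (intro sum.cong refl) simp
    finally show ?thesis .
  qed
  have fd: "f d \<in> polyfun I" and irr: "irreducible_closed I (Z (Suc d))"
    using Suc.prems by auto
  have "\<forall>\<beta>\<in>{..<d} \<rightarrow>\<^sub>E {..N}. c (\<beta>(d := i)) = 0" if "i \<le> N" for i
    using that
  proof (induction i rule: less_induct)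
    case (less i)
    \<comment> \<open>The relation divided by \<open>f d ^ i\<close>; the coefficients below
      \<open>i\<close> are already known to vanish.\<close>
    define S where "S x = (\<Sum>j\<in>{i..N}. f d x ^ (j - i) * P j x)" for x
    have low: "P j x = 0" if "j < i" for j x
      unfolding P_def
    proof (intro sum.neutral ballI)
      fix \<beta> assume "\<beta> \<in> {..<d} \<rightarrow>\<^sub>E {..N}"
      then have "c (\<beta>(d := j)) = 0" using less.IH[OF that] less.prems that by (meson less_imp_le_nat order_trans)
      then show "c (\<beta>(d := j)) * (\<Prod>k<d. f k x ^ \<beta> k) = 0" by (simp only: mult_zero_left)
    qed
    have Sf: "S \<in> polyfun I" unfolding S_def by (intro polyfun_intros fd Pf)
    have S0: "S x = 0" if x: "x \<in> Z (Suc d)" for x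
    proof (rule irreducible_closed_cancel[OF irr _ Sf _ _ x, of "\<lambda>x. f d x ^ i"])
      show "(\<lambda>x. f d x ^ i) \<in> polyfun I" by (intro polyfun_intros fd)
      show "\<exists>x\<in>Z (Suc d). f d x ^ i \<noteq> 0" using Suc.prems(5)[of d] by auto
      fix y assume y: "y \<in> Z (Suc d)"
      have "f d y ^ i * S y = (\<Sum>j\<in>{i..N}. f d y ^ j * P j y)"
        unfolding S_def sum_distrib_left
        by (intro sum.cong refl) (simp flip: mult.assoc power_add)
      also have "\<dots> = (\<Sum>j\<le>N. f d y ^ j * P j y)"
        by (rule sum.mono_neutral_left) (use low in auto)
      also have "\<dots> = 0" using expand[of y] Suc.prems(6)[OF y] by (simp only:)
      finally show "f d y ^ i * S y = 0" .
    qed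
    have "P i x = 0" if x: "x \<in> Z d" for x
    proof -
      have "f d x = 0" using Suc.prems(4)[of d x] x by simp
      then have "S x = (\<Sum>j\<in>{i..N}. if j = i then P i x else 0)"
        unfolding S_def by (intro sum.cong refl) (simp add: power_0_left)
      also have "\<dots> = P i x" using less.prems by simp
      finally show ?thesis using S0 x Suc.prems(2)[of d] by auto
    qed
    then have *: "(\<Sum>\<beta>\<in>{..<d} \<rightarrow>\<^sub>E {..N}. c (\<beta>(d := i)) * (\<Prod>k<d. f k x ^ \<beta> k)) = 0" if "x \<in> Z d" for x
      using that unfolding P_def by blast
    show ?case
    proof
      fix \<beta> assume "\<beta> \<in> {..<d} \<rightarrow>\<^sub>E {..N}"
      show "c (\<beta>(d := i)) = 0"
      proof (rule Suc.IH[of "\<lambda>\<beta>. c (\<beta>(d := i))" \<beta>])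
        fix k assume k: "k < d"
        show "Z k \<subseteq> Z (Suc k)" "f k \<in> polyfun I" "\<exists>x\<in>Z (Suc k). f k x \<noteq> 0"
          using k Suc.prems(2,3,5)[of k] by simp_all
        show "f k x = 0" if "x \<in> Z k" for x using k that Suc.prems(4)[of k x] by simp
      next
        fix k assume "k \<le> d"
        then show "irreducible_closed I (Z k)" using Suc.prems(1)[of k] by simp
      qed (fact * \<open>\<beta> \<in> _\<close>)+
    qed
  qed
  moreover have "\<alpha> d \<le> N" "restrict \<alpha> {..<d} \<in> {..<d} \<rightarrow>\<^sub>E {..N}" "\<alpha> = (restrict \<alpha> {..<d})(d := \<alpha> d)"
  proof -
    show "\<alpha> d \<le> N" using PiE_mem[OF Suc.prems(7), of d] by simp
    show "restrict \<alpha> {..<d} \<in> {..<d} \<rightarrow>\<^sub>E {..N}"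
      using PiE_mem[OF Suc.prems(7)] by (simp add: restrict_PiE_iff)
    show "\<alpha> = (restrict \<alpha> {..<d})(d := \<alpha> d)"
    proof
      fix k
      show "\<alpha> k = ((restrict \<alpha> {..<d})(d := \<alpha> d)) k"
        using PiE_arb[OF Suc.prems(7), of k] by (cases "k < d"; cases "k = d") simp_all
    qed
  qed
  ultimately have "c ((restrict \<alpha> {..<d})(d := \<alpha> d)) = 0" by blast
  then show ?case by (subst \<open>\<alpha> = (restrict \<alpha> {..<d})(d := \<alpha> d)\<close>)
qed

text \<open>A nontrivial equation determines one unknown \<open>p0\<close> from the others;
  substituting it leaves one equation and one unknown fewer.\<close>

lemma homogeneous_system_nontrivial:
  fixes a :: "'p \<Rightarrow> 'q \<Rightarrow> complex"
  assumes "finite Q" "finite P" "card Q < card P"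
  shows "\<exists>c. (\<exists>p\<in>P. c p \<noteq> 0) \<and> (\<forall>q\<in>Q. (\<Sum>p\<in>P. c p * a p q) = 0)"
  using assms
proof (induction Q arbitrary: P a)
  case empty
  then have "\<exists>p. p \<in> P" by (auto simp: card_gt_0_iff)
  then show ?case by (intro exI[of _ "\<lambda>_. 1"]) auto
next
  case (insert q Q)
  show ?case
  proof (cases "\<forall>p\<in>P. a p q = 0")
    case True
    have "card Q < card P" using insert.prems insert.hyps by simp
    then obtain c where c: "\<exists>p\<in>P. c p \<noteq> 0" "\<forall>q\<in>Q. (\<Sum>p\<in>P. c p * a p q) = 0"
      using insert.IH[OF insert.prems(1), of a] by blast
    then show ?thesis using True by (intro exI[of _ c]) auto
  next
    case False
    then obtain p0 where p0: "p0 \<in> P" "a p0 q \<noteq> 0" by blast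
    let ?P = "P - {p0}"
    let ?a = "\<lambda>p r. a p r - a p q / a p0 q * a p0 r"
    have "card Q < card ?P" using insert.prems insert.hyps p0 by simp
    then obtain c where c: "\<exists>p\<in>?P. c p \<noteq> 0" "\<forall>r\<in>Q. (\<Sum>p\<in>?P. c p * ?a p r) = 0"
      using insert.IH[of ?P ?a] insert.prems(1) by blast
    define c' where "c' = c(p0 := - (\<Sum>p\<in>?P. c p * (a p q / a p0 q)))"
    have split: "(\<Sum>p\<in>P. c' p * a p r) = (\<Sum>p\<in>?P. c p * ?a p r)" for r
    proof -
      have "(\<Sum>p\<in>P. c' p * a p r) = c' p0 * a p0 r + (\<Sum>p\<in>?P. c' p * a p r)"
        using insert.prems(1) p0(1) by (simp add: sum.remove)
      also have "(\<Sum>p\<in>?P. c' p * a p r) = (\<Sum>p\<in>?P. c p * a p r)"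
        by (intro sum.cong refl) (auto simp: c'_def)
      finally show ?thesis
        by (simp add: c'_def right_diff_distrib sum_subtractf sum_distrib_right mult.assoc)
    qed
    have "(\<Sum>p\<in>P. c' p * a p q) = 0" unfolding split using p0(2) by simp
    then have "\<forall>r\<in>insert q Q. (\<Sum>p\<in>P. c' p * a p r) = 0"
      using c(2) by (auto simp: split)
    moreover have "\<exists>p\<in>P. c' p \<noteq> 0" using c(1) by (auto simp: c'_def)
    ultimately show ?thesis by blast
  qed
qed

section \<open>Generically finite coordinate rings\<close>

text \<open>Membership in a module over the coordinate ring. Only values on \<open>Z\<close> are
  compared, so no quotient ring has to be formed.\<close>

definition gmod :: "'v set \<Rightarrow> ('v \<Rightarrow> complex) set \<Rightarrow> (('v \<Rightarrow> complex) \<Rightarrow> complex) set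
    \<Rightarrow> (('v \<Rightarrow> complex) \<Rightarrow> complex) \<Rightarrow> bool" where
  "gmod T Z B f \<longleftrightarrow> (\<exists>r. (\<forall>b\<in>B. r b \<in> polyfun T) \<and> (\<forall>x\<in>Z. f x = (\<Sum>b\<in>B. r b x * b x)))"

lemma gmod_cong: "gmod T Z B f \<Longrightarrow> (\<And>x. x \<in> Z \<Longrightarrow> f x = g x) \<Longrightarrow> gmod T Z B g"
  unfolding gmod_def by auto

lemma gmod_scale:
  assumes "finite B" "b \<in> B" "c \<in> polyfun T"
  shows "gmod T Z B (\<lambda>x. c x * b x)"
  unfolding gmod_def
proof (intro exI[of _ "\<lambda>b'. if b' = b then c else (\<lambda>x. 0)"] conjI ballI)
  fix b' show "(if b' = b then c else (\<lambda>x. 0)) \<in> polyfun T" using assms polyfun_const by auto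
next
  fix x
  have "(\<Sum>b'\<in>B. (if b' = b then c else (\<lambda>x. 0)) x * b' x) = (\<Sum>b'\<in>B. if b' = b then c x * b x else 0)"
    by (intro sum.cong) auto
  also have "\<dots> = c x * b x" using assms by simp
  finally show "c x * b x = (\<Sum>b'\<in>B. (if b' = b then c else (\<lambda>x. 0)) x * b' x)" by (rule sym)
qed

lemma gmod_base: "finite B \<Longrightarrow> b \<in> B \<Longrightarrow> gmod T Z B b"
  using gmod_scale[OF _ _ polyfun_const, of B b T Z 1] by simp

lemma gmod_zero: "gmod T Z B (\<lambda>x. 0)"
  unfolding gmod_def by (intro exI[of _ "\<lambda>_ _. 0"]) (simp add: polyfun_const)

lemma gmod_add:
  assumes "gmod T Z B f" "gmod T Z B g"
  shows "gmod T Z B (\<lambda>x. f x + g x)"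
proof -
  obtain r where r: "\<And>b. b \<in> B \<Longrightarrow> r b \<in> polyfun T" "\<And>x. x \<in> Z \<Longrightarrow> f x = (\<Sum>b\<in>B. r b x * b x)"
    using assms(1) unfolding gmod_def by blast
  obtain s where s: "\<And>b. b \<in> B \<Longrightarrow> s b \<in> polyfun T" "\<And>x. x \<in> Z \<Longrightarrow> g x = (\<Sum>b\<in>B. s b x * b x)"
    using assms(2) unfolding gmod_def by blast
  show ?thesis
    unfolding gmod_def
  proof (intro exI[of _ "\<lambda>b x. r b x + s b x"] conjI ballI)
    show "(\<lambda>x. r b x + s b x) \<in> polyfun T" if "b \<in> B" for b
      using r(1) s(1) that by (intro polyfun_add)
    show "f x + g x = (\<Sum>b\<in>B. (r b x + s b x) * b x)" if "x \<in> Z" for x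
      using r(2)[OF that] s(2)[OF that] by (simp add: distrib_right sum.distrib)
  qed
qed

lemma gmod_sum: "(\<And>a. a \<in> A \<Longrightarrow> gmod T Z B (f a)) \<Longrightarrow> gmod T Z B (\<lambda>x. \<Sum>a\<in>A. f a x)"
  by (induction A rule: infinite_finite_induct) (auto intro: gmod_add gmod_zero)

lemma gmod_mult_polyfun:
  assumes "gmod T Z B f" "c \<in> polyfun T"
  shows "gmod T Z B (\<lambda>x. c x * f x)"
proof -
  obtain r where r: "\<And>b. b \<in> B \<Longrightarrow> r b \<in> polyfun T" "\<And>x. x \<in> Z \<Longrightarrow> f x = (\<Sum>b\<in>B. r b x * b x)"
    using assms(1) unfolding gmod_def by blast
  show ?thesis
    unfolding gmod_def
  proof (intro exI[of _ "\<lambda>b x. c x * r b x"] conjI ballI)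
    show "(\<lambda>x. c x * r b x) \<in> polyfun T" if "b \<in> B" for b
      using r(1) assms(2) that by (intro polyfun_mult)
    show "c x * f x = (\<Sum>b\<in>B. (c x * r b x) * b x)" if "x \<in> Z" for x
      using r(2)[OF that] by (simp add: sum_distrib_left mult.assoc)
  qed
qed

lemma gmod_subst:
  assumes "gmod T Z B f" "\<And>b. b \<in> B \<Longrightarrow> gmod T Z B' (\<lambda>x. b x * g x)"
  shows "gmod T Z B' (\<lambda>x. f x * g x)"
proof -
  obtain r where r: "\<And>b. b \<in> B \<Longrightarrow> r b \<in> polyfun T" "\<And>x. x \<in> Z \<Longrightarrow> f x = (\<Sum>b\<in>B. r b x * b x)"
    using assms(1) unfolding gmod_def by blast
  have "gmod T Z B' (\<lambda>x. \<Sum>b\<in>B. r b x * (b x * g x))"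
    by (intro gmod_sum gmod_mult_polyfun assms(2) r(1))
  then show ?thesis
    by (rule gmod_cong) (simp add: r(2) sum_distrib_right mult.assoc)
qed

text \<open>
  The fraction field of the coordinate ring of \<open>Z\<close> is finite over that of the polynomials in \<open>T\<close>:
  after multiplication by a denominator \<open>h\<close>, the ring acts on the finitely generated module spanned by \<open>B\<close>.
\<close>

definition genfin where
  "genfin I T Z h B \<longleftrightarrow> h \<in> polyfun I \<and> (\<exists>x\<in>Z. h x \<noteq> 0) \<and> finite B \<and> B \<subseteq> polyfun I \<and> (\<lambda>_. 1) \<in> B \<and>
     (\<forall>b\<in>B. gmod T Z B (\<lambda>x. h x * b x))"

text \<open>Multiplication by \<open>f\<close> preserves the module spanned by \<open>B\<close> once
  \<open>h\<close> is inverted. This replaces algebraicity over the polynomials in \<open>T\<close>;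
  unlike a minimal polynomial, it is visibly inherited by sums and products.\<close>

definition galg where
  "galg T Z h B f \<longleftrightarrow> (\<exists>n. \<forall>b\<in>B. gmod T Z B (\<lambda>x. h x ^ n * f x * b x))"

lemma gmod_mult_power:
  assumes "genfin I T Z h B" "gmod T Z B f"
  shows "gmod T Z B (\<lambda>x. h x ^ k * f x)"
proof (induction k)
  case (Suc k)
  have "gmod T Z B (\<lambda>x. (h x ^ k * f x) * h x)"
    by (rule gmod_subst[OF Suc]) (use assms(1) in \<open>simp add: genfin_def mult.commute\<close>)
  then show ?case by (rule gmod_cong) simp
qed (use assms(2) in simp)

lemma galg_raise:
  assumes "genfin I T Z h B" "\<And>b. b \<in> B \<Longrightarrow> gmod T Z B (\<lambda>x. h x ^ n * f x * b x)" "n \<le> m" "b \<in> B"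
  shows "gmod T Z B (\<lambda>x. h x ^ m * f x * b x)"
proof -
  have "h x ^ (m - n) * (h x ^ n * f x * b x) = h x ^ m * f x * b x" for x
    using assms(3) by (simp flip: mult.assoc power_add)
  with gmod_mult_power[OF assms(1) assms(2)[OF assms(4)], of "m - n"] show ?thesis by simp
qed

lemma galg_add:
  assumes "genfin I T Z h B" "galg T Z h B f" "galg T Z h B g"
  shows "galg T Z h B (\<lambda>x. f x + g x)"
proof -
  obtain n where n: "\<And>b. b \<in> B \<Longrightarrow> gmod T Z B (\<lambda>x. h x ^ n * f x * b x)" using assms(2) unfolding galg_def by blast
  obtain m where m: "\<And>b. b \<in> B \<Longrightarrow> gmod T Z B (\<lambda>x. h x ^ m * g x * b x)" using assms(3) unfolding galg_def by blast
  show ?thesis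
    unfolding galg_def
  proof (intro exI[of _ "n + m"] ballI)
    fix b assume b: "b \<in> B"
    have "gmod T Z B (\<lambda>x. h x ^ (n + m) * f x * b x + h x ^ (n + m) * g x * b x)"
      using n m b by (intro gmod_add galg_raise[OF assms(1) n] galg_raise[OF assms(1) m]) auto
    then show "gmod T Z B (\<lambda>x. h x ^ (n + m) * (f x + g x) * b x)"
      by (rule gmod_cong) (simp add: algebra_simps)
  qed
qed

lemma galg_mult:
  assumes "genfin I T Z h B" "galg T Z h B f" "galg T Z h B g"
  shows "galg T Z h B (\<lambda>x. f x * g x)"
proof -
  obtain n where n: "\<And>b. b \<in> B \<Longrightarrow> gmod T Z B (\<lambda>x. h x ^ n * f x * b x)" using assms(2) unfolding galg_def by blast
  obtain m where m: "\<And>b. b \<in> B \<Longrightarrow> gmod T Z B (\<lambda>x. h x ^ m * g x * b x)" using assms(3) unfolding galg_def by blast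
  show ?thesis
    unfolding galg_def
  proof (intro exI[of _ "n + m"] ballI)
    fix b assume b: "b \<in> B"
    have "gmod T Z B (\<lambda>x. (h x ^ n * f x * b x) * (h x ^ m * g x))"
      by (rule gmod_subst[OF n[OF b]]) (use m in \<open>simp add: mult.commute\<close>)
    then show "gmod T Z B (\<lambda>x. h x ^ (n + m) * (f x * g x) * b x)"
      by (rule gmod_cong) (simp add: power_add algebra_simps)
  qed
qed

lemma galg_polyfun_base:
  assumes "genfin I T Z h B" "c \<in> polyfun T"
  shows "galg T Z h B c"
  unfolding galg_def
proof (intro exI[of _ 0] ballI)
  fix b assume "b \<in> B"
  then show "gmod T Z B (\<lambda>x. h x ^ 0 * c x * b x)"
    using gmod_scale[of B b c T Z] assms by (simp add: genfin_def)
qed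

lemma galg_cong: "galg T Z h B f \<Longrightarrow> (\<And>x. x \<in> Z \<Longrightarrow> f x = g x) \<Longrightarrow> galg T Z h B g"
  unfolding galg_def using gmod_cong[of T Z B "\<lambda>x. h x ^ n * f x * b x" "\<lambda>x. h x ^ n * g x * b x" for n b]
  by fastforce

lemma galg_polyfun:
  assumes "genfin I T Z h B" "\<And>v. v \<in> J \<Longrightarrow> galg T Z h B (\<lambda>x. x v)" "f \<in> polyfun J"
  shows "galg T Z h B f"
  using assms(3)
proof (induction rule: polyfun_induct)
  case (const c)
  then show ?case by (rule galg_polyfun_base[OF assms(1) polyfun_const])
next
  case (add f g)
  show ?case by (rule galg_add[OF assms(1) add(3,4)])
next
  case (mult f g)
  show ?case by (rule galg_mult[OF assms(1) mult(3,4)])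
qed (rule assms(2))

lemma genfin_trivial:
  assumes "T \<subseteq> I" "Z \<noteq> {}"
  shows "genfin I T Z (\<lambda>_. 1) {\<lambda>_. 1}"
  unfolding genfin_def
proof (intro conjI ballI)
  show "gmod T Z {\<lambda>_. 1} (\<lambda>x. 1 * b x)" if "b \<in> {\<lambda>_. 1}" for b
    using gmod_base[OF _ that] by simp
qed (use assms polyfun_const in auto)

lemma galg_common_exponent:
  assumes "genfin I T Z h B" "finite A" "\<And>a. a \<in> A \<Longrightarrow> galg T Z h B (f a)"
  shows "\<exists>n. \<forall>a\<in>A. \<forall>b\<in>B. gmod T Z B (\<lambda>x. h x ^ n * f a x * b x)"
  using assms(2,3)
proof (induction A)
  case (insert a A)
  obtain n where n: "\<forall>a\<in>A. \<forall>b\<in>B. gmod T Z B (\<lambda>x. h x ^ n * f a x * b x)"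
    using insert.IH insert.prems by blast
  obtain m where m: "\<forall>b\<in>B. gmod T Z B (\<lambda>x. h x ^ m * f a x * b x)"
    using insert.prems[of a] unfolding galg_def by blast
  show ?case
  proof (intro exI[of _ "n + m"] ballI)
    fix a' b assume a': "a' \<in> insert a A" and b: "b \<in> B"
    show "gmod T Z B (\<lambda>x. h x ^ (n + m) * f a' x * b x)"
    proof (cases "a' = a")
      case True
      show ?thesis unfolding True by (rule galg_raise[OF assms(1), of m]) (use m b in auto)
    next
      case False
      then have "a' \<in> A" using a' by simp
      show ?thesis by (rule galg_raise[OF assms(1), of n]) (use n b \<open>a' \<in> A\<close> in auto)
    qed
  qed
qed simp

text \<open>Adjoining a root \<open>c\<close>: up to the factor \<open>a n\<close>, the relation
  expresses the power \<open>n\<close> of \<open>c\<close> by lower ones, so the products of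
  \<open>B\<close> with 1, c, ..., c^(n-1) generate the new module. The leading coefficient may
  vanish at points of \<open>Z\<close> and is therefore absorbed into the denominator.\<close>

lemma genfin_extend:
  assumes irr: "irreducible_closed I Z" and gf: "genfin I T Z h B"
    and c: "c \<in> polyfun I" and n: "n \<ge> 1"
    and a: "\<And>i. i \<le> n \<Longrightarrow> a i \<in> polyfun I" "\<And>i. i \<le> n \<Longrightarrow> galg T Z h B (a i)"
    and an: "\<exists>x\<in>Z. a n x \<noteq> 0"
    and rel: "\<And>x. x \<in> Z \<Longrightarrow> (\<Sum>i\<le>n. a i x * c x ^ i) = 0"
  shows "\<exists>h' B'. genfin I T Z h' B' \<and> galg T Z h' B' c \<and> (\<forall>f. galg T Z h B f \<longrightarrow> galg T Z h' B' f)"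
proof -
  note gf' = gf[unfolded genfin_def]
  obtain s where s: "\<forall>i\<in>{..n}. \<forall>b\<in>B. gmod T Z B (\<lambda>x. h x ^ s * a i x * b x)"
    using galg_common_exponent[OF gf, of "{..n}" a] a(2) by auto
  \<comment> \<open>\<open>Suc s\<close> instead of \<open>s\<close>: each power of
    \<open>h'\<close> then contains the same power of \<open>h\<close>, so that what was algebraic
    for the old denominator stays algebraic for the new one.\<close>
  define h' where "h' x = h x ^ Suc s * a n x" for x
  define B' where "B' = (\<lambda>(b, l) x. b x * c x ^ l) ` (B \<times> {..<n})"
  have finB': "finite B'" using gf' unfolding B'_def by simp
  have lift: "gmod T Z B' (\<lambda>x. g x * c x ^ l)" if "gmod T Z B g" "l < n" for g l
    by (rule gmod_subst[OF that(1)], rule gmod_base[OF finB']) (use that(2) in \<open>auto simp: B'_def\<close>)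
  have cs: "gmod T Z B (\<lambda>x. h x ^ Suc s * a i x * b x)" if "i \<le> n" "b \<in> B" for i b
    by (rule galg_raise[OF gf, of s]) (use s that in auto)
  have h'b: "gmod T Z B (\<lambda>x. h' x * b x)" if "b \<in> B" for b
    unfolding h'_def by (rule cs[OF _ that]) simp
  have h'g: "gmod T Z B (\<lambda>x. h' x ^ k * g x)" if "gmod T Z B g" for g k
  proof (induction k)
    case (Suc k)
    have "gmod T Z B (\<lambda>x. (h' x ^ k * g x) * h' x)"
      by (rule gmod_subst[OF Suc]) (use h'b in \<open>simp add: mult.commute\<close>)
    then show ?case by (rule gmod_cong) simp
  qed (use that in simp)
  have genfin: "genfin I T Z h' B'"
    unfolding genfin_def
  proof (intro conjI ballI)
    show "h' \<in> polyfun I" unfolding h'_def using gf' a(1)[of n] by (intro polyfun_intros) auto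
    show "\<exists>x\<in>Z. h' x \<noteq> 0"
    proof (rule ccontr)
      assume *: "\<not> ?thesis"
      have "a n x = 0" if "x \<in> Z" for x
      proof (rule irreducible_closed_cancel[OF irr _ _ _ _ that, of "\<lambda>x. h x ^ Suc s"])
        show "(\<lambda>x. h x ^ Suc s) \<in> polyfun I" using gf' by (intro polyfun_intros) auto
        show "a n \<in> polyfun I" using a(1) by simp
        show "\<exists>x\<in>Z. h x ^ Suc s \<noteq> 0" using gf' by auto
        show "h x ^ Suc s * a n x = 0" if "x \<in> Z" for x using * that by (auto simp: h'_def)
      qed
      with an show False by blast
    qed
    show "finite B'" by (rule finB')
    show "B' \<subseteq> polyfun I"
      using gf' c by (auto simp: B'_def intro!: polyfun_intros)
    show "(\<lambda>_. 1) \<in> B'"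
      unfolding B'_def by (rule image_eqI[of _ _ "(\<lambda>_. 1, 0)"]) (use gf' n in auto)
    fix b assume "b \<in> B'"
    then obtain b0 l where b: "b = (\<lambda>x. b0 x * c x ^ l)" "b0 \<in> B" "l < n" by (auto simp: B'_def)
    from lift[OF h'b[OF b(2)] b(3)]
    show "gmod T Z B' (\<lambda>x. h' x * b x)" by (simp add: b(1) mult.assoc)
  qed
  have galgc: "galg T Z h' B' c"
    unfolding galg_def
  proof (intro exI[of _ 1] ballI)
    fix b assume "b \<in> B'"
    then obtain b0 l where b: "b = (\<lambda>x. b0 x * c x ^ l)" "b0 \<in> B" "l < n" by (auto simp: B'_def)
    show "gmod T Z B' (\<lambda>x. h' x ^ 1 * c x * b x)"
    proof (cases "Suc l < n")
      case True
      from lift[OF h'b[OF b(2)] True] show ?thesis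
        by (rule gmod_cong) (simp add: b(1) algebra_simps)
    next
      case False
      \<comment> \<open>Multiplication by \<open>c\<close> produces the power \<open>n\<close> here;
        the factor \<open>a n\<close> inside \<open>h'\<close> lets the relation rewrite it in lower
        powers.\<close>
      then have l: "n = Suc l" using b(3) by simp
      have "gmod T Z B' (\<lambda>x. (- 1) * (\<Sum>i<n. (h x ^ Suc s * a i x * b0 x) * c x ^ i))"
      proof (rule gmod_mult_polyfun[OF _ polyfun_const], rule gmod_sum)
        fix i assume "i \<in> {..<n}"
        then show "gmod T Z B' (\<lambda>x. (h x ^ Suc s * a i x * b0 x) * c x ^ i)"
          by (intro lift cs b(2)) auto
      qed
      then show ?thesis
      proof (rule gmod_cong)
        fix x assume x: "x \<in> Z"
        have "(\<Sum>i<n. a i x * c x ^ i) + a n x * c x ^ n = 0"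
          using rel[OF x] by (simp add: lessThan_Suc_atMost[symmetric])
        then have "a n x * c x ^ n = - (\<Sum>i<n. a i x * c x ^ i)"
          by (simp add: eq_neg_iff_add_eq_0 add.commute)
        then have "h x ^ Suc s * b0 x * (a n x * c x ^ n) = h x ^ Suc s * b0 x * - (\<Sum>i<n. a i x * c x ^ i)"
          by simp
        moreover have "h' x ^ 1 * c x * b x = h x ^ Suc s * b0 x * (a n x * c x ^ n)"
          by (simp add: h'_def b(1) l)
        moreover have "(- 1) * (\<Sum>i<n. (h x ^ Suc s * a i x * b0 x) * c x ^ i) =
            h x ^ Suc s * b0 x * - (\<Sum>i<n. a i x * c x ^ i)"
          by (simp add: sum_distrib_left algebra_simps sum_negf)
        ultimately show "(- 1) * (\<Sum>i<n. (h x ^ Suc s * a i x * b0 x) * c x ^ i) = h' x ^ 1 * c x * b x"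
          by simp
      qed
    qed
  qed
  have old: "galg T Z h' B' f" if f: "galg T Z h B f" for f
  proof -
    obtain m where m: "\<And>b. b \<in> B \<Longrightarrow> gmod T Z B (\<lambda>x. h x ^ m * f x * b x)" using f unfolding galg_def by blast
    \<comment> \<open>\<open>h'\<close> is \<open>g\<close> times \<open>h\<close>. In the m-th
      power of \<open>h'\<close> the powers of \<open>h\<close> make \<open>f\<close> act on the
      module, and those of \<open>g\<close> preserve it.\<close>
    define g where "g x = h x ^ s * a n x" for x
    have gg: "gmod T Z B (\<lambda>x. g x ^ k * u x)" if "gmod T Z B u" for u k
    proof (induction k)
      case (Suc k)
      have "gmod T Z B (\<lambda>x. (g x ^ k * u x) * g x)"
        by (rule gmod_subst[OF Suc]) (use s in \<open>simp add: mult.commute g_def\<close>)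
      then show ?case by (rule gmod_cong) simp
    qed (use that in simp)
    show ?thesis
      unfolding galg_def
    proof (intro exI[of _ m] ballI)
      fix b assume "b \<in> B'"
      then obtain b0 l where b: "b = (\<lambda>x. b0 x * c x ^ l)" "b0 \<in> B" "l < n" by (auto simp: B'_def)
      have h': "h' x = g x * h x" for x by (simp add: h'_def g_def)
      from lift[OF gg[OF m[OF b(2)], of m] b(3)]
      show "gmod T Z B' (\<lambda>x. h' x ^ m * f x * b x)"
        by (rule gmod_cong) (simp add: h' b(1) power_mult_distrib mult.assoc)
    qed
  qed
  show ?thesis using genfin galgc old by blast
qed

section \<open>Counting monomials bounds the dimension\<close>

text \<open>Each exponent is bounded separately, instead of the total degree: the number of
  monomials is then at most \<open>(e + 1) ^ card T\<close>, and the bounds add under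
  multiplication.\<close>

definition bounded_polys :: "'v set \<Rightarrow> nat \<Rightarrow> 'v cpoly set" where
  "bounded_polys T e = {p \<in> polys_in T. \<forall>m\<in>Poly_Mapping.keys p. \<forall>v. Poly_Mapping.lookup m v \<le> e}"

definition bounded_monoms :: "'v set \<Rightarrow> nat \<Rightarrow> ('v \<Rightarrow>\<^sub>0 nat) set" where
  "bounded_monoms T e = {m. Poly_Mapping.keys m \<subseteq> T \<and> (\<forall>v. Poly_Mapping.lookup m v \<le> e)}"

lemma bounded_polys_iff: "p \<in> bounded_polys T e \<longleftrightarrow> Poly_Mapping.keys p \<subseteq> bounded_monoms T e"
  by (auto simp: bounded_polys_def bounded_monoms_def polys_in_iff)

lemma bounded_monoms_card:
  assumes "finite T"
  shows "finite (bounded_monoms T e)" "card (bounded_monoms T e) \<le> (e + 1) ^ card T"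
proof -
  let ?f = "\<lambda>m. restrict (Poly_Mapping.lookup m) T"
  have "inj_on ?f (bounded_monoms T e)"
  proof (rule inj_onI)
    fix m m' assume m: "m \<in> bounded_monoms T e" "m' \<in> bounded_monoms T e" "?f m = ?f m'"
    show "m = m'"
    proof (rule poly_mapping_eqI)
      fix v
      show "Poly_Mapping.lookup m v = Poly_Mapping.lookup m' v"
      proof (cases "v \<in> T")
        case True
        then show ?thesis using fun_cong[OF m(3), of v] by simp
      next
        case False
        then have "v \<notin> Poly_Mapping.keys m" "v \<notin> Poly_Mapping.keys m'"
          using m by (auto simp: bounded_monoms_def)
        then show ?thesis by (simp add: not_in_keys_iff_lookup_eq_zero)
      qed
    qed
  qed
  moreover have "?f ` bounded_monoms T e \<subseteq> T \<rightarrow>\<^sub>E {..e}"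
    by (auto simp: bounded_monoms_def)
  moreover have "finite (T \<rightarrow>\<^sub>E {..e})" using assms by (simp add: finite_PiE)
  moreover have "card (T \<rightarrow>\<^sub>E {..e}) = (e + 1) ^ card T" using assms by (simp add: card_PiE)
  ultimately show "finite (bounded_monoms T e)" "card (bounded_monoms T e) \<le> (e + 1) ^ card T"
    using inj_on_finite[of ?f "bounded_monoms T e" "T \<rightarrow>\<^sub>E {..e}"] card_inj_on_le[of ?f "bounded_monoms T e" "T \<rightarrow>\<^sub>E {..e}"] by simp_all
qed

lemma bounded_polys_mono: "e \<le> e' \<Longrightarrow> bounded_polys T e \<subseteq> bounded_polys T e'"
  unfolding bounded_polys_def using order_trans by blast

lemma bounded_polys_0: "0 \<in> bounded_polys T e"
  by (simp add: bounded_polys_iff)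

lemma bounded_polys_one: "1 \<in> bounded_polys T e"
  by (simp add: bounded_polys_iff bounded_monoms_def)

lemma bounded_polys_add: "p \<in> bounded_polys T e \<Longrightarrow> q \<in> bounded_polys T e \<Longrightarrow> p + q \<in> bounded_polys T e"
  unfolding bounded_polys_iff using keys_add[of p q] by blast

lemma bounded_polys_sum: "(\<And>a. a \<in> A \<Longrightarrow> f a \<in> bounded_polys T e) \<Longrightarrow> sum f A \<in> bounded_polys T e"
  by (induction A rule: infinite_finite_induct) (auto intro: bounded_polys_add bounded_polys_0)

lemma bounded_polys_mult:
  assumes "p \<in> bounded_polys T e" "q \<in> bounded_polys T e'"
  shows "p * q \<in> bounded_polys T (e + e')"
  unfolding bounded_polys_iff
proof
  fix m assume "m \<in> Poly_Mapping.keys (p * q)"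
  then obtain a b where "m = a + b" "a \<in> Poly_Mapping.keys p" "b \<in> Poly_Mapping.keys q"
    using keys_mult[of p q] by blast
  then show "m \<in> bounded_monoms T (e + e')"
    using subsetD[OF assms(1)[unfolded bounded_polys_iff], of a] subsetD[OF assms(2)[unfolded bounded_polys_iff], of b]
    by (simp add: bounded_monoms_def keys_add_nat lookup_add add_mono)
qed

lemma polys_in_bounded:
  assumes "p \<in> polys_in T"
  obtains e where "p \<in> bounded_polys T e"
proof -
  define e where "e = Max (insert 0 ((\<lambda>(m, v). Poly_Mapping.lookup m v) ` (SIGMA m:Poly_Mapping.keys p. Poly_Mapping.keys m)))"
  have "Poly_Mapping.lookup m v \<le> e" if "m \<in> Poly_Mapping.keys p" for m v
  proof (cases "v \<in> Poly_Mapping.keys m")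
    case True
    then show ?thesis unfolding e_def using that by (intro Max_ge) auto
  next
    case False
    then show ?thesis by (simp add: not_in_keys_iff_lookup_eq_zero)
  qed
  then show thesis using assms that[of e] by (simp add: bounded_polys_def)
qed

section \<open>Multiplication operators on the module with control of the exponents\<close>

definition bmod where
  "bmod T Z B e f \<longleftrightarrow> (\<exists>r. (\<forall>b\<in>B. r b \<in> bounded_polys T e) \<and> (\<forall>x\<in>Z. f x = (\<Sum>b\<in>B. poly_eval x (r b) * b x)))"

lemma bmod_mono: "e \<le> e' \<Longrightarrow> bmod T Z B e f \<Longrightarrow> bmod T Z B e' f"
  unfolding bmod_def using bounded_polys_mono by blast

lemma gmod_bmod:
  assumes "finite B" "gmod T Z B f"
  obtains e where "bmod T Z B e f"
proof -
  obtain r where r: "\<And>b. b \<in> B \<Longrightarrow> r b \<in> polyfun T" "\<And>x. x \<in> Z \<Longrightarrow> f x = (\<Sum>b\<in>B. r b x * b x)"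
    using assms(2) unfolding gmod_def by blast
  have "\<exists>p e. p \<in> bounded_polys T e \<and> (\<forall>x. r b x = poly_eval x p)" if b: "b \<in> B" for b
  proof -
    obtain p where "p \<in> polys_in T" "r b = (\<lambda>x. poly_eval x p)"
      using r(1)[OF b] unfolding polyfun_def by auto
    then show ?thesis by (metis polys_in_bounded)
  qed
  then obtain p e where p: "\<And>b. b \<in> B \<Longrightarrow> p b \<in> bounded_polys T (e b)" "\<And>b x. b \<in> B \<Longrightarrow> r b x = poly_eval x (p b)"
    by metis
  have "bmod T Z B (Max (insert 0 (e ` B))) f"
    unfolding bmod_def
  proof (intro exI[of _ p] conjI ballI)
    fix b assume b: "b \<in> B"
    have "e b \<le> Max (insert 0 (e ` B))" using assms(1) b by (intro Max_ge) auto
    then show "p b \<in> bounded_polys T (Max (insert 0 (e ` B)))" using p(1)[OF b] bounded_polys_mono by blast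
  next
    fix x assume "x \<in> Z"
    then show "f x = (\<Sum>b\<in>B. poly_eval x (p b) * b x)" using r(2) p(2) by simp
  qed
  then show thesis by (rule that)
qed

text \<open>A product of matrices with polynomial entries: entries are multiplied and summed, so the
  exponent bounds add.\<close>

lemma bmod_subst:
  assumes "bmod T Z B e f" "\<And>b. b \<in> B \<Longrightarrow> bmod T Z B e' (\<lambda>x. g x * b x)"
  shows "bmod T Z B (e + e') (\<lambda>x. g x * f x)"
proof -
  obtain r where r: "\<And>b. b \<in> B \<Longrightarrow> r b \<in> bounded_polys T e" "\<And>x. x \<in> Z \<Longrightarrow> f x = (\<Sum>b\<in>B. poly_eval x (r b) * b x)"
    using assms(1) unfolding bmod_def by blast
  have "\<forall>b\<in>B. \<exists>s. (\<forall>b'\<in>B. s b' \<in> bounded_polys T e') \<and> (\<forall>x\<in>Z. g x * b x = (\<Sum>b'\<in>B. poly_eval x (s b') * b' x))"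
    using assms(2) unfolding bmod_def by blast
  then obtain s where s: "\<And>b b'. b \<in> B \<Longrightarrow> b' \<in> B \<Longrightarrow> s b b' \<in> bounded_polys T e'"
    "\<And>b x. b \<in> B \<Longrightarrow> x \<in> Z \<Longrightarrow> g x * b x = (\<Sum>b'\<in>B. poly_eval x (s b b') * b' x)"
    unfolding bchoice_iff by blast
  show ?thesis
    unfolding bmod_def
  proof (intro exI[of _ "\<lambda>b'. \<Sum>b\<in>B. r b * s b b'"] conjI ballI)
    show "(\<Sum>b\<in>B. r b * s b b') \<in> bounded_polys T (e + e')" if "b' \<in> B" for b'
      by (intro bounded_polys_sum bounded_polys_mult r(1) s(1) that)
  next
    fix x assume x: "x \<in> Z"
    have "g x * f x = (\<Sum>b\<in>B. poly_eval x (r b) * (g x * b x))"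
      by (simp add: r(2)[OF x] sum_distrib_left algebra_simps)
    also have "\<dots> = (\<Sum>b\<in>B. \<Sum>b'\<in>B. poly_eval x (r b) * (poly_eval x (s b b') * b' x))"
      by (intro sum.cong refl) (simp add: s(2) x sum_distrib_left)
    also have "\<dots> = (\<Sum>b'\<in>B. \<Sum>b\<in>B. poly_eval x (r b) * (poly_eval x (s b b') * b' x))"
      by (rule sum.swap)
    also have "\<dots> = (\<Sum>b'\<in>B. poly_eval x (\<Sum>b\<in>B. r b * s b b') * b' x)"
      by (simp add: poly_eval_sum poly_eval_mult sum_distrib_right mult.assoc)
    finally show "g x * f x = (\<Sum>b'\<in>B. poly_eval x (\<Sum>b\<in>B. r b * s b b') * b' x)" .
  qed
qed

definition bmult where
  "bmult T Z B e g \<longleftrightarrow> (\<forall>b\<in>B. bmod T Z B e (\<lambda>x. g x * b x))"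

lemma bmult_mult:
  assumes "bmult T Z B e f" "bmult T Z B e' g"
  shows "bmult T Z B (e + e') (\<lambda>x. f x * g x)"
  unfolding bmult_def
proof
  fix b assume b: "b \<in> B"
  have "bmod T Z B (e' + e) (\<lambda>x. f x * (g x * b x))"
    by (rule bmod_subst) (use assms b in \<open>auto simp: bmult_def\<close>)
  then show "bmod T Z B (e + e') (\<lambda>x. f x * g x * b x)" by (simp add: mult.assoc add.commute)
qed

lemma bmult_one:
  assumes "finite B"
  shows "bmult T Z B 0 (\<lambda>x. 1)"
  unfolding bmult_def
proof
  fix b assume b: "b \<in> B"
  show "bmod T Z B 0 (\<lambda>x. 1 * b x)"
    unfolding bmod_def
  proof (intro exI[of _ "\<lambda>b'. if b' = b then 1 else 0"] conjI ballI)
    fix x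
    have "(\<Sum>b'\<in>B. poly_eval x (if b' = b then 1 else 0) * b' x) = (\<Sum>b'\<in>B. if b' = b then b x else 0)"
      by (intro sum.cong) (auto simp: poly_eval_monom_eval)
    then show "1 * b x = (\<Sum>b'\<in>B. poly_eval x (if b' = b then 1 else 0) * b' x)"
      using assms b by simp
  qed (simp add: bounded_polys_one bounded_polys_0)
qed

lemma bmult_power: "finite B \<Longrightarrow> bmult T Z B e g \<Longrightarrow> bmult T Z B (n * e) (\<lambda>x. g x ^ n)"
proof (induction n)
  case (Suc n)
  from bmult_mult[OF Suc.prems(2) Suc.IH[OF Suc.prems]] show ?case by simp
qed (simp add: bmult_one)

lemma bmult_prod:
  assumes "finite B" "\<And>k. k < d \<Longrightarrow> bmult T Z B e (g k)"
  shows "bmult T Z B (d * e) (\<lambda>x. \<Prod>k<(d::nat). g k x)"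
  using assms(2)
proof (induction d)
  case (Suc d)
  have "bmult T Z B (d * e + e) (\<lambda>x. (\<Prod>k<d. g k x) * g d x)"
    using Suc by (intro bmult_mult) auto
  then show ?case by (simp add: add.commute)
qed (simp add: bmult_one assms(1))

text \<open>Comparison of growth rates. The \<open>d\<close> functions separating a chain have
  (N+1)^d monomials with exponents at most N, independent on the top set. After clearing
  denominators they all lie in a space whose dimension grows only like N to the power
  \<open>card T\<close>, so \<open>d\<close> cannot exceed \<open>card T\<close>.\<close>

lemma genfin_chain_bound:
  fixes Z :: "nat \<Rightarrow> ('v \<Rightarrow> complex) set"
  assumes T: "finite T" and gf: "genfin I T (Z d) h B"
    and alg: "\<And>v. v \<in> I \<Longrightarrow> galg T (Z d) h B (\<lambda>x. x v)"
    and irr: "\<And>k. k \<le> d \<Longrightarrow> irreducible_closed I (Z k)"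
    and chain: "\<And>k. k < d \<Longrightarrow> Z k \<subset> Z (Suc k)"
  shows "d \<le> card T"
proof (rule ccontr)
  assume "\<not> d \<le> card T"
  then have dT: "card T < d" by simp
  note gf' = gf[unfolded genfin_def]
  have finB: "finite B" and one: "(\<lambda>_. 1) \<in> B" using gf' by auto
  have "\<exists>f. f \<in> polyfun I \<and> (\<forall>x\<in>Z k. f x = 0) \<and> (\<exists>x\<in>Z (Suc k). f x \<noteq> 0)" if "k < d" for k
  proof -
    have "zariski_closed I (Z k)" "Z (Suc k) \<subseteq> affine_space I"
      using irr[of k] irr[of "Suc k"] that zariski_closed_subset by (auto simp: irreducible_closed_def)
    moreover have "\<not> Z (Suc k) \<subseteq> Z k" using chain[OF that] by blast
    ultimately obtain f where "f \<in> polyfun I" "\<And>x. x \<in> Z k \<Longrightarrow> f x = 0" "\<exists>x\<in>Z (Suc k). f x \<noteq> 0"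
      by (rule zariski_closed_separation) blast
    then show ?thesis by blast
  qed
  then obtain f where f: "\<And>k. k < d \<Longrightarrow> f k \<in> polyfun I" "\<And>k x. k < d \<Longrightarrow> x \<in> Z k \<Longrightarrow> f k x = 0"
    "\<And>k. k < d \<Longrightarrow> \<exists>x\<in>Z (Suc k). f k x \<noteq> 0"
    by metis
  have galgf: "galg T (Z d) h B (f k)" if "k < d" for k
    by (rule galg_polyfun[OF gf alg f(1)[OF that]])
  obtain s0 where s0: "\<forall>k\<in>{..<d}. \<forall>b\<in>B. gmod T (Z d) B (\<lambda>x. h x ^ s0 * f k x * b x)"
    using galg_common_exponent[OF gf, of "{..<d}" f] galgf by auto
  have bm: "\<exists>e. bmult T (Z d) B e g" if "\<forall>b\<in>B. gmod T (Z d) B (\<lambda>x. g x * b x)" for g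
  proof -
    have "\<exists>e. bmod T (Z d) B e (\<lambda>x. g x * b x)" if "b \<in> B" for b
      using gmod_bmod[OF finB] \<open>\<forall>b\<in>B. _\<close> that by metis
    then obtain e where e: "\<And>b. b \<in> B \<Longrightarrow> bmod T (Z d) B (e b) (\<lambda>x. g x * b x)" by metis
    have "bmult T (Z d) B (Max (insert 0 (e ` B))) g"
      unfolding bmult_def
    proof
      fix b assume b: "b \<in> B"
      show "bmod T (Z d) B (Max (insert 0 (e ` B))) (\<lambda>x. g x * b x)"
        by (rule bmod_mono[OF _ e[OF b]]) (use finB b in \<open>auto intro!: Max_ge\<close>)
    qed
    then show ?thesis by blast
  qed
  have "\<forall>k\<in>{..<d}. \<exists>e. bmult T (Z d) B e (\<lambda>x. h x ^ s0 * f k x)"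
  proof
    fix k assume "k \<in> {..<d}"
    then show "\<exists>e. bmult T (Z d) B e (\<lambda>x. h x ^ s0 * f k x)" using s0 by (intro bm) blast
  qed
  then obtain ek where ek: "\<And>k. k < d \<Longrightarrow> bmult T (Z d) B (ek k) (\<lambda>x. h x ^ s0 * f k x)"
    unfolding bchoice_iff by auto
  have "\<forall>b\<in>B. gmod T (Z d) B (\<lambda>x. h x ^ s0 * b x)"
  proof
    fix b assume b: "b \<in> B"
    show "gmod T (Z d) B (\<lambda>x. h x ^ s0 * b x)"
      by (rule gmod_mult_power[OF gf gmod_base[OF finB b]])
  qed
  from bm[OF this] obtain e' where e': "bmult T (Z d) B e' (\<lambda>x. h x ^ s0)" by blast
  define e where "e = Max (insert e' (ek ` {..<d}))"
  have e1: "bmult T (Z d) B e (\<lambda>x. h x ^ s0 * f k x)" if "k < d" for k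
  proof -
    have "ek k \<le> e" unfolding e_def using that by (intro Max_ge) auto
    then show ?thesis using ek[OF that] bmod_mono unfolding bmult_def by blast
  qed
  have e2: "bmult T (Z d) B e (\<lambda>x. h x ^ s0)"
  proof -
    have "e' \<le> e" unfolding e_def by (intro Max_ge) auto
    then show ?thesis using e' bmod_mono unfolding bmult_def by blast
  qed
  have bound: "(N + 1) ^ d \<le> card B * (d * (N * e) + 1) ^ card T" for N
  proof (rule ccontr)
    assume neg: "\<not> ?thesis"
    let ?P = "{..<d} \<rightarrow>\<^sub>E {..N}"
    let ?E = "d * (N * e)"
    let ?M = "bounded_monoms T ?E"
    \<comment> \<open>Padding with powers of \<open>h ^ s0\<close> gives all monomials the same
      factor \<open>h x ^ (s0 * N * d)\<close>. A linear relation among the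
      \<open>F \<alpha>\<close> thus becomes one among the monomials in the \<open>f k\<close> after
      cancellation.\<close>
    define F where "F \<alpha> x = (\<Prod>k<d. (h x ^ s0 * f k x) ^ \<alpha> k * (h x ^ s0) ^ (N - \<alpha> k))" for \<alpha> x
    have F: "F \<alpha> x = h x ^ (s0 * N * d) * (\<Prod>k<d. f k x ^ \<alpha> k)" if "\<alpha> \<in> ?P" for \<alpha> x
    proof -
      have "(h x ^ s0 * f k x) ^ \<alpha> k * (h x ^ s0) ^ (N - \<alpha> k) = h x ^ (s0 * N) * f k x ^ \<alpha> k" if "k < d" for k
      proof -
        have "\<alpha> k \<le> N" using PiE_mem[OF \<open>\<alpha> \<in> ?P\<close>, of k] that by simp
        then have "(h x ^ s0) ^ \<alpha> k * (h x ^ s0) ^ (N - \<alpha> k) = h x ^ (s0 * N)"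
          by (simp flip: power_add power_mult distrib_left)
        then show ?thesis by (metis (no_types, lifting) mult.assoc mult.commute power_mult_distrib)
      qed
      then have "F \<alpha> x = (\<Prod>k<d. h x ^ (s0 * N) * f k x ^ \<alpha> k)" unfolding F_def by (intro prod.cong) auto
      then show ?thesis by (simp add: prod.distrib power_mult)
    qed
    have bm_F: "bmult T (Z d) B ?E (F \<alpha>)" if a: "\<alpha> \<in> ?P" for \<alpha>
      unfolding F_def
    proof (rule bmult_prod[OF finB])
      fix k assume k: "k < d"
      have "\<alpha> k \<le> N" using PiE_mem[OF a, of k] k by simp
      then have "\<alpha> k * e + (N - \<alpha> k) * e = N * e" by (simp flip: distrib_right)
      then show "bmult T (Z d) B (N * e) (\<lambda>x. (h x ^ s0 * f k x) ^ \<alpha> k * (h x ^ s0) ^ (N - \<alpha> k))"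
        using bmult_mult[OF bmult_power[OF finB e1[OF k], of "\<alpha> k"] bmult_power[OF finB e2, of "N - \<alpha> k"]] by simp
    qed
    have "\<forall>\<alpha>\<in>?P. bmod T (Z d) B ?E (F \<alpha>)"
    proof
      fix \<alpha> assume "\<alpha> \<in> ?P"
      from bspec[OF bm_F[OF this, unfolded bmult_def] one] show "bmod T (Z d) B ?E (F \<alpha>)" by simp
    qed
    then have "\<forall>\<alpha>\<in>?P. \<exists>r. (\<forall>b\<in>B. r b \<in> bounded_polys T ?E) \<and> (\<forall>x\<in>Z d. F \<alpha> x = (\<Sum>b\<in>B. poly_eval x (r b) * b x))"
      by (simp add: bmod_def)
    from bchoice[OF this] obtain r where
      "\<forall>\<alpha>\<in>?P. (\<forall>b\<in>B. r \<alpha> b \<in> bounded_polys T ?E) \<and> (\<forall>x\<in>Z d. F \<alpha> x = (\<Sum>b\<in>B. poly_eval x (r \<alpha> b) * b x))"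
      by (elim exE) (rule that)
    then have r: "\<And>\<alpha> b. \<alpha> \<in> ?P \<Longrightarrow> b \<in> B \<Longrightarrow> r \<alpha> b \<in> bounded_polys T ?E"
      "\<And>\<alpha> x. \<alpha> \<in> ?P \<Longrightarrow> x \<in> Z d \<Longrightarrow> F \<alpha> x = (\<Sum>b\<in>B. poly_eval x (r \<alpha> b) * b x)"
      by simp_all
    have finM: "finite ?M" and cM: "card ?M \<le> (?E + 1) ^ card T"
      using bounded_monoms_card[OF T, of ?E] by auto
    have small: "card (B \<times> ?M) < card ?P"
    proof -
      have "card (B \<times> ?M) \<le> card B * (?E + 1) ^ card T" using cM by (simp add: card_cartesian_product)
      also have "\<dots> < (N + 1) ^ d" using neg by simp
      also have "\<dots> = card ?P" by (simp add: card_PiE)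
      finally show ?thesis .
    qed
    have "finite (B \<times> ?M)" "finite ?P" using finB finM by (simp_all add: finite_PiE)
    \<comment> \<open>One unknown for each monomial in the \<open>f k\<close>, one equation for each
      pair of a generator in \<open>B\<close> and a bounded monomial in \<open>T\<close>.\<close>
    from homogeneous_system_nontrivial[OF this small, of "\<lambda>\<alpha> q. Poly_Mapping.lookup (r \<alpha> (fst q)) (snd q)"]
    obtain c where c: "\<exists>\<alpha>\<in>?P. c \<alpha> \<noteq> 0"
      "\<forall>q\<in>B \<times> ?M. (\<Sum>\<alpha>\<in>?P. c \<alpha> * Poly_Mapping.lookup (r \<alpha> (fst q)) (snd q)) = 0"
      by (elim exE conjE) (rule that)
    define S where "S x = (\<Sum>\<alpha>\<in>?P. c \<alpha> * (\<Prod>k<d. f k x ^ \<alpha> k))" for x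
    have S0: "S x = 0" if x: "x \<in> Z d" for x
    proof (rule irreducible_closed_cancel[OF irr _ _ _ _ x, of "\<lambda>x. h x ^ (s0 * N * d)"])
      show "d \<le> d" by simp
      show "(\<lambda>x. h x ^ (s0 * N * d)) \<in> polyfun I" using gf' by (intro polyfun_intros) simp
      show "S \<in> polyfun I" unfolding S_def by (intro polyfun_intros f(1)) simp
      show "\<exists>x\<in>Z d. h x ^ (s0 * N * d) \<noteq> 0" using gf' by auto
      fix y assume y: "y \<in> Z d"
      have pe: "poly_eval y (r \<alpha> b) = (\<Sum>m\<in>?M. Poly_Mapping.lookup (r \<alpha> b) m * monom_eval y m)" if "\<alpha> \<in> ?P" "b \<in> B" for \<alpha> b
        using r(1)[OF that] by (intro poly_eval_superset finM) (simp add: bounded_polys_iff)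
      have "h y ^ (s0 * N * d) * S y = (\<Sum>\<alpha>\<in>?P. c \<alpha> * F \<alpha> y)"
        unfolding S_def sum_distrib_left by (intro sum.cong refl) (simp add: F)
      also have "\<dots> = (\<Sum>\<alpha>\<in>?P. \<Sum>b\<in>B. \<Sum>m\<in>?M. c \<alpha> * Poly_Mapping.lookup (r \<alpha> b) m * (monom_eval y m * b y))"
        using y by (intro sum.cong refl) (simp add: r(2) pe sum_distrib_left sum_distrib_right mult.assoc)
      also have "\<dots> = (\<Sum>b\<in>B. \<Sum>m\<in>?M. \<Sum>\<alpha>\<in>?P. c \<alpha> * Poly_Mapping.lookup (r \<alpha> b) m * (monom_eval y m * b y))"
        by (subst sum.swap, intro sum.cong refl, rule sum.swap)
      also have "\<dots> = (\<Sum>b\<in>B. \<Sum>m\<in>?M. (\<Sum>\<alpha>\<in>?P. c \<alpha> * Poly_Mapping.lookup (r \<alpha> b) m) * (monom_eval y m * b y))"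
        by (simp add: sum_distrib_right)
      also have "\<dots> = 0" using c(2) by (intro sum.neutral ballI) simp
      finally show "h y ^ (s0 * N * d) * S y = 0" .
    qed
    have "c \<alpha> = 0" if "\<alpha> \<in> ?P" for \<alpha>
      by (rule chain_independent[where Z = Z and f = f and d = d and I = I, OF irr _ f _ that])
        (use chain S0 in \<open>auto simp: S_def\<close>)
    with c(1) show False by blast
  qed
  \<comment> \<open>At N = C the upper bound is at most C (C+1)^(card T), while the left side is at
    least (C+1)^(card T + 1).\<close>
  define C where "C = card B * (d * e + 1) ^ card T"
  have "(C + 1) ^ d \<le> card B * (d * (C * e) + 1) ^ card T" by (rule bound)
  also have "\<dots> \<le> card B * ((d * e + 1) * (C + 1)) ^ card T"
    by (intro mult_left_mono power_mono) (auto simp: algebra_simps)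
  also have "\<dots> = C * (C + 1) ^ card T" by (simp only: power_mult_distrib mult.assoc[symmetric]) (simp only: C_def)
  finally have "(C + 1) ^ d \<le> C * (C + 1) ^ card T" .
  moreover have "(C + 1) ^ Suc (card T) \<le> (C + 1) ^ d" using dT by (intro power_increasing) auto
  ultimately have "(C + 1) * (C + 1) ^ card T \<le> C * (C + 1) ^ card T" by (simp only: power_Suc)
  moreover have "0 < (C + 1) ^ card T" by simp
  ultimately have "C + 1 \<le> C" using mult_le_cancel2 by blast
  then show False by simp
qed

text \<open>The data are requested only for the top member of a chain, so they may vary with
  \<open>Z\<close>.\<close>

lemma variety_dim_le:
  assumes "\<And>Z. irreducible_closed I Z \<Longrightarrow> Z \<subseteq> zariski_closure I Y \<Longrightarrow>
      \<exists>T h B. finite T \<and> card T \<le> D \<and> genfin I T Z h B \<and> (\<forall>v\<in>I. galg T Z h B (\<lambda>x. x v))"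
  shows "variety_dim I Y \<le> enat D"
  unfolding variety_dim_def
proof (rule Sup_least, clarify)
  fix d and Z :: "nat \<Rightarrow> ('a \<Rightarrow> complex) set"
  assume Z: "\<forall>k\<le>d. irreducible_closed I (Z k) \<and> Z k \<subseteq> zariski_closure I Y" "\<forall>k<d. Z k \<subset> Z (Suc k)"
  then obtain T h B where "finite T" "card T \<le> D" "genfin I T (Z d) h B" "\<forall>v\<in>I. galg T (Z d) h B (\<lambda>x. x v)"
    using assms[of "Z d"] by blast
  then have "d \<le> card T" using Z by (intro genfin_chain_bound[of T I Z d h B]) auto
  then show "enat d \<le> enat D" using \<open>card T \<le> D\<close> by simp
qed

section \<open>Analytic sections bound the dimension from below\<close>

definition polydisc :: "'v set \<Rightarrow> ('v \<Rightarrow> complex) \<Rightarrow> real \<Rightarrow> ('v \<Rightarrow> complex) set" where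
  "polydisc S p \<delta> = {s \<in> affine_space S. \<forall>v\<in>S. norm (s v - p v) < \<delta>}"

definition cline :: "'v set \<Rightarrow> ('v \<Rightarrow> complex) \<Rightarrow> ('v \<Rightarrow> complex) \<Rightarrow> complex \<Rightarrow> ('v \<Rightarrow> complex)" where
  "cline S s s' z = (\<lambda>v\<in>S. s v + z * (s' v - s v))"

definition line_dom where
  "line_dom S p \<delta> s s' = {z. cline S s s' z \<in> polydisc S p \<delta>}"

text \<open>Holomorphy in several variables is only ever needed along complex lines.\<close>

definition holomorphic_on_lines where
  "holomorphic_on_lines S p \<delta> f \<longleftrightarrow>
     (\<forall>s\<in>polydisc S p \<delta>. \<forall>s'\<in>polydisc S p \<delta>. (\<lambda>z. f (cline S s s' z)) holomorphic_on line_dom S p \<delta> s s')"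

lemma line_dom_eq: "line_dom S p \<delta> s s' = (\<Inter>v\<in>S. {z. norm (s v + z * (s' v - s v) - p v) < \<delta>})"
  by (auto simp: line_dom_def polydisc_def cline_def)

lemma open_line_dom:
  assumes "finite S"
  shows "open (line_dom S p \<delta> s s')"
  unfolding line_dom_eq
  by (intro open_INT assms ballI open_Collect_less continuous_intros)

text \<open>An intersection of preimages of discs under affine maps. Convexity supplies the
  connectedness that the identity theorem asks for.\<close>

lemma convex_line_dom: "convex (line_dom S p \<delta> s s')"
  unfolding line_dom_eq
proof (rule convex_INT)
  fix v
  show "convex {z. norm (s v + z * (s' v - s v) - p v) < \<delta>}"
  proof (rule convexI)
    fix x y :: complex and a b :: real
    assume x: "x \<in> {z. norm (s v + z * (s' v - s v) - p v) < \<delta>}"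
      and y: "y \<in> {z. norm (s v + z * (s' v - s v) - p v) < \<delta>}"
      and ab: "0 \<le> a" "0 \<le> b" "a + b = 1"
    define X where "X = s v + x * (s' v - s v) - p v"
    define Y where "Y = s v + y * (s' v - s v) - p v"
    have "X \<in> ball 0 \<delta>" "Y \<in> ball 0 \<delta>" using x y by (simp_all add: X_def Y_def)
    then have "a *\<^sub>R X + b *\<^sub>R Y \<in> ball 0 \<delta>" by (intro convexD[OF convex_ball] ab)
    moreover have "a *\<^sub>R X + b *\<^sub>R Y = s v + (a *\<^sub>R x + b *\<^sub>R y) * (s' v - s v) - p v"
    proof -
      have b: "b = 1 - a" using ab by simp
      show ?thesis unfolding X_def Y_def b by (simp add: scaleR_conv_of_real algebra_simps)
    qed
    ultimately show "a *\<^sub>R x + b *\<^sub>R y \<in> {z. norm (s v + z * (s' v - s v) - p v) < \<delta>}" by simp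
  qed
qed

lemma cline_0 [simp]: "s \<in> affine_space S \<Longrightarrow> cline S s s' 0 = s"
  unfolding cline_def by (simp add: PiE_restrict)

lemma cline_1 [simp]: "s' \<in> affine_space S \<Longrightarrow> cline S s s' 1 = s'"
  unfolding cline_def by (simp add: PiE_restrict)

text \<open>If two closed sets cover the closure and neither is all of it, there are polynomials
  vanishing on the one and on the other, but not at some \<open>\<phi> s\<close> and some
  \<open>\<phi> s'\<close> respectively. Pulled back to the complex line through \<open>s\<close>
  and \<open>s'\<close>, their product is zero, yet the first is nonzero at parameter 0 and the
  second at parameter 1. The identity theorem excludes this.\<close>

lemma irreducible_closed_image:
  fixes \<phi> :: "('v \<Rightarrow> complex) \<Rightarrow> ('v \<Rightarrow> complex)"
  assumes S: "finite S"
    and \<phi>: "\<And>s. s \<in> polydisc S p \<delta> \<Longrightarrow> \<phi> s \<in> affine_space I"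
    and hol: "\<And>v. v \<in> I \<Longrightarrow> holomorphic_on_lines S p \<delta> (\<lambda>s. \<phi> s v)"
    and M: "M \<subseteq> polydisc S p \<delta>" "M \<noteq> {}"
    and line: "\<And>s s' z. s \<in> M \<Longrightarrow> s' \<in> M \<Longrightarrow> cline S s s' z \<in> polydisc S p \<delta> \<Longrightarrow> cline S s s' z \<in> M"
  shows "irreducible_closed I (zariski_closure I (\<phi> ` M))"
proof -
  let ?Z = "zariski_closure I (\<phi> ` M)"
  have aff: "\<phi> ` M \<subseteq> affine_space I" using \<phi> M by blast
  have sub: "\<phi> ` M \<subseteq> ?Z" by (rule subset_zariski_closure)
  have "?Z = A \<or> ?Z = B" if A: "zariski_closed I A" and B: "zariski_closed I B" and AB: "?Z = A \<union> B" for A B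
  proof (rule ccontr)
    assume neg: "\<not> ?thesis"
    have "\<not> \<phi> ` M \<subseteq> A" using zariski_closure_minimal[OF A] neg AB by blast
    then obtain f where f: "f \<in> polyfun I" "\<And>x. x \<in> A \<Longrightarrow> f x = 0" "\<exists>x\<in>\<phi> ` M. f x \<noteq> 0"
      by (rule zariski_closed_separation[OF A aff]) blast
    have "\<not> \<phi> ` M \<subseteq> B" using zariski_closure_minimal[OF B] neg AB by blast
    then obtain g where g: "g \<in> polyfun I" "\<And>x. x \<in> B \<Longrightarrow> g x = 0" "\<exists>x\<in>\<phi> ` M. g x \<noteq> 0"
      by (rule zariski_closed_separation[OF B aff]) blast
    obtain s s' where s: "s \<in> M" "f (\<phi> s) \<noteq> 0" and s': "s' \<in> M" "g (\<phi> s') \<noteq> 0" using f(3) g(3) by blast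
    have sp: "s \<in> polydisc S p \<delta>" "s' \<in> polydisc S p \<delta>" using s s' M by auto
    define U where "U = line_dom S p \<delta> s s'"
    have U: "open U" "topological_space_class.connected U" "0 \<in> U" "1 \<in> U"
      unfolding U_def using open_line_dom[OF S] convex_connected[OF convex_line_dom] sp
      by (auto simp: line_dom_def polydisc_def)
    have hol: "(\<lambda>z. h (\<phi> (cline S s s' z))) holomorphic_on U" if "h \<in> polyfun I" for h
      using that
    proof (induction rule: polyfun_induct)
      case (var v)
      then show ?case using hol[OF var] sp by (simp add: holomorphic_on_lines_def U_def)
    qed (intro holomorphic_intros; assumption)+
    define F where "F z = f (\<phi> (cline S s s' z))" for z
    define G where "G z = g (\<phi> (cline S s s' z))" for z
    have hF: "F holomorphic_on U" and hG: "G holomorphic_on U"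
      unfolding F_def G_def using f(1) g(1) by (auto intro: hol)
    have FG: "F z = 0 \<or> G z = 0" if "z \<in> U" for z
    proof -
      have "cline S s s' z \<in> M" using that line[OF s(1) s'(1)] by (simp add: U_def line_dom_def)
      then have "\<phi> (cline S s s' z) \<in> A \<union> B" using sub AB by blast
      then show ?thesis unfolding F_def G_def using f(2) g(2) by blast
    qed
    have F0: "F 0 \<noteq> 0" and G1: "G 1 \<noteq> 0"
      using s s' sp unfolding F_def G_def by (simp_all add: polydisc_def)
    define V where "V = {z\<in>U. F z \<noteq> 0}"
    have "open V"
    proof -
      have "V = U \<inter> F -` (- {0})" by (auto simp: V_def)
      moreover have "open (U \<inter> F -` (- {0}))"
        by (rule continuous_open_preimage) (use hF U in \<open>auto intro: holomorphic_on_imp_continuous_on\<close>)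
      ultimately show ?thesis by simp
    qed
    have "G 1 = 0"
    proof (rule analytic_continuation[OF hG U(1,2), of V 0])
      show "V \<subseteq> U" by (auto simp: V_def)
      show "(0::complex) islimpt V" using \<open>open V\<close> U(3) F0 by (intro interior_limit_point) (simp add: interior_open V_def)
      show "G z = 0" if "z \<in> V" for z using that FG by (auto simp: V_def)
    qed (use U in auto)
    with G1 show False by simp
  qed
  moreover have "?Z \<noteq> {}" using sub M(2) by blast
  ultimately show ?thesis
    unfolding irreducible_closed_def using zariski_closed_closure[OF aff] by blast
qed

text \<open>The flag consists of coordinate slices through \<open>p\<close>, in which only the first
  \<open>k\<close> coordinates move. The closures of their images ascend strictly: the coordinate
  \<open>e k\<close> equals \<open>p (e k)\<close> on the image of the k-th slice, hence on its
  closure, while \<open>\<phi>\<close>, being a section, moves it on the next one.\<close>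

lemma variety_dim_ge:
  fixes \<phi> :: "('v \<Rightarrow> complex) \<Rightarrow> ('v \<Rightarrow> complex)"
  assumes S: "finite S" "S \<subseteq> I" and Y: "Y \<subseteq> affine_space I" and "\<delta> > 0"
    and \<phi>: "\<And>s. s \<in> polydisc S p \<delta> \<Longrightarrow> \<phi> s \<in> Y"
    and sec: "\<And>s v. s \<in> polydisc S p \<delta> \<Longrightarrow> v \<in> S \<Longrightarrow> \<phi> s v = s v"
    and hol: "\<And>v. v \<in> I \<Longrightarrow> holomorphic_on_lines S p \<delta> (\<lambda>s. \<phi> s v)"
  shows "enat (card S) \<le> variety_dim I Y"
proof -
  define d where "d = card S"
  obtain e where e: "bij_betw e {0..<d} S" using ex_bij_betw_nat_finite[OF S(1)] unfolding d_def by blast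
  have eS: "e i \<in> S" if "i < d" for i using e that by (auto simp: bij_betw_def)
  have einj: "e i = e j \<longleftrightarrow> i = j" if "i < d" "j < d" for i j
    using e that by (auto simp: bij_betw_def inj_on_def)
  define M where "M k = {s \<in> polydisc S p \<delta>. \<forall>i. k \<le> i \<and> i < d \<longrightarrow> s (e i) = p (e i)}" for k
  define Z where "Z k = zariski_closure I (\<phi> ` M k)" for k
  \<comment> \<open>For k < d this point lies in the slice \<open>Suc k\<close> but not in the slice
    \<open>k\<close>; for k = d it is the centre, which lies in all of them.\<close>
  define pt where "pt k = (\<lambda>v\<in>S. if k < d \<and> v = e k then p v + complex_of_real (\<delta>/2) else p v)" for k
  have pt: "pt k \<in> M (Suc k)" if "k < d" for k
    using \<open>\<delta> > 0\<close> eS einj that by (auto simp: M_def pt_def polydisc_def)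
  have ptd: "pt d \<in> M k" for k using \<open>\<delta> > 0\<close> eS by (auto simp: M_def pt_def polydisc_def)
  have "irreducible_closed I (Z k)" for k
    unfolding Z_def
  proof (rule irreducible_closed_image[OF S(1), of p \<delta>])
    show "M k \<noteq> {}" using ptd by blast
    fix s s' z assume "s \<in> M k" "s' \<in> M k" "cline S s s' z \<in> polydisc S p \<delta>"
    then show "cline S s s' z \<in> M k" using eS by (simp add: M_def cline_def)
  qed (use \<phi> Y hol in \<open>auto simp: M_def\<close>)
  moreover have "Z k \<subseteq> zariski_closure I Y" for k
    unfolding Z_def using \<phi> by (intro zariski_closure_mono) (auto simp: M_def)
  moreover have "Z k \<subset> Z (Suc k)" if k: "k < d" for k
  proof
    show "Z k \<subseteq> Z (Suc k)" unfolding Z_def by (intro zariski_closure_mono image_mono) (auto simp: M_def)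
    have in1: "\<phi> (pt k) \<in> Z (Suc k)" unfolding Z_def using pt[OF k] subset_zariski_closure by blast
    have "\<phi> (pt k) \<notin> Z k"
    proof
      assume *: "\<phi> (pt k) \<in> Z k"
      have "\<phi> (pt k) (e k) - p (e k) = 0"
      proof (rule polyfun_zero_closure[OF _ _ _ *[unfolded Z_def]])
        show "(\<lambda>x. x (e k) - p (e k)) \<in> polyfun I" using eS[OF k] S by (intro polyfun_intros) auto
        show "\<phi> ` M k \<subseteq> affine_space I" using \<phi> Y by (auto simp: M_def)
        fix x assume "x \<in> \<phi> ` M k"
        then show "x (e k) - p (e k) = 0" using sec eS[OF k] k by (auto simp: M_def)
      qed
      moreover have "\<phi> (pt k) (e k) = p (e k) + complex_of_real (\<delta>/2)"
        using sec[of "pt k" "e k"] pt[OF k] eS[OF k] k by (simp add: M_def pt_def)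
      ultimately show False using \<open>\<delta> > 0\<close> by simp
    qed
    with in1 show "Z k \<noteq> Z (Suc k)" by blast
  qed
  ultimately have "enat d \<in> {enat d | d. \<exists>Z :: nat \<Rightarrow> ('v \<Rightarrow> complex) set.
     (\<forall>k \<le> d. irreducible_closed I (Z k) \<and> Z k \<subseteq> zariski_closure I Y) \<and>
     (\<forall>k < d. Z k \<subset> Z (Suc k))}" by blast
  then show ?thesis unfolding variety_dim_def d_def by (rule Sup_upper)
qed

text \<open>A polynomial that vanishes on the projection vanishes on an open polydisc.\<close>

lemma independent_in_polydisc:
  assumes "finite S" "\<delta> > 0" "\<And>s. s \<in> polydisc S p \<delta> \<Longrightarrow> \<exists>x\<in>X. \<forall>v\<in>S. x v = s v"
  shows "independent_in X S"
  unfolding independent_in_def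
proof (intro ballI impI)
  fix q assume q: "q \<in> polys_in S" "\<forall>y\<in>coord_proj S ` X. poly_eval y q = 0"
  show "q = 0"
  proof (rule ccontr)
    assume "q \<noteq> 0"
    from poly_eval_nonzero_polydisc[OF assms(1) q(1) this assms(2), of p]
    obtain x where x: "\<forall>v\<in>S. norm (x v - p v) < \<delta>" "poly_eval x q \<noteq> 0" by blast
    have "restrict x S \<in> polydisc S p \<delta>" using x(1) by (auto simp: polydisc_def)
    from assms(3)[OF this] obtain y where y: "y \<in> X" "\<forall>v\<in>S. y v = x v" by auto
    have "poly_eval (restrict y S) q = poly_eval x q" by (rule poly_eval_cong[OF q(1)]) (use y in auto)
    moreover have "poly_eval (restrict y S) q = 0" using q(2) y(1) by blast
    ultimately show False using x(2) by simp
  qed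
qed

text \<open>From above, all coordinates are polynomials in \<open>S\<close>; from below, the
  inclusion of the polydisc serves as the analytic section.\<close>

lemma variety_dim_dense_projection:
  assumes "finite S" "\<delta> > 0" "\<And>s. s \<in> polydisc S p \<delta> \<Longrightarrow> \<exists>x\<in>X. \<forall>v\<in>S. x v = s v"
  shows "variety_dim S (coord_proj S ` X) = enat (card S)"
proof (rule antisym)
  have aff: "coord_proj S ` X \<subseteq> affine_space S" by auto
  show "variety_dim S (coord_proj S ` X) \<le> enat (card S)"
  proof (rule variety_dim_le)
    fix Z :: "('a \<Rightarrow> complex) set" assume "irreducible_closed S Z"
    then have gf: "genfin S S Z (\<lambda>_. 1) {\<lambda>_. 1}"
      by (intro genfin_trivial) (auto simp: irreducible_closed_def)
    have "\<forall>v\<in>S. galg S Z (\<lambda>_. 1) {\<lambda>_. 1} (\<lambda>x. x v)"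
      using galg_polyfun_base[OF gf polyfun_var] by blast
    with gf assms(1) show "\<exists>T h B. finite T \<and> card T \<le> card S \<and> genfin S T Z h B \<and> (\<forall>v\<in>S. galg T Z h B (\<lambda>x. x v))"
      by blast
  qed
  show "enat (card S) \<le> variety_dim S (coord_proj S ` X)"
  proof (rule variety_dim_ge[OF assms(1) order_refl aff assms(2), where p = p and \<phi> = "\<lambda>s. s"])
    fix s assume s: "s \<in> polydisc S p \<delta>"
    from assms(3)[OF s] obtain x where x: "x \<in> X" "\<forall>v\<in>S. x v = s v" by blast
    have "restrict x S = s"
    proof
      fix v
      show "restrict x S v = s v"
        using x(2) s PiE_arb[of s S "\<lambda>_. UNIV" v] by (cases "v \<in> S") (simp_all add: polydisc_def)
    qed
    then show "s \<in> coord_proj S ` X" by (intro image_eqI[OF _ x(1)]) (rule sym)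
  next
    fix v assume "v \<in> S"
    then show "holomorphic_on_lines S p \<delta> (\<lambda>s. s v)"
      by (auto simp: holomorphic_on_lines_def cline_def intro!: holomorphic_intros)
  qed auto
qed

section \<open>Newton iteration for quadratic systems\<close>

lemma norm_double_sum_le:
  fixes a y :: "'v \<Rightarrow> 'v \<Rightarrow> complex"
  assumes "\<And>u v. u \<in> I \<Longrightarrow> v \<in> I \<Longrightarrow> norm (y u v) \<le> t" "(\<Sum>u\<in>I. \<Sum>v\<in>I. norm (a u v)) \<le> C" "t \<ge> 0"
  shows "norm (\<Sum>u\<in>I. \<Sum>v\<in>I. a u v * y u v) \<le> C * t"
proof -
  have "norm (\<Sum>u\<in>I. \<Sum>v\<in>I. a u v * y u v) \<le> (\<Sum>u\<in>I. \<Sum>v\<in>I. norm (a u v) * t)"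
    by (intro sum_norm_le order.trans[OF norm_mult_ineq] mult_left_mono assms) auto
  also have "\<dots> = (\<Sum>u\<in>I. \<Sum>v\<in>I. norm (a u v)) * t" by (simp add: sum_distrib_right)
  also have "\<dots> \<le> C * t" using assms by (intro mult_right_mono) auto
  finally show ?thesis .
qed

text \<open>An implicit function theorem in which \<open>b\<close> is a right inverse of the
  derivative at \<open>p\<close>, supported outside \<open>E\<close>. For a point p + \<sigma> +
  \<Sum> \<eta>_k b_k, with \<sigma> the prescribed displacement on \<open>E\<close>, a quadratic
  system has no remainder term: it says exactly that \<eta> is a fixed point of
  \<open>\<psi> s\<close>. The derivative stays frozen at \<open>p\<close>, and the iteration is a
  contraction.\<close>

lemma quadratic_implicit_section:
  fixes c :: "'k \<Rightarrow> 'v \<Rightarrow> 'v \<Rightarrow> complex"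
  assumes I: "finite I" and K: "finite K" and E: "E \<subseteq> I"
    and root: "\<And>k. k \<in> K \<Longrightarrow> (\<Sum>u\<in>I. \<Sum>v\<in>I. c k u v * (p u * p v)) = d k"
    and bE: "\<And>k v. k \<in> K \<Longrightarrow> v \<in> E \<Longrightarrow> b k v = 0"
    and lin: "\<And>k k'. k \<in> K \<Longrightarrow> k' \<in> K \<Longrightarrow>
      (\<Sum>u\<in>I. \<Sum>v\<in>I. c k' u v * (p u * b k v + b k u * p v)) = (if k' = k then 1 else 0)"
  obtains \<delta> \<phi> where "\<delta> > 0"
    and "\<And>s. s \<in> polydisc E p \<delta> \<Longrightarrow> \<phi> s \<in> affine_space I"
    and "\<And>s v. s \<in> polydisc E p \<delta> \<Longrightarrow> v \<in> E \<Longrightarrow> \<phi> s v = s v"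
    and "\<And>s k. s \<in> polydisc E p \<delta> \<Longrightarrow> k \<in> K \<Longrightarrow> (\<Sum>u\<in>I. \<Sum>v\<in>I. c k u v * (\<phi> s u * \<phi> s v)) = d k"
    and "\<And>v. v \<in> I \<Longrightarrow> holomorphic_on_lines E p \<delta> (\<lambda>s. \<phi> s v)"
proof -
  \<comment> \<open>The summands 1 make these constants at least 1, so they may be divided by and
    compared by monotonicity.\<close>
  define C where "C = 1 + (\<Sum>k\<in>K. \<Sum>u\<in>I. \<Sum>v\<in>I. norm (c k u v))"
  define P where "P = 1 + (\<Sum>v\<in>I. norm (p v))"
  define \<beta> where "\<beta> = 1 + (\<Sum>v\<in>I. \<Sum>k\<in>K. norm (b k v))"
  have C1: "C \<ge> 1" and P1: "P \<ge> 1" and \<beta>1: "\<beta> \<ge> 1"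
    unfolding C_def P_def \<beta>_def by (auto intro!: sum_nonneg)
  have C: "(\<Sum>u\<in>I. \<Sum>v\<in>I. norm (c k u v)) \<le> C" if "k \<in> K" for k
  proof -
    have "(\<Sum>u\<in>I. \<Sum>v\<in>I. norm (c k u v)) \<le> (\<Sum>k\<in>K. \<Sum>u\<in>I. \<Sum>v\<in>I. norm (c k u v))"
      by (rule member_le_sum[OF that _ K, of "\<lambda>k. \<Sum>u\<in>I. \<Sum>v\<in>I. norm (c k u v)"]) (auto intro!: sum_nonneg)
    then show ?thesis by (simp add: C_def)
  qed
  have P: "norm (p v) \<le> P" if "v \<in> I" for v
    using member_le_sum[OF that _ I, of "\<lambda>v. norm (p v)"] by (simp add: P_def)
  have \<beta>: "(\<Sum>k\<in>K. norm (b k v)) \<le> \<beta>" if "v \<in> I" for v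
    using member_le_sum[OF that _ I, of "\<lambda>v. \<Sum>k\<in>K. norm (b k v)"] by (simp add: \<beta>_def sum_nonneg)
  \<comment> \<open>With this \<open>e\<close>, displacements of size at most 2 \<beta> e give a
    quadratic part of size at most e/2 and with Lipschitz constant 1/2. The choice of
    \<open>\<delta>\<close> bounds the linear part by e/2, so coefficients of size at most
    \<open>e\<close> are mapped to such coefficients again.\<close>
  define e where "e = 1 / (8 * C * \<beta>\<^sup>2)"
  define \<delta> where "\<delta> = e / (4 * C * P)"
  have e0: "e > 0" unfolding e_def using C1 \<beta>1 by simp
  have \<delta>0: "\<delta> > 0" unfolding \<delta>_def using e0 C1 P1 by simp
  have e8: "8 * C * \<beta>\<^sup>2 * e = 1" unfolding e_def using C1 \<beta>1 by simp
  have \<delta>4: "4 * C * P * \<delta> = e" unfolding \<delta>_def using C1 P1 by simp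
  have CP1: "C * P \<ge> 1" using C1 P1 mult_mono[of 1 C 1 P] by simp
  have \<delta>e: "\<delta> \<le> \<beta> * e"
  proof -
    have "\<delta> \<le> 4 * (C * P) * \<delta>" using CP1 \<delta>0 mult_right_mono[of 1 "4 * (C * P)" \<delta>] by simp
    also have "\<dots> = e" using \<delta>4 by (simp add: mult.assoc)
    also have "\<dots> \<le> \<beta> * e" using \<beta>1 e0 by simp
    finally show ?thesis .
  qed
  define \<sigma> where "\<sigma> s v = (if v \<in> E then s v - p v else 0)" for s :: "'v \<Rightarrow> complex" and v
  define Y where "Y s \<eta> v = \<sigma> s v + (\<Sum>k\<in>K. \<eta> k * b k v)" for s \<eta> v
  define L where "L k y = (\<Sum>u\<in>I. \<Sum>v\<in>I. c k u v * (p u * y v + y u * p v))" for k y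
  define Q where "Q k y = (\<Sum>u\<in>I. \<Sum>v\<in>I. c k u v * (y u * y v))" for k y
  define \<psi> where "\<psi> s \<eta> k = - L k (\<sigma> s) - Q k (Y s \<eta>)" for s \<eta> k
  define h where "h n s = ((\<psi> s) ^^ n) (\<lambda>_. 0)" for n s
  have h0: "h 0 s k = 0" and hS: "h (Suc n) s = \<psi> s (h n s)" for n s k
    by (simp_all add: h_def)
  let ?D = "polydisc E p \<delta>"
  have \<sigma>b: "norm (\<sigma> s v) \<le> \<delta>" if "s \<in> ?D" for s v
    using that \<delta>0 by (auto simp: \<sigma>_def polydisc_def less_imp_le)
  have bsum: "norm (\<Sum>k\<in>K. \<eta> k * b k v) \<le> \<beta> * t" if "\<And>k. k \<in> K \<Longrightarrow> norm (\<eta> k) \<le> t" "t \<ge> 0" "v \<in> I" for \<eta> t v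
  proof -
    have "norm (\<Sum>k\<in>K. \<eta> k * b k v) \<le> (\<Sum>k\<in>K. t * norm (b k v))"
      by (intro sum_norm_le order.trans[OF norm_mult_ineq] mult_right_mono that(1)) auto
    also have "\<dots> = (\<Sum>k\<in>K. norm (b k v)) * t" by (simp add: sum_distrib_left mult.commute)
    also have "\<dots> \<le> \<beta> * t" using \<beta>[OF that(3)] that(2) by (rule mult_right_mono)
    finally show ?thesis .
  qed
  have Yb: "norm (Y s \<eta> v) \<le> 2 * \<beta> * e" if "s \<in> ?D" "\<And>k. k \<in> K \<Longrightarrow> norm (\<eta> k) \<le> e" "v \<in> I" for s \<eta> v
  proof -
    have "norm (Y s \<eta> v) \<le> norm (\<sigma> s v) + norm (\<Sum>k\<in>K. \<eta> k * b k v)" unfolding Y_def by (rule norm_triangle_ineq)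
    also have "\<dots> \<le> \<beta> * e + \<beta> * e"
      using \<sigma>b[OF that(1), of v] \<delta>e bsum[of \<eta> e v] that(2,3) e0 by (intro add_mono) auto
    finally show ?thesis by simp
  qed
  have YY: "norm (Y s \<eta> v - Y s \<eta>' v) \<le> \<beta> * t" if "\<And>k. k \<in> K \<Longrightarrow> norm (\<eta> k - \<eta>' k) \<le> t" "t \<ge> 0" "v \<in> I" for s \<eta> \<eta>' t v
  proof -
    have "Y s \<eta> v - Y s \<eta>' v = (\<Sum>k\<in>K. (\<eta> k - \<eta>' k) * b k v)"
      by (simp add: Y_def left_diff_distrib sum_subtractf)
    then show ?thesis using bsum[of "\<lambda>k. \<eta> k - \<eta>' k" t v] that by simp
  qed
  have \<psi>b: "norm (\<psi> s \<eta> k) \<le> e" if s: "s \<in> ?D" and \<eta>: "\<And>k. k \<in> K \<Longrightarrow> norm (\<eta> k) \<le> e" and k: "k \<in> K" for s \<eta> k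
  proof -
    have "norm (L k (\<sigma> s)) \<le> C * (2 * P * \<delta>)"
      unfolding L_def
    proof (rule norm_double_sum_le[OF _ C[OF k]])
      fix u v assume u: "u \<in> I" "v \<in> I"
      have "norm (p u * \<sigma> s v + \<sigma> s u * p v) \<le> norm (p u) * norm (\<sigma> s v) + norm (\<sigma> s u) * norm (p v)"
        by (metis norm_mult norm_triangle_ineq)
      also have "\<dots> \<le> P * \<delta> + \<delta> * P"
        using u P1 \<delta>0 by (intro add_mono mult_mono P \<sigma>b s) auto
      finally show "norm (p u * \<sigma> s v + \<sigma> s u * p v) \<le> 2 * P * \<delta>" by simp
    qed (use P1 \<delta>0 in auto)
    moreover have "norm (Q k (Y s \<eta>)) \<le> C * (2 * \<beta> * e * (2 * \<beta> * e))"
      unfolding Q_def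
    proof (rule norm_double_sum_le[OF _ C[OF k]])
      fix u v assume u: "u \<in> I" "v \<in> I"
      show "norm (Y s \<eta> u * Y s \<eta> v) \<le> 2 * \<beta> * e * (2 * \<beta> * e)"
        unfolding norm_mult using \<beta>1 e0 u by (intro mult_mono Yb s \<eta>) auto
    qed (use \<beta>1 e0 in auto)
    moreover have "C * (2 * \<beta> * e * (2 * \<beta> * e)) = e / 2"
    proof -
      have "C * (2 * \<beta> * e * (2 * \<beta> * e)) = (8 * C * \<beta>\<^sup>2 * e) * e / 2" by (simp add: power2_eq_square)
      then show ?thesis by (simp only: e8)
    qed
    moreover have "C * (2 * P * \<delta>) = e / 2" using \<delta>4 by simp
    moreover have "norm (\<psi> s \<eta> k) \<le> norm (L k (\<sigma> s)) + norm (Q k (Y s \<eta>))"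
      unfolding \<psi>_def by (metis norm_minus_cancel norm_triangle_ineq4)
    ultimately show ?thesis by linarith
  qed
  have \<psi>l: "norm (\<psi> s \<eta> k - \<psi> s \<eta>' k) \<le> t / 2" if s: "s \<in> ?D" and \<eta>: "\<And>k. k \<in> K \<Longrightarrow> norm (\<eta> k) \<le> e"
    and \<eta>': "\<And>k. k \<in> K \<Longrightarrow> norm (\<eta>' k) \<le> e" and t: "\<And>k. k \<in> K \<Longrightarrow> norm (\<eta> k - \<eta>' k) \<le> t" "t \<ge> 0" and k: "k \<in> K"
    for s \<eta> \<eta>' k t
  proof -
    have eq: "\<psi> s \<eta>' k - \<psi> s \<eta> k = (\<Sum>u\<in>I. \<Sum>v\<in>I. c k u v * (Y s \<eta> u * Y s \<eta> v - Y s \<eta>' u * Y s \<eta>' v))"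
      by (simp add: \<psi>_def Q_def right_diff_distrib sum_subtractf)
    have "norm (\<psi> s \<eta>' k - \<psi> s \<eta> k) \<le> C * (2 * (2 * \<beta> * e * (\<beta> * t)))"
      unfolding eq
    proof (rule norm_double_sum_le[OF _ C[OF k]])
      fix u v assume u: "u \<in> I" "v \<in> I"
      have eq': "Y s \<eta> u * Y s \<eta> v - Y s \<eta>' u * Y s \<eta>' v =
          (Y s \<eta> u - Y s \<eta>' u) * Y s \<eta> v + Y s \<eta>' u * (Y s \<eta> v - Y s \<eta>' v)" by (simp add: algebra_simps)
      have "norm (Y s \<eta> u * Y s \<eta> v - Y s \<eta>' u * Y s \<eta>' v) \<le> norm (Y s \<eta> u - Y s \<eta>' u) * norm (Y s \<eta> v) + norm (Y s \<eta>' u) * norm (Y s \<eta> v - Y s \<eta>' v)"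
        unfolding eq' by (metis norm_mult norm_triangle_ineq)
      also have "\<dots> \<le> \<beta> * t * (2 * \<beta> * e) + 2 * \<beta> * e * (\<beta> * t)"
      proof -
        have "norm (Y s \<eta> w - Y s \<eta>' w) \<le> \<beta> * t" if "w \<in> I" for w
          using YY[of \<eta> \<eta>' t w s] t that by simp
        moreover have "norm (Y s \<eta> w) \<le> 2 * \<beta> * e" if "w \<in> I" for w
          using Yb[of s \<eta> w] s \<eta> that by simp
        moreover have "norm (Y s \<eta>' w) \<le> 2 * \<beta> * e" if "w \<in> I" for w
          using Yb[of s \<eta>' w] s \<eta>' that by simp
        ultimately show ?thesis using \<beta>1 e0 t(2) u by (intro add_mono mult_mono) simp_all
      qed
      finally show "norm (Y s \<eta> u * Y s \<eta> v - Y s \<eta>' u * Y s \<eta>' v) \<le> 2 * (2 * \<beta> * e * (\<beta> * t))"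
        by (simp add: mult_ac)
    qed (use \<beta>1 e0 t in auto)
    also have "C * (2 * (2 * \<beta> * e * (\<beta> * t))) = (8 * C * \<beta>\<^sup>2 * e) * t / 2" by (simp add: power2_eq_square)
    also have "\<dots> = t / 2" by (simp only: e8)
    finally show ?thesis by (simp add: norm_minus_commute)
  qed
  have hb: "norm (h n s k) \<le> e" if "s \<in> ?D" "k \<in> K" for n s k
    using that(2)
  proof (induction n arbitrary: k)
    case (Suc n)
    show ?case unfolding hS by (rule \<psi>b[OF that(1) Suc.IH Suc.prems])
  qed (use e0 in \<open>simp add: h0\<close>)
  have hd: "norm (h (Suc n) s k - h n s k) \<le> e * (1/2) ^ n" if "s \<in> ?D" "k \<in> K" for n s k
    using that(2)
  proof (induction n arbitrary: k)
    case 0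
    then show ?case using hb[OF that(1) 0, of 1] by (simp add: h0)
  next
    case (Suc n)
    have "norm (\<psi> s (h (Suc n) s) k - \<psi> s (h n s) k) \<le> e * (1/2) ^ n / 2"
      by (rule \<psi>l[OF that(1) hb[OF that(1)] hb[OF that(1)] Suc.IH _ Suc.prems]) (use e0 in auto)
    then show ?case unfolding hS[of "Suc n"] hS[of n, symmetric] using hS[of n s] by simp
  qed
  \<comment> \<open>The limit is taken as a telescoping series, so that a geometric majorant gives
    convergence uniformly in \<open>s\<close>.\<close>
  define g where "g s k = suminf (\<lambda>n. h (Suc n) s k - h n s k)" for s k
  have summ: "summable (\<lambda>n. e * (1/2) ^ n)" by (intro summable_mult summable_geometric) simp
  have ul: "uniform_limit ?D (\<lambda>n s. h n s k) (\<lambda>s. g s k) sequentially" if "k \<in> K" for k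
  proof -
    have "uniform_limit ?D (\<lambda>n s. \<Sum>i<n. h (Suc i) s k - h i s k) (\<lambda>s. suminf (\<lambda>i. h (Suc i) s k - h i s k)) sequentially"
      using hd[OF _ that] by (intro Weierstrass_m_test[OF _ summ]) auto
    moreover have "(\<Sum>i<n. h (Suc i) s k - h i s k) = h n s k" for n s
      using sum_lessThan_telescope[of "\<lambda>i. h i s k" n] by (simp add: h0)
    ultimately show ?thesis by (simp add: g_def)
  qed
  have lim: "(\<lambda>n. h n s k) \<longlonglongrightarrow> g s k" if "s \<in> ?D" "k \<in> K" for s k
    using tendsto_uniform_limitI[OF ul[OF that(2)] that(1)] .
  have fixpoint: "g s k = \<psi> s (g s) k" if s: "s \<in> ?D" and k: "k \<in> K" for s k
  proof (rule LIMSEQ_unique)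
    show "(\<lambda>n. h (Suc n) s k) \<longlonglongrightarrow> g s k" using lim[OF s k] by (rule LIMSEQ_Suc)
    show "(\<lambda>n. h (Suc n) s k) \<longlonglongrightarrow> \<psi> s (g s) k"
      unfolding hS \<psi>_def Q_def Y_def by (intro tendsto_intros lim s)
  qed
  define \<phi> where "\<phi> s = (\<lambda>v\<in>I. p v + Y s (g s) v)" for s
  show thesis
  proof (rule that[OF \<delta>0, of \<phi>])
    show "\<phi> s \<in> affine_space I" for s by (simp add: \<phi>_def)
    show "\<phi> s v = s v" if "v \<in> E" for s v
      using that E bE by (auto simp: \<phi>_def Y_def \<sigma>_def)
  next
    fix s k assume s: "s \<in> ?D" and k: "k \<in> K"
    let ?y = "Y s (g s)"
    have "(\<Sum>u\<in>I. \<Sum>v\<in>I. c k u v * (\<phi> s u * \<phi> s v)) = (\<Sum>u\<in>I. \<Sum>v\<in>I. c k u v * (p u * p v) + c k u v * (p u * ?y v + ?y u * p v) + c k u v * (?y u * ?y v))"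
      by (intro sum.cong refl) (simp add: \<phi>_def algebra_simps)
    also have "\<dots> = d k + L k ?y + Q k ?y"
      by (simp add: sum.distrib root[OF k] L_def Q_def)
    also have "L k ?y = L k (\<sigma> s) + (\<Sum>k'\<in>K. g s k' * (\<Sum>u\<in>I. \<Sum>v\<in>I. c k u v * (p u * b k' v + b k' u * p v)))"
    proof -
      have "L k ?y = (\<Sum>u\<in>I. \<Sum>v\<in>I. c k u v * (p u * \<sigma> s v + \<sigma> s u * p v) +
          (\<Sum>k'\<in>K. g s k' * (c k u v * (p u * b k' v + b k' u * p v))))"
        unfolding L_def
      proof (intro sum.cong refl)
        fix u v
        have "c k u v * (p u * ?y v + ?y u * p v) = c k u v * (p u * \<sigma> s v + \<sigma> s u * p v) +
            c k u v * (p u * (\<Sum>k'\<in>K. g s k' * b k' v) + (\<Sum>k'\<in>K. g s k' * b k' u) * p v)"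
          by (simp add: Y_def algebra_simps)
        also have "c k u v * (p u * (\<Sum>k'\<in>K. g s k' * b k' v) + (\<Sum>k'\<in>K. g s k' * b k' u) * p v) =
            (\<Sum>k'\<in>K. g s k' * (c k u v * (p u * b k' v + b k' u * p v)))"
          by (simp add: sum_distrib_left sum_distrib_right sum.distrib[symmetric] algebra_simps)
        finally show "c k u v * (p u * ?y v + ?y u * p v) = c k u v * (p u * \<sigma> s v + \<sigma> s u * p v) +
            (\<Sum>k'\<in>K. g s k' * (c k u v * (p u * b k' v + b k' u * p v)))" .
      qed
      also have "\<dots> = L k (\<sigma> s) + (\<Sum>u\<in>I. \<Sum>v\<in>I. \<Sum>k'\<in>K. g s k' * (c k u v * (p u * b k' v + b k' u * p v)))"
        by (simp add: sum.distrib L_def)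
      also have "(\<Sum>u\<in>I. \<Sum>v\<in>I. \<Sum>k'\<in>K. g s k' * (c k u v * (p u * b k' v + b k' u * p v))) =
          (\<Sum>u\<in>I. \<Sum>k'\<in>K. \<Sum>v\<in>I. g s k' * (c k u v * (p u * b k' v + b k' u * p v)))"
        by (intro sum.cong refl) (rule sum.swap)
      also have "\<dots> = (\<Sum>k'\<in>K. \<Sum>u\<in>I. \<Sum>v\<in>I. g s k' * (c k u v * (p u * b k' v + b k' u * p v)))"
        by (rule sum.swap)
      finally show ?thesis by (simp add: sum_distrib_left)
    qed
    also have "(\<Sum>k'\<in>K. g s k' * (\<Sum>u\<in>I. \<Sum>v\<in>I. c k u v * (p u * b k' v + b k' u * p v))) = (\<Sum>k'\<in>K. if k' = k then g s k else 0)"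
      by (intro sum.cong refl) (auto simp: lin k)
    also have "\<dots> = g s k" using K k by simp
    also have "d k + (L k (\<sigma> s) + g s k) + Q k ?y = d k"
      using fixpoint[OF s k] by (simp add: \<psi>_def)
    finally show "(\<Sum>u\<in>I. \<Sum>v\<in>I. c k u v * (\<phi> s u * \<phi> s v)) = d k" .
  next
    fix v assume v: "v \<in> I"
    show "holomorphic_on_lines E p \<delta> (\<lambda>s. \<phi> s v)"
      unfolding holomorphic_on_lines_def
    proof (intro ballI)
      fix s s' assume s: "s \<in> ?D" "s' \<in> ?D"
      let ?U = "line_dom E p \<delta> s s'"
      have U: "open ?U" using open_line_dom finite_subset[OF E I] by blast
      have \<sigma>h: "(\<lambda>z. \<sigma> (cline E s s' z) w) holomorphic_on ?U" for w
        by (cases "w \<in> E") (auto simp: \<sigma>_def cline_def intro!: holomorphic_intros)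
      have hh: "(\<lambda>z. h n (cline E s s' z) k) holomorphic_on ?U" for n k
      proof (induction n arbitrary: k)
        case (Suc n)
        show ?case unfolding hS \<psi>_def L_def Q_def Y_def by (intro holomorphic_intros \<sigma>h Suc)
      qed (simp add: h0)
      \<comment> \<open>Along a line the iterates are holomorphic, and locally uniform convergence
        passes this on to the limit.\<close>
      have gh: "(\<lambda>z. g (cline E s s' z) k) holomorphic_on ?U" if k: "k \<in> K" for k
      proof (rule holomorphic_uniform_sequence[OF U hh])
        fix z assume "z \<in> ?U"
        then obtain r where r: "r > 0" "cball z r \<subseteq> ?U" using U open_contains_cball by blast
        have "uniform_limit (cball z r) (\<lambda>n z. h n (cline E s s' z) k) (\<lambda>z. g (cline E s s' z) k) sequentially"
          by (rule uniform_limit_compose'[OF ul[OF k]]) (use r in \<open>auto simp: line_dom_def\<close>)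
        with r show "\<exists>r. 0 < r \<and> cball z r \<subseteq> ?U \<and> uniform_limit (cball z r) (\<lambda>n z. h n (cline E s s' z) k) (\<lambda>z. g (cline E s s' z) k) sequentially"
          by blast
      qed
      show "(\<lambda>z. \<phi> (cline E s s' z) v) holomorphic_on ?U"
        using v unfolding \<phi>_def Y_def by (simp del: restrict_apply add: restrict_apply') (intro holomorphic_intros \<sigma>h gh)
    qed
  qed
qed

section \<open>Algebraic dependence\<close>

lemma funtf_variety_iff:
  "w \<in> funtf_variety n r \<longleftrightarrow> w \<in> affine_space (index_grid n r) \<and>
     (\<forall>a<n. \<forall>b<n. (\<Sum>j<r. w (a, j) * w (b, j)) = (if a = b then of_nat r / of_nat n else 0)) \<and>
     (\<forall>j<r. (\<Sum>a<n. w (a, j) * w (a, j)) = 1)"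
proof -
  let ?W = "Matrix.mat n r w"
  have 1: "?W * ?W\<^sup>T = (of_nat r / of_nat n) \<cdot>\<^sub>m 1\<^sub>m n \<longleftrightarrow>
      (\<forall>a<n. \<forall>b<n. (\<Sum>j<r. w (a, j) * w (b, j)) = (if a = b then of_nat r / of_nat n else 0))"
    by (simp add: mat_eq_iff scalar_prod_def atLeast0LessThan)
  have 2: "diag_mat (?W\<^sup>T * ?W) = diag_mat (1\<^sub>m r) \<longleftrightarrow> (\<forall>j<r. (\<Sum>a<n. w (a, j) * w (a, j)) = 1)"
    by (simp add: diag_mat_def scalar_prod_def atLeast0LessThan map_eq_conv Ball_def)
  show ?thesis by (simp only: funtf_variety_def Let_def mem_Collect_eq 1 2)
qed

lemma funtf_variety_subset: "funtf_variety n r \<subseteq> affine_space (index_grid n r)"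
  by (auto simp: funtf_variety_def)

lemma funtf_closure_equations:
  assumes x: "x \<in> zariski_closure (index_grid n r) (funtf_variety n r)"
  shows "a < n \<Longrightarrow> b < n \<Longrightarrow> (\<Sum>j<r. x (a, j) * x (b, j)) = (if a = b then of_nat r / of_nat n else 0)"
    and "j < r \<Longrightarrow> (\<Sum>a<n. x (a, j) * x (a, j)) = 1"
proof -
  note zero = polyfun_zero_closure[OF _ funtf_variety_subset _ x]
  show "(\<Sum>j<r. x (a, j) * x (b, j)) = (if a = b then of_nat r / of_nat n else 0)" if "a < n" "b < n"
  proof -
    have "(\<Sum>j<r. x (a, j) * x (b, j)) - (if a = b then of_nat r / of_nat n else 0) = 0"
      by (rule zero) (use that in \<open>auto simp: funtf_variety_iff intro!: polyfun_intros\<close>)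
    then show ?thesis by simp
  qed
  show "(\<Sum>a<n. x (a, j) * x (a, j)) = 1" if "j < r"
  proof -
    have "(\<Sum>a<n. x (a, j) * x (a, j)) - 1 = 0"
      by (rule zero) (use that in \<open>auto simp: funtf_variety_iff intro!: polyfun_intros\<close>)
    then show ?thesis by simp
  qed
qed

text \<open>A circuit argument. In a dependent subset of least size, the coefficients of a relation
  with respect to one of its variables \<open>\<tau>\<close> involve fewer variables, so a nonzero
  coefficient cannot vanish identically on \<open>Z\<close>. The relation is thus a genuine equation
  for \<open>\<tau>\<close> over the other coordinates. The point \<open>q\<close> certifies that
  \<open>G\<close> does not come from the zero polynomial; it may lie outside
  \<open>Z\<close>.\<close>

lemma dependent_genfin:
  assumes irr: "irreducible_closed I Z" and S: "finite S" "S \<subseteq> I"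
    and G: "G \<in> polyfun S" "G q \<noteq> 0" "\<And>x. x \<in> Z \<Longrightarrow> G x = 0"
  obtains \<tau> h B where "\<tau> \<in> S" "genfin I (S - {\<tau>}) Z h B" "\<And>v. v \<in> S \<Longrightarrow> galg (S - {\<tau>}) Z h B (\<lambda>x. x v)"
proof -
  obtain x0 where x0: "x0 \<in> Z" using irr by (auto simp: irreducible_closed_def)
  define dep where "dep S' \<longleftrightarrow> (\<exists>p\<in>polys_in S'. p \<noteq> 0 \<and> (\<forall>x\<in>Z. poly_eval x p = 0))" for S'
  have "dep S"
  proof -
    obtain p where p: "p \<in> polys_in S" "G = (\<lambda>x. poly_eval x p)" using G(1) by (auto simp: polyfun_def)
    have "p \<noteq> 0" using G(2) p(2) by auto
    with p G(3) show ?thesis unfolding dep_def by auto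
  qed
  then obtain S0 where S0: "S0 \<subseteq> S" "dep S0" and minimal: "\<And>S'. S' \<subseteq> S \<Longrightarrow> dep S' \<Longrightarrow> card S0 \<le> card S'"
    using arg_min_natI[of "\<lambda>S'. S' \<subseteq> S \<and> dep S'" S card] arg_min_nat_le[of "\<lambda>S'. S' \<subseteq> S \<and> dep S'" _ card] that
    by (metis (no_types, lifting) subset_refl)
  obtain p where p: "p \<in> polys_in S0" "p \<noteq> 0" "\<And>x. x \<in> Z \<Longrightarrow> poly_eval x p = 0"
    using S0(2) unfolding dep_def by blast
  have "S0 \<noteq> {}"
  proof
    assume e: "S0 = {}"
    with p(1) have p': "p \<in> polys_in {}" by simp
    obtain x where "poly_eval x p \<noteq> 0" using poly_eval_nonzero_polydisc[OF _ p' p(2), of 1] by auto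
    moreover have "poly_eval x p = poly_eval x0 p" by (rule poly_eval_cong[OF p']) simp
    ultimately show False using p(3)[OF x0] by simp
  qed
  then obtain \<tau> where \<tau>: "\<tau> \<in> S0" by blast
  then have "p \<in> polys_in (insert \<tau> S0)" using p(1) by (simp add: insert_absorb)
  from polys_in_expand[OF this] obtain n c where c: "\<And>i. c i \<in> polys_in (S0 - {\<tau>})"
    and pc: "p = (\<Sum>i\<le>n. c i * Poly_Mapping.single (Poly_Mapping.single \<tau> i) 1)" by blast
  have ex: "\<exists>i\<le>n. c i \<noteq> 0"
  proof (rule ccontr)
    assume "\<not> ?thesis"
    then have "p = 0" unfolding pc by (intro sum.neutral) simp
    with p(2) show False by simp
  qed
  \<comment> \<open>The degree in \<open>\<tau>\<close>. The number \<open>n\<close> is only an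
    upper bound for it, and the leading coefficient must be nonzero.\<close>
  define N where "N = Max {i. i \<le> n \<and> c i \<noteq> 0}"
  have N: "N \<le> n" "c N \<noteq> 0" and Nmax: "\<And>i. i \<le> n \<Longrightarrow> c i \<noteq> 0 \<Longrightarrow> i \<le> N"
  proof -
    have fin: "finite {i. i \<le> n \<and> c i \<noteq> 0}" by simp
    from Max_in[OF fin] ex show "N \<le> n" "c N \<noteq> 0" unfolding N_def by auto
    show "i \<le> N" if "i \<le> n" "c i \<noteq> 0" for i unfolding N_def using that by (intro Max_ge[OF fin]) simp
  qed
  have nv: "\<exists>x\<in>Z. poly_eval x (c i) \<noteq> 0" if "c i \<noteq> 0" for i
  proof (rule ccontr)
    assume "\<not> ?thesis"
    then have "dep (S0 - {\<tau>})" using c[of i] that unfolding dep_def by auto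
    then have "card S0 \<le> card (S0 - {\<tau>})" using S0(1) by (intro minimal) auto
    moreover have "card (S0 - {\<tau>}) < card S0" using \<tau> S0(1) S(1) by (intro card_Diff1_less) (auto dest: finite_subset)
    ultimately show False by simp
  qed
  have ev: "(\<Sum>i\<le>N. poly_eval x (c i) * x \<tau> ^ i) = poly_eval x p" for x
  proof -
    have "poly_eval x p = (\<Sum>i\<le>n. poly_eval x (c i) * x \<tau> ^ i)"
      unfolding pc by (simp add: poly_eval_sum poly_eval_mult)
    also have "\<dots> = (\<Sum>i\<le>N. poly_eval x (c i) * x \<tau> ^ i)"
      by (rule sum.mono_neutral_right) (use N Nmax in force)+
    finally show ?thesis by (rule sym)
  qed
  have N1: "N \<ge> 1"
  proof (rule ccontr)
    assume "\<not> ?thesis"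
    then have N0: "N = 0" by simp
    obtain x where x: "x \<in> Z" "poly_eval x (c 0) \<noteq> 0" using nv[OF N(2)] N0 by auto
    with ev[of x] p(3)[OF x(1)] N0 show False by simp
  qed
  let ?T = "S - {\<tau>}"
  have \<tau>S: "\<tau> \<in> S" using \<tau> S0 by blast
  have gf: "genfin I ?T Z (\<lambda>_. 1) {\<lambda>_. 1}" using S x0 by (intro genfin_trivial) auto
  have ci: "(\<lambda>x. poly_eval x (c i)) \<in> polyfun ?T" for i
    using polyfunI[OF c[of i]] polyfun_mono[of "S0 - {\<tau>}" ?T] S0(1) by blast
  have "\<exists>h' B'. genfin I ?T Z h' B' \<and> galg ?T Z h' B' (\<lambda>x. x \<tau>) \<and>
      (\<forall>f. galg ?T Z (\<lambda>_. 1) {\<lambda>_. 1} f \<longrightarrow> galg ?T Z h' B' f)"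
  proof (rule genfin_extend[OF irr gf _ N1, where a = "\<lambda>i x. poly_eval x (c i)"])
    show "(\<lambda>x. x \<tau>) \<in> polyfun I" using \<tau>S S by (intro polyfun_var) auto
    show "(\<lambda>x. poly_eval x (c i)) \<in> polyfun I" for i using ci[of i] polyfun_mono[of ?T I] S by blast
    show "galg ?T Z (\<lambda>_. 1) {\<lambda>_. 1} (\<lambda>x. poly_eval x (c i))" for i by (rule galg_polyfun_base[OF gf ci])
    show "\<exists>x\<in>Z. poly_eval x (c N) \<noteq> 0" by (rule nv[OF N(2)])
    show "(\<Sum>i\<le>N. poly_eval x (c i) * x \<tau> ^ i) = 0" if "x \<in> Z" for x using ev p(3)[OF that] by simp
  qed
  then obtain h B where hB: "genfin I ?T Z h B" "galg ?T Z h B (\<lambda>x. x \<tau>)"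
    "\<And>f. galg ?T Z (\<lambda>_. 1) {\<lambda>_. 1} f \<Longrightarrow> galg ?T Z h B f" by blast
  show thesis
  proof (rule that[OF \<tau>S hB(1)])
    fix v assume v: "v \<in> S"
    show "galg ?T Z h B (\<lambda>x. x v)"
    proof (cases "v = \<tau>")
      case True
      with hB(2) show ?thesis by simp
    next
      case False
      show ?thesis by (rule galg_polyfun_base[OF hB(1) polyfun_var]) (use v False in simp)
    qed
  qed
qed

text \<open>Each \<open>c k\<close> is a root of a quadratic equation over what is already
  algebraic; the roots are adjoined one after the other.\<close>

lemma genfin_extend_sqrts:
  assumes irr: "irreducible_closed I Z" and gf: "genfin I T Z h B" and A: "finite A"
    and c: "\<And>k. k \<in> A \<Longrightarrow> c k \<in> polyfun I"
    and a: "\<And>k. k \<in> A \<Longrightarrow> a k \<in> polyfun I" "\<And>k. k \<in> A \<Longrightarrow> galg T Z h B (a k)" "\<And>k. k \<in> A \<Longrightarrow> \<exists>x\<in>Z. a k x \<noteq> 0"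
    and g: "\<And>k. k \<in> A \<Longrightarrow> g k \<in> polyfun I" "\<And>k. k \<in> A \<Longrightarrow> galg T Z h B (g k)"
    and rel: "\<And>k x. k \<in> A \<Longrightarrow> x \<in> Z \<Longrightarrow> a k x * c k x ^ 2 = g k x"
  shows "\<exists>h' B'. genfin I T Z h' B' \<and> (\<forall>k\<in>A. galg T Z h' B' (c k)) \<and> (\<forall>f. galg T Z h B f \<longrightarrow> galg T Z h' B' f)"
  using A c a g rel
proof (induction A)
  case empty
  then show ?case using gf by blast
next
  case (insert k A)
  have "\<exists>h' B'. genfin I T Z h' B' \<and> (\<forall>k\<in>A. galg T Z h' B' (c k)) \<and> (\<forall>f. galg T Z h B f \<longrightarrow> galg T Z h' B' f)"
    by (rule insert.IH) (simp_all add: insert.prems)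
  then obtain h1 B1 where 1: "genfin I T Z h1 B1" "\<And>k. k \<in> A \<Longrightarrow> galg T Z h1 B1 (c k)"
    "\<And>f. galg T Z h B f \<Longrightarrow> galg T Z h1 B1 f" by blast
  define b where "b = (\<lambda>i::nat. if i = 2 then a k else if i = 0 then (\<lambda>x. - g k x) else (\<lambda>x. 0))"
  have gg: "galg T Z h1 B1 (\<lambda>x. - g k x)"
  proof -
    have "galg T Z h1 B1 (\<lambda>x. (- 1) * g k x)"
      by (rule galg_mult[OF 1(1) galg_polyfun_base[OF 1(1) polyfun_const] 1(3)]) (simp add: insert.prems)
    then show ?thesis by simp
  qed
  have "\<exists>h' B'. genfin I T Z h' B' \<and> galg T Z h' B' (c k) \<and> (\<forall>f. galg T Z h1 B1 f \<longrightarrow> galg T Z h' B' f)"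
  proof (rule genfin_extend[OF irr 1(1), where n = 2 and a = b])
    show "c k \<in> polyfun I" by (simp add: insert.prems)
    show "b i \<in> polyfun I" for i
      unfolding b_def by (simp add: insert.prems polyfun_uminus polyfun_const)
    show "galg T Z h1 B1 (b i)" for i
      unfolding b_def using gg galg_polyfun_base[OF 1(1) polyfun_const] by (simp add: insert.prems 1(3))
    show "\<exists>x\<in>Z. b 2 x \<noteq> 0" by (simp add: b_def insert.prems)
    fix x assume x: "x \<in> Z"
    have "(\<Sum>i\<le>2. b i x * c k x ^ i) = - g k x + a k x * c k x ^ 2"
      by (simp add: b_def numeral_2_eq_2)
    then show "(\<Sum>i\<le>2. b i x * c k x ^ i) = 0" using insert.prems(7)[OF _ x, of k] by simp
  qed simp
  then obtain h2 B2 where 2: "genfin I T Z h2 B2" "galg T Z h2 B2 (c k)"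
    "\<And>f. galg T Z h1 B1 f \<Longrightarrow> galg T Z h2 B2 f" by blast
  show ?case
  proof (intro exI conjI ballI allI impI)
    show "genfin I T Z h2 B2" by (rule 2)
    show "galg T Z h2 B2 (c k')" if "k' \<in> insert k A" for k' using that 1(2) 2(2,3) by auto
    show "galg T Z h2 B2 f" if "galg T Z h B f" for f using that 1(3) 2(3) by blast
  qed
qed

text \<open>Division with remainder by X^2 - s, where X is the coordinate \<open>u\<close>.\<close>

lemma polyfun_even_odd:
  assumes "F \<in> polyfun (insert u V)" "s \<in> polyfun V"
  shows "\<exists>A\<in>polyfun V. \<exists>B\<in>polyfun V. \<forall>x. x u ^ 2 = s x \<longrightarrow> F x = A x + B x * x u"
  using assms(1)
proof (induction rule: polyfun_induct)
  case (const c)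
  show ?case by (intro bexI[of _ "\<lambda>x. c"] bexI[of _ "\<lambda>x. 0"]) (auto intro: polyfun_intros)
next
  case (var v)
  show ?case
  proof (cases "v = u")
    case True
    show ?thesis by (intro bexI[of _ "\<lambda>x. 0"] bexI[of _ "\<lambda>x. 1"]) (auto simp: True intro: polyfun_intros)
  next
    case False
    then show ?thesis using var
      by (intro bexI[of _ "\<lambda>x. x v"] bexI[of _ "\<lambda>x. 0"]) (auto intro: polyfun_intros)
  qed
next
  case (add f g)
  obtain A B where AB: "A \<in> polyfun V" "B \<in> polyfun V" "\<forall>x. x u ^ 2 = s x \<longrightarrow> f x = A x + B x * x u"
    using add(3) by blast
  obtain C D where CD: "C \<in> polyfun V" "D \<in> polyfun V" "\<forall>x. x u ^ 2 = s x \<longrightarrow> g x = C x + D x * x u"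
    using add(4) by blast
  show ?case
    by (intro bexI[of _ "\<lambda>x. A x + C x"] bexI[of _ "\<lambda>x. B x + D x"])
      (use AB CD in \<open>auto simp: algebra_simps intro: polyfun_intros\<close>)
next
  case (mult f g)
  obtain A B where AB: "A \<in> polyfun V" "B \<in> polyfun V" "\<forall>x. x u ^ 2 = s x \<longrightarrow> f x = A x + B x * x u"
    using mult(3) by blast
  obtain C D where CD: "C \<in> polyfun V" "D \<in> polyfun V" "\<forall>x. x u ^ 2 = s x \<longrightarrow> g x = C x + D x * x u"
    using mult(4) by blast
  have "f x * g x = (A x * C x + B x * D x * s x) + (A x * D x + B x * C x) * x u" if "x u ^ 2 = s x" for x
    using AB(3) CD(3) that by (simp add: that[symmetric] power2_eq_square algebra_simps)
  then show ?case
    by (intro bexI[of _ "\<lambda>x. A x * C x + B x * D x * s x"] bexI[of _ "\<lambda>x. A x * D x + B x * C x"] allI impI)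
      (use AB CD assms(2) in \<open>auto intro!: polyfun_intros\<close>)
qed

text \<open>Taking norms eliminates square roots; a point at which all the square roots vanish survives.\<close>

lemma polyfun_eliminate_sqrts:
  assumes "finite K" "F \<in> polyfun (V \<union> u ` K)" "\<And>k. k \<in> K \<Longrightarrow> s k \<in> polyfun V"
    and "\<And>k x. k \<in> K \<Longrightarrow> x \<in> Z \<Longrightarrow> x (u k) ^ 2 = s k x" "\<And>x. x \<in> Z \<Longrightarrow> F x = 0"
    and "\<And>k. k \<in> K \<Longrightarrow> q (u k) = 0" "\<And>k. k \<in> K \<Longrightarrow> s k q = 0" "F q \<noteq> 0"
  shows "\<exists>G\<in>polyfun V. G q \<noteq> 0 \<and> (\<forall>x\<in>Z. G x = 0)"
  using assms
proof (induction K arbitrary: F)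
  case empty
  then show ?case by auto
next
  case (insert k K)
  have "F \<in> polyfun (insert (u k) (V \<union> u ` K))" using insert.prems(1) by simp
  moreover have sk: "s k \<in> polyfun (V \<union> u ` K)" using insert.prems(2)[of k] polyfun_mono[of V "V \<union> u ` K"] by blast
  ultimately have "\<exists>A\<in>polyfun (V \<union> u ` K). \<exists>B\<in>polyfun (V \<union> u ` K). \<forall>x. x (u k) ^ 2 = s k x \<longrightarrow> F x = A x + B x * x (u k)"
    by (rule polyfun_even_odd)
  then obtain A B where AB: "A \<in> polyfun (V \<union> u ` K)" "B \<in> polyfun (V \<union> u ` K)"
    "\<forall>x. x (u k) ^ 2 = s k x \<longrightarrow> F x = A x + B x * x (u k)" by blast
  let ?F = "\<lambda>x. A x * A x - B x * B x * s k x"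
  show ?case
  proof (rule insert.IH)
    show "?F \<in> polyfun (V \<union> u ` K)" using AB sk by (intro polyfun_intros)
    show "?F x = 0" if x: "x \<in> Z" for x
    proof -
      have 1: "x (u k) ^ 2 = s k x" using insert.prems(3)[of k x] x by simp
      then have "A x + B x * x (u k) = 0" using AB(3) insert.prems(4)[OF x] by simp
      then have "(A x + B x * x (u k)) * (A x - B x * x (u k)) = 0" by simp
      then show ?thesis by (simp add: 1[symmetric] power2_eq_square algebra_simps)
    qed
    have "F q = A q" using AB(3) insert.prems(5,6)[of k] by simp
    then show "?F q \<noteq> 0" using insert.prems(6)[of k] insert.prems(7) by simp
  qed (simp_all add: insert.prems)
qed

section \<open>Dimension of the variety for three rows\<close>

lemma sum_lessThan_3: "(\<Sum>a<3. f a) = f 0 + f 1 + f (2::nat)"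
  by (simp add: numeral_3_eq_3 numeral_2_eq_2)

lemma less_3_cases: "a < 3 \<longleftrightarrow> a = 0 \<or> a = 1 \<or> a = (2::nat)"
  by auto

text \<open>If column 0 were orthogonal to all others, W W^T would map it to itself, whereas
  tightness maps it to r/3 times itself. As r is not 3, the column would be zero, which contradicts
  its unit norm.\<close>

lemma exists_nonorthogonal_columns:
  fixes x :: "nat \<times> nat \<Rightarrow> complex"
  assumes "r \<ge> 4"
    and rows: "\<And>a b. a < 3 \<Longrightarrow> b < 3 \<Longrightarrow> (\<Sum>j<r. x (a, j) * x (b, j)) = (if a = b then of_nat r / 3 else 0)"
    and cols: "\<And>j. j < r \<Longrightarrow> (\<Sum>a<3. x (a, j) * x (a, j)) = 1"
  shows "\<exists>i<r. \<exists>j<r. i \<noteq> j \<and> (\<Sum>a<3. x (a, i) * x (a, j)) \<noteq> 0"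
proof (rule ccontr)
  assume neg: "\<not> ?thesis"
  have "x (b, 0) = 0" if b: "b < 3" for b
  proof -
    have "(\<Sum>j<r. (\<Sum>a<3. x (a, 0) * x (a, j)) * x (b, j)) = (\<Sum>j<r. if j = 0 then x (b, 0) else 0)"
    proof (intro sum.cong refl)
      fix j assume j: "j \<in> {..<r}"
      have "(\<Sum>a<3. x (a, 0) * x (a, j)) = (if j = 0 then 1 else 0)"
      proof (cases "j = 0")
        case True
        then show ?thesis using cols[of 0] assms(1) by simp
      next
        case False
        then show ?thesis using neg j assms(1) by auto
      qed
      then show "(\<Sum>a<3. x (a, 0) * x (a, j)) * x (b, j) = (if j = 0 then x (b, 0) else 0)" by simp
    qed
    also have "\<dots> = x (b, 0)" using assms(1) by simp
    finally have "x (b, 0) = (\<Sum>j<r. \<Sum>a<3. x (a, 0) * (x (a, j) * x (b, j)))"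
      by (simp add: sum_distrib_right mult.assoc)
    also have "\<dots> = (\<Sum>a<3. x (a, 0) * (\<Sum>j<r. x (a, j) * x (b, j)))"
      by (subst sum.swap) (simp add: sum_distrib_left)
    also have "\<dots> = (\<Sum>a<3. if a = b then x (b, 0) * (of_nat r / 3) else 0)"
      using b by (intro sum.cong refl) (simp add: rows)
    also have "\<dots> = x (b, 0) * (of_nat r / 3)" using b by simp
    finally have "x (b, 0) * (of_nat r / 3 - 1) = 0" by (simp add: algebra_simps)
    moreover have "of_nat r / 3 - 1 \<noteq> (0::complex)"
    proof
      assume "of_nat r / 3 - 1 = (0::complex)"
      then have "of_nat r = (of_nat 3 :: complex)" by simp
      then have "r = 3" by (simp only: of_nat_eq_iff)
      with assms(1) show False by simp
    qed
    ultimately show ?thesis by simp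
  qed
  then have "(\<Sum>a<3. x (a, 0) * x (a, 0)) = 0" by simp
  with cols[of 0] assms(1) show False by simp
qed

lemma card_lessThan_minus_two: "i < r \<Longrightarrow> j < r \<Longrightarrow> i \<noteq> j \<Longrightarrow> card ({..<r} - {i, j}) = r - (2::nat)"
  by (subst card_Diff_subset) auto

text \<open>
  Two non-orthogonal unit columns \<open>v\<close>, \<open>w\<close> are, up to finitely many choices, determined by
  \<open>M = v v\<^sup>T + w w\<^sup>T\<close>: if \<open>t = v \<bullet> w\<close>, then \<open>tr M\<^sup>2 = 2 + 2t\<^sup>2\<close>, and \<open>M\<^sup>2 - (1 - t) M = t (v + w) (v + w)\<^sup>T\<close>,
  \<open>M\<^sup>2 - (1 + t) M = - t (v - w) (v - w)\<^sup>T\<close>.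
\<close>

lemma two_unit_vectors_identities:
  fixes v w :: "nat \<Rightarrow> complex"
  assumes v: "(\<Sum>a<3. v a * v a) = 1" and w: "(\<Sum>a<3. w a * w a) = 1"
    and t: "(\<Sum>a<3. v a * w a) = t" and M: "\<And>a b. a < 3 \<Longrightarrow> b < 3 \<Longrightarrow> M a b = v a * v b + w a * w b"
  shows "a < 3 \<Longrightarrow> t * (v a + w a) ^ 2 = (\<Sum>b<3. M a b * M a b) + (- 1) * M a a + t * M a a"
    and "a < 3 \<Longrightarrow> (- 1) * t * (v a - w a) ^ 2 = (\<Sum>b<3. M a b * M a b) + (- 1) * M a a + (- 1) * (t * M a a)"
    and "t ^ 2 = ((\<Sum>a<3. \<Sum>b<3. M a b * M a b) - 2) / 2"
    and "M 0 0 * M 1 1 * M 2 2 + 2 * M 0 1 * M 1 2 * M 0 2 - M 0 0 * M 1 2 * M 1 2 - M 1 1 * M 0 2 * M 0 2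
      - M 2 2 * M 0 1 * M 0 1 = 0"
proof -
  have sq: "(\<Sum>b<3. M a b * M a b) = v a * v a + w a * w a + 2 * t * (v a * w a)" if a: "a < 3" for a
  proof -
    have "(\<Sum>b<3. M a b * M a b) = (\<Sum>b<3. v a * v a * (v b * v b) + 2 * (v a * w a) * (v b * w b) + w a * w a * (w b * w b))"
      using a by (intro sum.cong refl) (simp add: M algebra_simps)
    also have "\<dots> = v a * v a * (\<Sum>b<3. v b * v b) + 2 * (v a * w a) * (\<Sum>b<3. v b * w b) + w a * w a * (\<Sum>b<3. w b * w b)"
      by (simp only: sum.distrib sum_distrib_left)
    finally show ?thesis by (simp add: v w t)
  qed
  show "t * (v a + w a) ^ 2 = (\<Sum>b<3. M a b * M a b) + (- 1) * M a a + t * M a a"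
    and "(- 1) * t * (v a - w a) ^ 2 = (\<Sum>b<3. M a b * M a b) + (- 1) * M a a + (- 1) * (t * M a a)" if "a < 3"
    unfolding sq[OF that] M[OF that that] by (simp_all add: power2_eq_square algebra_simps)
  have "(\<Sum>a<3. \<Sum>b<3. M a b * M a b) = (\<Sum>a<3. v a * v a + w a * w a + 2 * t * (v a * w a))"
    by (intro sum.cong refl) (simp add: sq)
  also have "\<dots> = (\<Sum>a<3. v a * v a) + (\<Sum>a<3. w a * w a) + 2 * t * (\<Sum>a<3. v a * w a)"
    by (simp only: sum.distrib sum_distrib_left)
  finally show "t ^ 2 = ((\<Sum>a<3. \<Sum>b<3. M a b * M a b) - 2) / 2"
    by (simp add: v w t power2_eq_square)
  \<comment> \<open>The determinant of a symmetric 3 x 3 matrix; \<open>M\<close> has rank at most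
    two.\<close>
  show "M 0 0 * M 1 1 * M 2 2 + 2 * M 0 1 * M 1 2 * M 0 2 - M 0 0 * M 1 2 * M 1 2 - M 1 1 * M 0 2 * M 0 2
      - M 2 2 * M 0 1 * M 0 1 = 0"
    by (simp add: M algebra_simps)
qed

text \<open>The count: two rows of the r - 2 columns in \<open>J\<close> give 2 (r - 2) entries, and
  the determinant relation removes one of them. Everything else follows by square roots: the third
  row from the unit norms, then the scalar product \<open>t\<close>, then the sum and the difference
  of the columns \<open>i\<close> and \<open>j\<close>.\<close>

lemma funtf_3_genfin:
  assumes r: "r \<ge> 5" and irr: "irreducible_closed (index_grid 3 r) Z"
    and sub: "Z \<subseteq> zariski_closure (index_grid 3 r) (funtf_variety 3 r)"
  shows "\<exists>T h B. finite T \<and> card T \<le> 2 * r - 5 \<and> genfin (index_grid 3 r) T Z h B \<and>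
    (\<forall>v\<in>index_grid 3 r. galg T Z h B (\<lambda>x. x v))"
proof -
  let ?I = "index_grid 3 r"
  have rows: "(\<Sum>j<r. x (a, j) * x (b, j)) = (if a = b then of_nat r / 3 else 0)" if "x \<in> Z" "a < 3" "b < 3" for x a b
    using funtf_closure_equations(1)[of x 3 r a b] sub that by auto
  have cols: "(\<Sum>a<3. x (a, j) * x (a, j)) = 1" if "x \<in> Z" "j < r" for x j
    using funtf_closure_equations(2)[of x 3 r j] sub that by auto
  obtain x0 where x0: "x0 \<in> Z" using irr by (auto simp: irreducible_closed_def)
  have "\<exists>i<r. \<exists>j<r. i \<noteq> j \<and> (\<Sum>a<3. x0 (a, i) * x0 (a, j)) \<noteq> 0"
    using r x0 by (intro exists_nonorthogonal_columns rows cols) auto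
  \<comment> \<open>Non-orthogonality at a single point of \<open>Z\<close> is enough:
    \<open>t\<close> is then not identically zero on \<open>Z\<close>, as a denominator has to
    be.\<close>
  then obtain i j where ij: "i < r" "j < r" "i \<noteq> j" "(\<Sum>a<3. x0 (a, i) * x0 (a, j)) \<noteq> 0" by blast
  define t where "t x = (\<Sum>a<3. x (a, i) * x (a, j))" for x :: "nat \<times> nat \<Rightarrow> complex"
  define J where "J = {..<r} - {i, j}"
  define M where "M a b x = (if a = b then of_nat r / 3 else 0) - (\<Sum>k\<in>J. x (a, k) * x (b, k))"
    for a b and x :: "nat \<times> nat \<Rightarrow> complex"
  have J: "finite J" "J \<subseteq> {..<r}" "card J = r - 2"
    using ij card_lessThan_minus_two by (auto simp: J_def)
  have M: "M a b x = x (a, i) * x (b, i) + x (a, j) * x (b, j)" if "x \<in> Z" "a < 3" "b < 3" for a b x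
  proof -
    have "{..<r} = insert i (insert j J)" "i \<notin> insert j J" "j \<notin> J" using ij by (auto simp: J_def)
    then have "(\<Sum>k<r. x (a, k) * x (b, k)) = x (a, i) * x (b, i) + (x (a, j) * x (b, j) + (\<Sum>k\<in>J. x (a, k) * x (b, k)))"
      using J(1) by simp
    then show ?thesis using rows[OF that] by (simp add: M_def)
  qed
  note ids = two_unit_vectors_identities[where v = "\<lambda>a. x (a, i)" and w = "\<lambda>a. x (a, j)" and t = "t x" and
      M = "\<lambda>a b. M a b x" for x, OF cols cols t_def[symmetric] M]
  define V where "V = {0, 1::nat} \<times> J"
  define u where "u k = (2::nat, k)" for k :: nat
  define s where "s k x = 1 - x (0, k) * x (0, k) - x (1, k) * x (1, k)" for k and x :: "nat \<times> nat \<Rightarrow> complex"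
  \<comment> \<open>The determinant of \<open>M\<close>, in terms of the columns in \<open>J\<close>
    alone. It vanishes on \<open>Z\<close>, where \<open>M\<close> is also a sum of two matrices of
    rank one.\<close>
  define F where "F x = M 0 0 x * M 1 1 x * M 2 2 x + 2 * M 0 1 x * M 1 2 x * M 0 2 x - M 0 0 x * M 1 2 x * M 1 2 x
      - M 1 1 x * M 0 2 x * M 0 2 x - M 2 2 x * M 0 1 x * M 0 1 x" for x
  \<comment> \<open>All columns equal the second unit vector. The third row and the radicands
    \<open>s k\<close> vanish, and \<open>M\<close> is diagonal with the nonzero entries r/3, r/3 -
    (r - 2) and r/3.\<close>
  define q where "q = (\<lambda>(a, k::nat). if a = (1::nat) then 1 else (0::complex))"
  have VI: "V \<subseteq> ?I" "finite V" and cV: "card V = 2 * (r - 2)"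
    using J by (auto simp: V_def card_cartesian_product)
  have W: "V \<union> u ` J = {..<3} \<times> J" by (auto simp: V_def u_def less_3_cases)
  have WI: "{..<3} \<times> J \<subseteq> ?I" using J by auto
  have MW: "M a b \<in> polyfun ({..<3} \<times> J)" if "a < 3" "b < 3" for a b
    unfolding M_def by (intro polyfun_intros) (use that in auto)
  have sV: "s k \<in> polyfun V" if "k \<in> J" for k
    unfolding s_def by (intro polyfun_intros) (use that in \<open>auto simp: V_def\<close>)
  have zk: "x (2, k) ^ 2 = s k x" if "k \<in> J" "x \<in> Z" for k x
    using cols[OF that(2), of k] that(1) J(2) by (auto simp: sum_lessThan_3 s_def power2_eq_square algebra_simps)
  have "\<exists>G\<in>polyfun V. G q \<noteq> 0 \<and> (\<forall>x\<in>Z. G x = 0)"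
  proof (rule polyfun_eliminate_sqrts[OF J(1), where u = u and s = s and F = F])
    show "F \<in> polyfun (V \<union> u ` J)"
      unfolding W F_def by (intro polyfun_intros MW) auto
    show "F x = 0" if "x \<in> Z" for x
      unfolding F_def using ids(4)[OF that _ that _ that] ij by simp
    have Mq: "M 0 0 q = of_nat r / 3" "M 2 2 q = of_nat r / 3" "M 0 1 q = 0" "M 1 2 q = 0" "M 0 2 q = 0"
      "M 1 1 q = of_nat r / 3 - of_nat (r - 2)"
      by (simp_all add: M_def q_def J(3))
    have r0: "of_nat r / 3 \<noteq> (0::complex)" using r by simp
    have r1: "of_nat r / 3 - of_nat (r - 2) \<noteq> (0::complex)"
    proof
      assume "of_nat r / 3 - of_nat (r - 2) = (0::complex)"
      then have "of_nat r = (of_nat (3 * (r - 2)) :: complex)" by simp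
      then have "r = 3 * (r - 2)" by (simp only: of_nat_eq_iff)
      with r show False by simp
    qed
    have "F q = (of_nat r / 3) * (of_nat r / 3 - of_nat (r - 2)) * (of_nat r / 3)"
      unfolding F_def Mq by simp
    then show "F q \<noteq> 0" using r0 r1 by (simp only: mult_eq_0_iff) blast
  qed (use sV zk in \<open>auto simp: u_def q_def s_def\<close>)
  then obtain G where G: "G \<in> polyfun V" "G q \<noteq> 0" "\<And>x. x \<in> Z \<Longrightarrow> G x = 0" by blast
  obtain \<tau> h B where hB: "\<tau> \<in> V" "genfin ?I (V - {\<tau>}) Z h B" "\<And>v. v \<in> V \<Longrightarrow> galg (V - {\<tau>}) Z h B (\<lambda>x. x v)"
    by (rule dependent_genfin[OF irr VI(2,1) G(1,2)]; (rule G(3) | rule that); assumption)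
  define T where "T = V - {\<tau>}"
  note hB = hB[folded T_def]
  have cT: "finite T" "card T \<le> 2 * r - 5" using VI hB(1) cV r by (simp_all add: T_def)
  have oneI: "(\<lambda>x. 1) \<in> polyfun ?I" by (rule polyfun_const)
  have nz1: "\<exists>x\<in>Z. (1::complex) \<noteq> 0" using x0 by auto
  have "\<exists>h' B'. genfin ?I T Z h' B' \<and> (\<forall>k\<in>J. galg T Z h' B' (\<lambda>x. x (2, k))) \<and> (\<forall>f. galg T Z h B f \<longrightarrow> galg T Z h' B' f)"
  proof (rule genfin_extend_sqrts[OF irr hB(2) J(1), where a = "\<lambda>_ _. 1" and g = s])
    show "(\<lambda>x. x (2, k)) \<in> polyfun ?I" if "k \<in> J" for k using that J by (intro polyfun_var) auto
    show "galg T Z h B (\<lambda>_. 1)" by (rule galg_polyfun_base[OF hB(2) polyfun_const])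
    show "s k \<in> polyfun ?I" if "k \<in> J" for k using sV[OF that] polyfun_mono[OF VI(1)] by blast
    show "galg T Z h B (s k)" if "k \<in> J" for k by (rule galg_polyfun[OF hB(2) hB(3) sV[OF that]])
    show "1 * x (2, k) ^ 2 = s k x" if "k \<in> J" "x \<in> Z" for k x using zk[OF that] by simp
  qed (rule oneI nz1)+
  then obtain h1 B1 where 1: "genfin ?I T Z h1 B1" "\<And>k. k \<in> J \<Longrightarrow> galg T Z h1 B1 (\<lambda>x. x (2, k))"
    "\<And>f. galg T Z h B f \<Longrightarrow> galg T Z h1 B1 f" by blast
  have W1: "galg T Z h1 B1 (\<lambda>x. x v)" if v: "v \<in> {..<3} \<times> J" for v
  proof (cases "v \<in> V")
    case True
    then show ?thesis by (intro 1(3) hB(3))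
  next
    case False
    then obtain k where "v = (2, k)" "k \<in> J" using v by (cases v) (auto simp: V_def less_3_cases)
    then show ?thesis using 1(2) by simp
  qed
  have tI: "t \<in> polyfun ?I" unfolding t_def by (intro polyfun_intros) (use ij in auto)
  have MI: "M a b \<in> polyfun ?I" if "a < 3" "b < 3" for a b
    using MW[OF that] polyfun_mono[OF WI] by blast
  define g where "g x = ((\<Sum>a<3. \<Sum>b<3. M a b x * M a b x) - 2) / 2" for x
  have gW: "g \<in> polyfun ({..<3} \<times> J)" unfolding g_def by (intro polyfun_intros MW) auto
  \<comment> \<open>A single square root is adjoined, hence the one-element index set.\<close>
  have "\<exists>h' B'. genfin ?I T Z h' B' \<and> (\<forall>k\<in>{()}. galg T Z h' B' t) \<and> (\<forall>f. galg T Z h1 B1 f \<longrightarrow> galg T Z h' B' f)"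
  proof (rule genfin_extend_sqrts[OF irr 1(1), where a = "\<lambda>_ _. 1" and g = "\<lambda>_. g"])
    show "galg T Z h1 B1 (\<lambda>_. 1)" by (rule galg_polyfun_base[OF 1(1) polyfun_const])
    show "g \<in> polyfun ?I" using gW polyfun_mono[OF WI] by blast
    show "galg T Z h1 B1 g" by (rule galg_polyfun[OF 1(1) W1 gW])
    show "1 * t x ^ 2 = g x" if "x \<in> Z" for x
      unfolding g_def using ids(3)[OF that _ that _ that] ij by simp
  qed (use x0 oneI tI in auto)
  then obtain h2 B2 where 2: "genfin ?I T Z h2 B2" "galg T Z h2 B2 t"
    "\<And>f. galg T Z h1 B1 f \<Longrightarrow> galg T Z h2 B2 f" by blast
  have M2: "galg T Z h2 B2 (M a b)" if "a < 3" "b < 3" for a b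
    by (rule 2(3)[OF galg_polyfun[OF 1(1) W1 MW[OF that]]])
  have c2: "galg T Z h2 B2 (\<lambda>x. c)" for c by (rule galg_polyfun_base[OF 2(1) polyfun_const])
  have MM2: "galg T Z h2 B2 (\<lambda>x. (\<Sum>b<3. M a b x * M a b x) + (- 1) * M a a x)" if "a < 3" for a
    unfolding sum_lessThan_3 using that by (intro galg_add[OF 2(1)] galg_mult[OF 2(1)] M2 c2) auto
  have nzt: "\<exists>x\<in>Z. t x \<noteq> 0" using x0 ij(4) by (auto simp: t_def)
  define g1 where "g1 a x = (\<Sum>b<3. M a b x * M a b x) + (- 1) * M a a x + t x * M a a x" for a x
  define g2 where "g2 a x = (\<Sum>b<3. M a b x * M a b x) + (- 1) * M a a x + (- 1) * (t x * M a a x)" for a x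
  have "\<exists>h' B'. genfin ?I T Z h' B' \<and> (\<forall>a\<in>{..<3}. galg T Z h' B' (\<lambda>x. x (a, i) + x (a, j))) \<and>
      (\<forall>f. galg T Z h2 B2 f \<longrightarrow> galg T Z h' B' f)"
  proof (rule genfin_extend_sqrts[OF irr 2(1), where a = "\<lambda>_. t" and g = g1])
    show "(\<lambda>x. x (a, i) + x (a, j)) \<in> polyfun ?I" if "a \<in> {..<3}" for a
      by (intro polyfun_intros) (use that ij in auto)
    show "g1 a \<in> polyfun ?I" if "a \<in> {..<3}" for a
      unfolding g1_def by (intro polyfun_intros MI tI) (use that in auto)
    show "galg T Z h2 B2 (g1 a)" if "a \<in> {..<3}" for a
      unfolding g1_def by (intro galg_add[OF 2(1) MM2] galg_mult[OF 2(1)] 2(2) M2) (use that in auto)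
    show "t x * (x (a, i) + x (a, j)) ^ 2 = g1 a x" if "a \<in> {..<3}" "x \<in> Z" for a x
      unfolding g1_def using ids(1)[OF that(2) _ that(2) _ that(2)] ij that(1) by simp
  qed (simp_all add: tI 2(2) nzt)
  then obtain h3 B3 where 3: "genfin ?I T Z h3 B3" "\<And>a. a < 3 \<Longrightarrow> galg T Z h3 B3 (\<lambda>x. x (a, i) + x (a, j))"
    "\<And>f. galg T Z h2 B2 f \<Longrightarrow> galg T Z h3 B3 f" by blast
  have c3: "galg T Z h3 B3 (\<lambda>x. c)" for c by (rule galg_polyfun_base[OF 3(1) polyfun_const])
  have "\<exists>h' B'. genfin ?I T Z h' B' \<and> (\<forall>a\<in>{..<3}. galg T Z h' B' (\<lambda>x. x (a, i) - x (a, j))) \<and>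
      (\<forall>f. galg T Z h3 B3 f \<longrightarrow> galg T Z h' B' f)"
  proof (rule genfin_extend_sqrts[OF irr 3(1), where a = "\<lambda>_ x. (- 1) * t x" and g = g2])
    show "(\<lambda>x. x (a, i) - x (a, j)) \<in> polyfun ?I" if "a \<in> {..<3}" for a
      by (intro polyfun_intros) (use that ij in auto)
    show "(\<lambda>x. (- 1) * t x) \<in> polyfun ?I" by (intro polyfun_intros tI)
    show "galg T Z h3 B3 (\<lambda>x. (- 1) * t x)" by (intro galg_mult[OF 3(1)] c3 3(3) 2(2))
    show "\<exists>x\<in>Z. (- 1) * t x \<noteq> 0" using nzt by simp
    show "g2 a \<in> polyfun ?I" if "a \<in> {..<3}" for a
      unfolding g2_def by (intro polyfun_intros MI tI) (use that in auto)
    show "galg T Z h3 B3 (g2 a)" if "a \<in> {..<3}" for a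
      unfolding g2_def by (intro 3(3) galg_add[OF 2(1) MM2] galg_mult[OF 2(1)] 2(2) M2 c2) (use that in auto)
    show "(- 1) * t x * (x (a, i) - x (a, j)) ^ 2 = g2 a x" if "a \<in> {..<3}" "x \<in> Z" for a x
      unfolding g2_def using ids(2)[OF that(2) _ that(2) _ that(2)] ij that(1) by simp
  qed simp
  then obtain h4 B4 where 4: "genfin ?I T Z h4 B4" "\<And>a. a < 3 \<Longrightarrow> galg T Z h4 B4 (\<lambda>x. x (a, i) - x (a, j))"
    "\<And>f. galg T Z h3 B3 f \<Longrightarrow> galg T Z h4 B4 f" by blast
  have c4: "galg T Z h4 B4 (\<lambda>x. c)" for c by (rule galg_polyfun_base[OF 4(1) polyfun_const])
  have "galg T Z h4 B4 (\<lambda>x. x v)" if v: "v \<in> ?I" for v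
  proof -
    obtain a k where ak: "v = (a, k)" "a < 3" "k < r" using v by auto
    have p: "galg T Z h4 B4 (\<lambda>x. x (a, i) + x (a, j))" and m: "galg T Z h4 B4 (\<lambda>x. x (a, i) - x (a, j))"
      using 3(2) 4 ak by auto
    consider "k = i" | "k = j" | "k \<in> J" using ak by (auto simp: J_def)
    then show ?thesis
    proof cases
      case 1
      have "galg T Z h4 B4 (\<lambda>x. 1/2 * ((x (a, i) + x (a, j)) + (x (a, i) - x (a, j))))"
        by (intro galg_mult[OF 4(1) c4] galg_add[OF 4(1)] p m)
      then show ?thesis by (rule galg_cong) (simp add: ak 1)
    next
      case 2
      have "galg T Z h4 B4 (\<lambda>x. 1/2 * ((x (a, i) + x (a, j)) + (- 1) * (x (a, i) - x (a, j))))"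
        by (intro galg_mult[OF 4(1) c4] galg_add[OF 4(1)] p m)
      then show ?thesis by (rule galg_cong) (simp add: ak 2)
    next
      case 3
      then show ?thesis using W1[of v] 2(3) \<open>\<And>f. galg T Z h2 B2 f \<Longrightarrow> galg T Z h3 B3 f\<close> 4(3) ak by auto
    qed
  qed
  with cT 4(1) show ?thesis by blast
qed

lemma variety_dim_funtf_3_le:
  assumes "r \<ge> 5"
  shows "variety_dim (index_grid 3 r) (funtf_variety 3 r) \<le> enat (2 * r - 5)"
  by (rule variety_dim_le[OF funtf_3_genfin[OF assms]])

section \<open>Explicit frames\<close>

text \<open>Cross-multiplication keeps all entries integral, so that the test can be evaluated. The
  pivot stays in the list, reduced to zero.\<close>

fun spans :: "nat \<Rightarrow> int list list \<Rightarrow> bool" where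
  "spans 0 vs = True"
| "spans (Suc n) vs = (case filter (\<lambda>v. hd v \<noteq> 0) vs of [] \<Rightarrow> False
     | p # _ \<Rightarrow> spans n (map (\<lambda>u. map2 (\<lambda>a b. hd p * a - hd u * b) (tl u) (tl p)) vs))"

text \<open>Gaussian elimination: \<open>A\<close> is a linear subspace of \<open>\<complex>\<^sup>n\<close> containing the vectors of the list.\<close>

lemma spans_sound:
  assumes "spans n vs" "\<And>v. v \<in> set vs \<Longrightarrow> length v = n"
    and "\<And>f g. A f \<Longrightarrow> A g \<Longrightarrow> A (\<lambda>i. f i + g i)" "\<And>c f. A f \<Longrightarrow> A (\<lambda>i. c * f i)"
    and "\<And>f g. A f \<Longrightarrow> (\<And>i. i < n \<Longrightarrow> f i = g i) \<Longrightarrow> A g" "A (\<lambda>_. 0)"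
    and "\<And>v. v \<in> set vs \<Longrightarrow> A (\<lambda>i. of_int (v ! i))"
  shows "A (t :: nat \<Rightarrow> complex)"
  using assms
proof (induction n arbitrary: vs A t)
  case 0
  show ?case by (rule "0.prems"(5)[OF "0.prems"(6)]) simp
next
  case (Suc n vs A t)
  obtain p ps where p: "filter (\<lambda>v. hd v \<noteq> 0) vs = p # ps"
    using Suc.prems(1) by (auto split: list.splits)
  let ?red = "\<lambda>u. map2 (\<lambda>a b. hd p * a - hd u * b) (tl u) (tl p)"
  have sp: "spans n (map ?red vs)" using Suc.prems(1) p by simp
  have "p \<in> set (filter (\<lambda>v. hd v \<noteq> 0) vs)" unfolding p by simp
  then have pvs: "p \<in> set vs" and hp: "hd p \<noteq> 0" by auto
  have nz: "v ! 0 = hd v" if "v \<in> set vs" for v using Suc.prems(2)[OF that] by (cases v) auto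
  have lp: "length p = Suc n" using Suc.prems(2)[OF pvs] .
  have nthred: "?red u ! i = hd p * u ! Suc i - hd u * p ! Suc i" if "u \<in> set vs" "i < n" for u i
    using Suc.prems(2)[OF that(1)] lp that(2) by (simp add: nth_tl)
  \<comment> \<open>The vectors of \<open>A\<close> with first coordinate zero, regarded in one
    dimension less.\<close>
  define A' where "A' f = A (case_nat 0 f)" for f :: "nat \<Rightarrow> complex"
  have A': "A' f" for f
  proof (rule Suc.IH[OF sp, of A'])
    show "length v = n" if "v \<in> set (map ?red vs)" for v using that Suc.prems(2) lp by auto
    show "A' (\<lambda>i. f i + g i)" if "A' f" "A' g" for f g
      using Suc.prems(3)[OF that[unfolded A'_def]] unfolding A'_def
      by (rule Suc.prems(5)) (simp split: nat.split)
    show "A' (\<lambda>i. c * f i)" if "A' f" for c f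
      using Suc.prems(4)[OF that[unfolded A'_def], of c] unfolding A'_def
      by (rule Suc.prems(5)) (simp split: nat.split)
    show "A' g" if "A' f" "\<And>i. i < n \<Longrightarrow> f i = g i" for f g
      using that(1) unfolding A'_def by (rule Suc.prems(5)) (simp add: that(2) split: nat.split)
    show "A' (\<lambda>_. 0)"
      unfolding A'_def by (rule Suc.prems(5)[OF Suc.prems(6)]) (simp split: nat.split)
    fix v assume "v \<in> set (map ?red vs)"
    then obtain u where u: "u \<in> set vs" "v = ?red u" by auto
    have "A (\<lambda>i. of_int (hd p) * of_int (u ! i) + of_int (- hd u) * of_int (p ! i))"
      by (intro Suc.prems(3) Suc.prems(4) Suc.prems(7) u pvs)
    then show "A' (\<lambda>i. of_int (v ! i))"
      unfolding A'_def
    proof (rule Suc.prems(5))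
      fix i assume i: "i < Suc n"
      show "(of_int (hd p) :: complex) * of_int (u ! i) + of_int (- hd u) * of_int (p ! i) = (case i of 0 \<Rightarrow> 0 | Suc j \<Rightarrow> of_int (v ! j))"
      proof (cases i)
        case 0
        then show ?thesis using nz[OF u(1)] nz[OF pvs] by simp
      next
        case (Suc j)
        then have "v ! j = hd p * u ! Suc j - hd u * p ! Suc j" unfolding u(2) using i by (intro nthred u(1)) simp
        then show ?thesis using Suc by simp
      qed
    qed
  qed
  \<comment> \<open>What is left of \<open>t\<close> when the pivot has cleared its first
    coordinate.\<close>
  let ?t' = "\<lambda>i. t (Suc i) - t 0 / of_int (hd p) * of_int (p ! Suc i)"
  have "A (\<lambda>i. t 0 / of_int (hd p) * of_int (p ! i) + case_nat 0 ?t' i)"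
    by (intro Suc.prems(3) Suc.prems(4) Suc.prems(7)[OF pvs] A'[of ?t', unfolded A'_def])
  then show ?case
  proof (rule Suc.prems(5))
    fix i show "t 0 / of_int (hd p) * of_int (p ! i) + case_nat 0 ?t' i = t i"
      using nz[OF pvs] hp by (cases i) simp_all
  qed
qed

text \<open>The cross product of \<open>u\<close> with the l-th unit vector: orthogonal to
  \<open>u\<close> and zero in row \<open>l\<close>, as required of a column that misses this row.
  For nonzero \<open>u\<close> the three of them span the orthogonal complement of
  \<open>u\<close>.\<close>

definition cross_unit :: "int list \<Rightarrow> nat \<Rightarrow> int list" where
  "cross_unit u l = (if l = 0 then [0, u ! 2, - (u ! 1)] else if l = 1 then [- (u ! 2), 0, u ! 0] else [u ! 1, - (u ! 0), 0])"

text \<open>The entry (2, 2) is left out: vanishing trace determines it, so five coordinates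
  describe a traceless symmetric matrix.\<close>

definition sym_pairs :: "(nat \<times> nat) list" where
  "sym_pairs = [(0, 0), (1, 1), (0, 1), (0, 2), (1, 2)]"

definition sym_prod :: "int list \<Rightarrow> int list \<Rightarrow> int list" where
  "sym_prod u y = map (\<lambda>(a, b). u ! a * y ! b + y ! a * u ! b) sym_pairs"

text \<open>
  The code of a column is the row it misses if it has degree 2 in the graph, and 3 if it has degree 3.
\<close>

definition normal_vectors :: "int list list \<Rightarrow> nat list \<Rightarrow> int list list" where
  "normal_vectors us L = concat (map2 (\<lambda>u c. map (\<lambda>l. sym_prod u (cross_unit u l)) (filter (\<lambda>l. c = 3 \<or> c = l) [0, 1, 2])) us L)"

text \<open>The dimension of the space of admissible directions in the column, namely its degree
  minus one.\<close>

definition code_weight :: "nat \<Rightarrow> nat" where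
  "code_weight c = (if c = 3 then 2 else 1)"

text \<open>
  Found by computer search: after normalisation, the first two lists are a rotated five-vector tight frame and
  a pair of orthonormal bases, the third is an orthonormal basis together with a regular tetrahedron.
\<close>

definition seed :: "nat \<Rightarrow> int list list" where
  "seed m = (if m = 0 then [[-3, -6, 2], [-1, 2, 1], [-13, -5, -10], [-13, 2, 11], [-1, 1, -2]]
     else if m = 1 then [[2, -2, 1], [-1, 2, 2], [1, 2, 2], [2, 2, -1], [-2, -1, 2], [-2, 1, -2]]
     else [[-2, 1, -2], [-1, -1, 1], [-1, 1, -1], [1, -2, -2], [1, -1, -1], [1, 1, 1], [-2, -2, 1]])"

text \<open>The first argument is fuel; every entry has weight at least 1, so fuel \<open>k\<close> suffices for total weight \<open>k\<close>.\<close>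

fun sorted_codes :: "nat \<Rightarrow> nat \<Rightarrow> nat \<Rightarrow> nat list list" where
  "sorted_codes 0 m k = (if k = 0 then [[]] else [])"
| "sorted_codes (Suc n) m k = (if k = 0 then [[]] else
     concat (map (\<lambda>c. if code_weight c \<le> k then map ((#) c) (sorted_codes n c (k - code_weight c)) else []) [m..<4]))"

lemma sorted_codes_complete:
  assumes "sorted L" "set L \<subseteq> {m..<4}" "sum_list (map code_weight L) = k" "k \<le> n"
  shows "L \<in> set (sorted_codes n m k)"
  using assms
proof (induction L arbitrary: n m k)
  case Nil
  then show ?case by (cases n) auto
next
  case (Cons c L)
  have w: "code_weight c \<ge> 1" by (simp add: code_weight_def)
  have k: "k = code_weight c + sum_list (map code_weight L)" using Cons.prems(3) by simp
  obtain n' where n: "n = Suc n'" using Cons.prems(4) k w by (cases n) auto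
  have "L \<in> set (sorted_codes n' c (k - code_weight c))"
    by (rule Cons.IH) (use Cons.prems w k n in auto)
  moreover have "c \<in> set [m..<4]" using Cons.prems(2) by simp
  ultimately show ?case using w k unfolding n by (auto intro!: bexI[of _ c])
qed

text \<open>In the exceptional lists all five columns have degree 2 and miss the same row l. Each of
  their matrices has a zero diagonal entry at l, so they cannot span. The lists are the same for all
  three seeds because at most the first five vectors of a seed are paired with codes.\<close>

lemma seed_spans_0: "list_all (\<lambda>L. L = replicate 5 0 \<or> L = replicate 5 1 \<or> L = replicate 5 2 \<or>
    spans 5 (normal_vectors (seed 0) L)) (sorted_codes 5 0 5)"
  by code_simp

lemma seed_spans_1: "list_all (\<lambda>L. L = replicate 5 0 \<or> L = replicate 5 1 \<or> L = replicate 5 2 \<or>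
    spans 5 (normal_vectors (seed 1) L)) (sorted_codes 5 0 5)"
  by code_simp

lemma seed_spans_2: "list_all (\<lambda>L. L = replicate 5 0 \<or> L = replicate 5 1 \<or> L = replicate 5 2 \<or>
    spans 5 (normal_vectors (seed 2) L)) (sorted_codes 5 0 5)"
  by code_simp

definition sqnorm :: "int list \<Rightarrow> int" where
  "sqnorm u = u ! 0 * u ! 0 + u ! 1 * u ! 1 + u ! 2 * u ! 2"

text \<open>Stated for vectors before normalisation: division by the squared norm avoids square
  roots.\<close>

definition tight :: "int list list \<Rightarrow> bool" where
  "tight us \<longleftrightarrow> (\<forall>a<3. \<forall>b<3. sum_list (map (\<lambda>u. of_int (u ! a * u ! b) / of_int (sqnorm u)) us) =
     (if a = b then of_nat (length us) / 3 else (0::complex)))"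

lemma tight_append: "tight us \<Longrightarrow> tight vs \<Longrightarrow> tight (us @ vs)"
  by (simp add: tight_def add_divide_distrib)

text \<open>With no entry equal to zero, any neighbour of a column can be used to solve the
  normalisation equation of that column.\<close>

definition full :: "int list list \<Rightarrow> bool" where
  "full us \<longleftrightarrow> (\<forall>u\<in>set us. length u = 3 \<and> u ! 0 \<noteq> 0 \<and> u ! 1 \<noteq> 0 \<and> u ! 2 \<noteq> 0)"

lemma full_append: "full us \<Longrightarrow> full vs \<Longrightarrow> full (us @ vs)"
  by (auto simp: full_def)

text \<open>Three times an orthonormal basis. The standard basis would contain zeros.\<close>

definition block :: "int list list" where
  "block = [[1, 2, 2], [2, 1, -2], [2, -2, 1]]"

lemma tight_block: "tight block" "full block"
  by (auto simp: tight_def full_def block_def sqnorm_def less_3_cases)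

lemma tight_seed: "m < 3 \<Longrightarrow> tight (seed m)" "m < 3 \<Longrightarrow> full (seed m)"
  by (auto simp: tight_def full_def seed_def sqnorm_def less_3_cases)

text \<open>Each block adds three columns and preserves tightness, so seeds with 5, 6 and 7 vectors
  reach every r from 5 on.\<close>

definition frame :: "nat \<Rightarrow> int list list" where
  "frame r = seed ((r - 5) mod 3) @ concat (replicate ((r - 5) div 3) block)"

lemma length_frame: "r \<ge> 5 \<Longrightarrow> length (frame r) = r"
proof -
  assume r: "r \<ge> 5"
  have "length (seed m) = m + 5" if "m < 3" for m using that by (auto simp: seed_def less_3_cases)
  then have "length (frame r) = (r - 5) mod 3 + 5 + (r - 5) div 3 * 3"
    by (simp add: frame_def length_concat block_def sum_list_replicate)
  then show ?thesis using r by simp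
qed

lemma tight_frame: "tight (frame r)"
proof -
  have "tight (concat (replicate k block))" for k
    by (induction k) (auto intro: tight_append tight_block simp: tight_def[of "[]"])
  then show ?thesis unfolding frame_def by (intro tight_append tight_seed) auto
qed

lemma full_frame: "full (frame r)"
proof -
  have "full (concat (replicate k block))" for k
    by (induction k) (auto intro: full_append tight_block simp: full_def[of "[]"])
  then show ?thesis unfolding frame_def by (intro full_append tight_seed) auto
qed

lemma frame_spans:
  assumes "sorted L" "set L \<subseteq> {0..<4}" "sum_list (map code_weight L) = 5" "\<And>l. l < 3 \<Longrightarrow> L \<noteq> replicate 5 l"
  shows "spans 5 (normal_vectors (frame r) L)"
proof -
  have L: "L \<in> set (sorted_codes 5 0 5)" using sorted_codes_complete[of L 0 5 5] assms by simp
  have "L \<noteq> replicate 5 0" "L \<noteq> replicate 5 1" "L \<noteq> replicate 5 2"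
    using assms(4)[of 0] assms(4)[of 1] assms(4)[of 2] by simp_all
  with L seed_spans_0 seed_spans_1 seed_spans_2
  have sp: "spans 5 (normal_vectors (seed m) L)" if "m < 3" for m
    using that unfolding list_all_iff less_3_cases by blast
  have "length L \<le> sum_list (map code_weight L)"
    by (induction L) (auto simp: code_weight_def)
  then have "length L \<le> 5" using assms(3) by simp
  then have "length L \<le> length (seed m)" for m by (simp add: seed_def)
  \<comment> \<open>\<open>zip\<close> stops at the end of \<open>L\<close>, so the blocks behind
    the seed are never reached.\<close>
  then have "zip (seed m @ vs) L = zip (seed m) L" for m vs by (simp add: zip_append1)
  then have "normal_vectors (frame r) L = normal_vectors (seed ((r - 5) mod 3)) L"
    by (simp add: normal_vectors_def frame_def)
  with sp[of "(r - 5) mod 3"] show ?thesis by simp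
qed

section \<open>Adapting a frame to a graph\<close>

lemma csqrt_nonzero_sq: "z \<noteq> 0 \<Longrightarrow> csqrt z \<noteq> 0 \<and> csqrt z * csqrt z = z"
  using power2_csqrt[of z] by (auto simp: power2_eq_square)

text \<open>
  \<open>H\<close> is the graph. A column of degree 1 only serves to solve the normalisation equation of that column.
  What remains is to span the traceless symmetric matrices by the matrices \<open>u y\<^sup>T + y u\<^sup>T\<close>, \<open>y\<close> orthogonal to \<open>u\<close>,
  where \<open>u\<close> is a column of degree at least 2 and \<open>y\<close> is supported on its neighbours.
\<close>

lemma funtf_point_exists:
  fixes r :: nat and H :: "(nat \<times> nat) set"
  assumes r: "r \<ge> 5" and H: "H \<subseteq> index_grid 3 r" "card H = r + 5"
    and deg: "\<And>j. j < r \<Longrightarrow> \<exists>a<3. (a, j) \<in> H"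
    and mix: "\<And>l. l < 3 \<Longrightarrow> \<exists>j<r. (l, j) \<in> H \<and> (\<exists>a<3. a \<noteq> l \<and> (a, j) \<in> H)"
  obtains p where
    "\<And>a b. a < 3 \<Longrightarrow> b < 3 \<Longrightarrow> (\<Sum>j<r. p (a, j) * p (b, j)) = (if a = b then of_nat r / 3 else (0::complex))"
    "\<And>j. j < r \<Longrightarrow> (\<Sum>a<3. p (a, j) * p (a, j)) = 1"
    "\<And>\<Sigma> \<gamma>. \<exists>\<xi>. (\<forall>v. v \<notin> H \<longrightarrow> \<xi> v = 0) \<and>
       (\<forall>i<5. case sym_pairs ! i of (a, b) \<Rightarrow> (\<Sum>j<r. p (a, j) * \<xi> (b, j) + \<xi> (a, j) * p (b, j)) = \<Sigma> i) \<and>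
       (\<forall>j<r. (\<Sum>a<3. p (a, j) * \<xi> (a, j) + \<xi> (a, j) * p (a, j)) = \<gamma> j)"
proof -
  define N where "N j = {a. a < 3 \<and> (a, j) \<in> H}" for j
  \<comment> \<open>The value 4 marks the remaining columns, which never enter
    \<open>L\<close>.\<close>
  define code where "code j = (if card (N j) = 3 then 3 else if card (N j) = 2 then (THE l. l < 3 \<and> l \<notin> N j) else 4)" for j
  have finN: "finite (N j)" for j by (simp add: N_def)
  have Nsub: "N j \<subseteq> {..<3}" for j by (auto simp: N_def)
  have Nne: "card (N j) \<ge> 1" if "j < r" for j
    using deg[OF that] finN[of j] by (auto simp: N_def Suc_le_eq card_gt_0_iff)
  have Nle: "card (N j) \<le> 3" for j using card_mono[OF _ Nsub[of j]] by simp
  have miss: "code j < 3 \<and> N j = {..<3} - {code j}" if "card (N j) = 2" for j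
  proof -
    have "card ({..<3} - N j) = 1" using that Nsub[of j] finN by (simp add: card_Diff_subset)
    then obtain l where l: "{..<3} - N j = {l}" by (auto simp: card_1_singleton_iff)
    then have "code j = l" unfolding code_def using that by (auto intro!: the_equality)
    then show ?thesis using l Nsub[of j] by auto
  qed
  have full3: "N j = {..<3}" if "card (N j) = 3" for j
    using card_subset_eq[OF _ Nsub[of j]] that by simp
  define special where "special = sort_key code (filter (\<lambda>j. card (N j) \<noteq> 1) [0..<r])"
  define leaf where "leaf = filter (\<lambda>j. card (N j) = 1) [0..<r]"
  \<comment> \<open>The frame vectors may be handed out along any ordering of the columns. Special
    columns come first, in the order of their codes, so that they receive the vectors paired with
    \<open>L\<close>.\<close>
  define cs where "cs = special @ leaf"
  have set_special: "set special = {j. j < r \<and> card (N j) \<noteq> 1}" by (auto simp: special_def)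
  have set_cs: "set cs = {..<r}" by (auto simp: cs_def special_def leaf_def)
  have dist_cs: "distinct cs" unfolding cs_def by (auto simp: special_def leaf_def)
  have len_cs: "length cs = r" using distinct_card[OF dist_cs] set_cs by simp
  have dist_special: "distinct special" using dist_cs by (simp add: cs_def)
  have code3: "code j = 3" if "card (N j) = 3" for j using that by (simp add: code_def)
  have weight: "card (N j) = code_weight (code j) + 1" if "j \<in> set special" for j
  proof -
    have "card (N j) = 2 \<or> card (N j) = 3" using that Nne[of j] Nle[of j] unfolding set_special by auto
    then show ?thesis
    proof
      assume 2: "card (N j) = 2"
      from miss[OF 2] have "code j \<noteq> 3" by simp
      with 2 show ?thesis by (simp add: code_weight_def)
    next
      assume 3: "card (N j) = 3"
      from code3[OF 3] 3 show ?thesis by (simp add: code_weight_def)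
    qed
  qed
  define L where "L = map code special"
  have "sorted L" by (simp add: L_def special_def)
  moreover have "set L \<subseteq> {0..<4}"
  proof -
    have "code j < 4" if "j \<in> set special" for j
    proof -
      have "card (N j) = 2 \<or> card (N j) = 3" using that Nne[of j] Nle[of j] unfolding set_special by auto
      then show ?thesis
      proof
        assume "card (N j) = 2"
        from miss[OF this] show ?thesis by simp
      next
        assume "card (N j) = 3"
        from code3[OF this] show ?thesis by simp
      qed
    qed
    then show ?thesis by (auto simp: L_def)
  qed
  \<comment> \<open>A special column has its weight plus one edges and a leaf has one edge, so r + 5
    edges on r columns leave total weight 5.\<close>
  moreover have "sum_list (map code_weight L) = 5"
  proof -
    have "card H = (\<Sum>j<r. card (N j))"
    proof -
      have "H = (\<Union>j<r. (\<lambda>a. (a, j)) ` N j)" using H(1) by (auto simp: N_def)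
      also have "card \<dots> = (\<Sum>j<r. card ((\<lambda>a. (a, j)) ` N j))"
        by (rule card_UN_disjoint) (use finN in auto)
      also have "\<dots> = (\<Sum>j<r. card (N j))" by (intro sum.cong refl card_image) (simp add: inj_on_def)
      finally show ?thesis .
    qed
    also have "\<dots> = (\<Sum>j\<in>set cs. card (N j))" by (simp add: set_cs)
    also have "\<dots> = sum_list (map (\<lambda>j. card (N j)) cs)" by (rule sum.distinct_set_conv_list[OF dist_cs])
    also have "\<dots> = sum_list (map (\<lambda>j. card (N j)) special) + length leaf"
    proof -
      have "sum_list (map (\<lambda>j. card (N j)) leaf) = sum_list (map (\<lambda>_. 1) leaf)"
        by (intro arg_cong[of _ _ sum_list] map_cong) (auto simp: leaf_def)
      then show ?thesis by (simp add: cs_def sum_list_triv)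
    qed
    also have "map (\<lambda>j. card (N j)) special = map (\<lambda>j. code_weight (code j) + 1) special"
      using weight by simp
    also have "sum_list \<dots> = sum_list (map code_weight L) + length special"
    proof -
      have "sum_list (map (\<lambda>j. f j + 1) xs) = sum_list (map f xs) + length xs" for f :: "nat \<Rightarrow> nat" and xs
        by (induction xs) auto
      then show ?thesis by (simp add: L_def comp_def)
    qed
    finally show ?thesis using H(2) len_cs by (simp add: cs_def)
  qed
  \<comment> \<open>By \<open>mix\<close>, row \<open>l\<close> has a neighbour that also meets
    another row. That column is special and does not miss \<open>l\<close>.\<close>
  moreover have "L \<noteq> replicate 5 l" if l: "l < 3" for l
  proof
    assume "L = replicate 5 l"
    then have all: "code j = l" if "j \<in> set special" for j using that unfolding L_def
      by (metis image_eqI in_set_replicate set_map)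
    obtain j a where j: "j < r" "(l, j) \<in> H" "a < 3" "a \<noteq> l" "(a, j) \<in> H" using mix[OF l] by blast
    then have "{l, a} \<subseteq> N j" using l by (simp add: N_def)
    then have "card (N j) \<ge> 2" using card_mono[OF finN, of "{l, a}" j] j(4) by simp
    then have "j \<in> set special" using j(1) by (simp add: set_special)
    from all[OF this] have "code j = l" .
    moreover have "card (N j) = 2"
    proof (rule ccontr)
      assume "card (N j) \<noteq> 2"
      then have "card (N j) = 3" using \<open>card (N j) \<ge> 2\<close> Nle[of j] by simp
      then show False using \<open>code j = l\<close> l by (simp add: code_def)
    qed
    ultimately show False using miss[of j] \<open>{l, a} \<subseteq> N j\<close> by auto
  qed
  ultimately have sp: "spans 5 (normal_vectors (frame r) L)" by (rule frame_spans)
  define U where "U j = the (map_of (zip cs (frame r)) j)" for j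
  have len_f: "length (frame r) = r" by (rule length_frame[OF r])
  have mapU: "map U cs = frame r"
  proof (rule nth_equalityI)
    show "length (map U cs) = length (frame r)" by (simp add: len_cs len_f)
    fix i assume "i < length (map U cs)"
    then show "map U cs ! i = frame r ! i"
      using map_of_zip_nth[of cs "frame r" i] dist_cs by (simp add: U_def len_cs len_f)
  qed
  have sumU: "(\<Sum>j<r. f (U j)) = sum_list (map f (frame r))" for f :: "int list \<Rightarrow> complex"
  proof -
    have "(\<Sum>j<r. f (U j)) = sum_list (map (\<lambda>j. f (U j)) cs)"
      using sum.distinct_set_conv_list[OF dist_cs, of "\<lambda>j. f (U j)"] by (simp add: set_cs)
    then show ?thesis by (simp flip: mapU add: comp_def)
  qed
  have Uin: "U j \<in> set (frame r)" if "j < r" for j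
    using that set_cs by (simp flip: mapU)
  have Ufull: "length (U j) = 3 \<and> U j ! 0 \<noteq> 0 \<and> U j ! 1 \<noteq> 0 \<and> U j ! 2 \<noteq> 0" if "j < r" for j
    using full_frame[of r] Uin[OF that] unfolding full_def by blast
  have Unz: "U j ! a \<noteq> 0" if "j < r" "a < 3" for j a
    using Ufull[OF that(1)] that(2) by (auto simp: less_3_cases)
  have sqU: "sqnorm (U j) \<noteq> 0" if "j < r" for j
  proof -
    have "sqnorm (U j) > 0" unfolding sqnorm_def using Unz[OF that, of 0]
      by (intro add_pos_nonneg) (auto simp: zero_less_mult_iff)
    then show ?thesis by simp
  qed
  define \<nu> where "\<nu> j = csqrt (of_int (sqnorm (U j)))" for j
  have \<nu>: "\<nu> j \<noteq> 0" "\<nu> j * \<nu> j = of_int (sqnorm (U j))" if "j < r" for j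
    using csqrt_nonzero_sq[of "of_int (sqnorm (U j))"] sqU[OF that] by (auto simp: \<nu>_def)
  define p where "p = (\<lambda>(a, j). of_int (U j ! a) / \<nu> j)"
  have pp: "p (a, j) * p (b, j) = of_int (U j ! a * U j ! b) / of_int (sqnorm (U j))" if "j < r" for a b j
    using \<nu>[OF that] by (simp add: p_def)
  have pnz: "p (a, j) \<noteq> 0" if "a < 3" "j < r" for a j
    using Unz[OF that(2,1)] \<nu>[OF that(2)] by (simp add: p_def)
  show thesis
  proof (rule that[of p])
    fix a b :: nat assume ab: "a < 3" "b < 3"
    have "(\<Sum>j<r. p (a, j) * p (b, j)) = (\<Sum>j<r. of_int (U j ! a * U j ! b) / of_int (sqnorm (U j)))"
      by (intro sum.cong refl pp) simp
    also have "\<dots> = (if a = b then of_nat r / 3 else 0)"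
      using tight_frame[of r] ab sumU[of "\<lambda>u. of_int (u ! a * u ! b) / of_int (sqnorm u)"]
      unfolding tight_def len_f by simp
    finally show "(\<Sum>j<r. p (a, j) * p (b, j)) = (if a = b then of_nat r / 3 else 0)" .
  next
    fix j assume j: "j < r"
    have "(\<Sum>a<3. p (a, j) * p (a, j)) = of_int (sqnorm (U j)) / of_int (sqnorm (U j))"
    proof -
      have "(\<Sum>a<3. p (a, j) * p (a, j)) =
          (of_int (U j ! 0 * U j ! 0) + of_int (U j ! 1 * U j ! 1) + of_int (U j ! 2 * U j ! 2)) / of_int (sqnorm (U j))"
        by (simp only: pp[OF j] sum_lessThan_3 add_divide_distrib)
      also have "of_int (U j ! 0 * U j ! 0) + of_int (U j ! 1 * U j ! 1) + of_int (U j ! 2 * U j ! 2) = (of_int (sqnorm (U j)) :: complex)"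
        by (simp add: sqnorm_def)
      finally show ?thesis .
    qed
    then show "(\<Sum>a<3. p (a, j) * p (a, j)) = 1" using sqU[OF j] by simp
  next
    fix \<Sigma> \<gamma> :: "nat \<Rightarrow> complex"
    define Lr where "Lr \<xi> a b = (\<Sum>j<r. p (a, j) * \<xi> (b, j) + \<xi> (a, j) * p (b, j))" for \<xi> :: "nat \<times> nat \<Rightarrow> complex" and a b
    define Lc where "Lc \<xi> j = (\<Sum>a<3. p (a, j) * \<xi> (a, j) + \<xi> (a, j) * p (a, j))" for \<xi> :: "nat \<times> nat \<Rightarrow> complex" and j
    have Lr_add: "Lr (\<lambda>v. \<xi> v + \<eta> v) a b = Lr \<xi> a b + Lr \<eta> a b" for \<xi> \<eta> a b
      by (simp add: Lr_def sum.distrib[symmetric] algebra_simps)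
    have Lr_scale: "Lr (\<lambda>v. c * \<xi> v) a b = c * Lr \<xi> a b" for c \<xi> a b
      by (simp add: Lr_def sum_distrib_left algebra_simps)
    have Lc_add: "Lc (\<lambda>v. \<xi> v + \<eta> v) j = Lc \<xi> j + Lc \<eta> j" for \<xi> \<eta> j
      by (simp add: Lc_def sum.distrib[symmetric] algebra_simps)
    have Lc_scale: "Lc (\<lambda>v. c * \<xi> v) j = c * Lc \<xi> j" for c \<xi> j
      by (simp add: Lc_def sum_distrib_left algebra_simps)
    \<comment> \<open>The row changes attainable by displacements on \<open>H\<close> that leave all
      column norms unchanged to first order. This is a linear subspace, as the elimination lemma
      expects.\<close>
    define A where "A t \<longleftrightarrow> (\<exists>\<xi>. (\<forall>v. v \<notin> H \<longrightarrow> \<xi> v = 0) \<and> (\<forall>j<r. Lc \<xi> j = 0) \<and>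
      (\<forall>i<5. Lr \<xi> (fst (sym_pairs ! i)) (snd (sym_pairs ! i)) = t i))" for t :: "nat \<Rightarrow> complex"
    have A: "A t" for t
    proof (rule spans_sound[OF sp])
      fix v assume v: "v \<in> set (normal_vectors (frame r) L)"
      have "frame r = map U special @ map U leaf" by (simp flip: mapU add: cs_def)
      then have zip: "zip (frame r) L = map (\<lambda>j. (U j, code j)) special"
      proof -
        have "zip (map f xs) (map g xs) = map (\<lambda>x. (f x, g x)) xs"
          for f :: "nat \<Rightarrow> int list" and g :: "nat \<Rightarrow> nat" and xs
          by (induction xs) auto
        then show ?thesis using \<open>frame r = _\<close> by (simp add: L_def zip_append1)
      qed
      obtain j l where j: "j \<in> set special" and "l \<in> {0, 1, 2}" and l': "code j = 3 \<or> code j = l"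
        and veq: "v = sym_prod (U j) (cross_unit (U j) l)"
        using v unfolding normal_vectors_def zip by (auto simp del: filter.simps; blast)
      then have l: "l < 3" by auto
      show "length v = 5" by (simp add: veq sym_prod_def sym_pairs_def)
      have jr: "j < r" using j by (simp add: set_special)
      define y where "y = cross_unit (U j) l"
      have y: "y ! l = 0" "length y = 3" "U j ! 0 * y ! 0 + U j ! 1 * y ! 1 + U j ! 2 * y ! 2 = 0"
        using l(1) by (auto simp: y_def cross_unit_def less_3_cases)
      have Hsup: "(a, j) \<in> H" if "a < 3" "a \<noteq> l" for a
      proof -
        have "card (N j) = 2 \<or> card (N j) = 3" using j Nne[of j] Nle[of j] unfolding set_special by auto
        then have "a \<in> N j"
        proof
          assume "card (N j) = 2"
          from miss[OF this] l' that show "a \<in> N j" by auto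
        next
          assume "card (N j) = 3"
          from full3[OF this] that show "a \<in> N j" by auto
        qed
        then show ?thesis by (simp add: N_def)
      qed
      \<comment> \<open>The factor \<open>\<nu> j\<close> cancels the normalisation of
        \<open>p\<close>, so the resulting row change is the integer vector \<open>v\<close>
        itself.\<close>
      define \<xi> where "\<xi> = (\<lambda>(a, k). if k = j \<and> a < 3 then \<nu> j * of_int (y ! a) else 0)"
      show "A (\<lambda>i. of_int (v ! i))"
        unfolding A_def
      proof (intro exI[of _ \<xi>] conjI allI impI)
        fix w assume "w \<notin> H"
        then show "\<xi> w = 0" using Hsup y(1) by (cases w) (auto simp: \<xi>_def)
      next
        fix k assume k: "k < r"
        show "Lc \<xi> k = 0"
        proof (cases "k = j")
          case False
          then show ?thesis by (simp add: Lc_def \<xi>_def)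
        next
          case True
          have "Lc \<xi> k = 2 * of_int (U j ! 0 * y ! 0 + U j ! 1 * y ! 1 + U j ! 2 * y ! 2)"
            using \<nu>(1)[OF jr] by (simp add: True Lc_def \<xi>_def p_def sum_lessThan_3 field_simps)
          then show ?thesis by (simp only: y(3) of_int_0 mult_zero_right)
        qed
      next
        fix i :: nat assume i: "i < 5"
        obtain a b where ab: "sym_pairs ! i = (a, b)" by force
        have "(a, b) \<in> set sym_pairs" using i nth_mem[of i sym_pairs] ab by (simp add: sym_pairs_def)
        then have ab3: "a < 3" "b < 3" by (auto simp: sym_pairs_def)
        have "Lr \<xi> a b = (\<Sum>k<r. if k = j then of_int (U j ! a) * of_int (y ! b) + of_int (y ! a) * of_int (U j ! b) else 0)"
          unfolding Lr_def using ab3 \<nu>(1)[OF jr] by (intro sum.cong refl) (auto simp: \<xi>_def p_def field_simps)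
        also have "\<dots> = of_int (U j ! a * y ! b + y ! a * U j ! b)" using jr by simp
        also have "U j ! a * y ! b + y ! a * U j ! b = v ! i"
        proof -
          have "i < length sym_pairs" using i by (simp add: sym_pairs_def)
          then show ?thesis by (simp add: veq sym_prod_def ab y_def[symmetric])
        qed
        finally show "Lr \<xi> (fst (sym_pairs ! i)) (snd (sym_pairs ! i)) = of_int (v ! i)" by (simp add: ab)
      qed
    next
      fix f g assume "A f" "A g"
      then obtain \<xi> \<eta> where \<xi>: "\<forall>v. v \<notin> H \<longrightarrow> \<xi> v = 0" "\<forall>j<r. Lc \<xi> j = 0" "\<forall>i<5. Lr \<xi> (fst (sym_pairs ! i)) (snd (sym_pairs ! i)) = f i"
        and \<eta>: "\<forall>v. v \<notin> H \<longrightarrow> \<eta> v = 0" "\<forall>j<r. Lc \<eta> j = 0" "\<forall>i<5. Lr \<eta> (fst (sym_pairs ! i)) (snd (sym_pairs ! i)) = g i"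
        unfolding A_def by blast
      show "A (\<lambda>i. f i + g i)"
        unfolding A_def by (rule exI[of _ "\<lambda>v. \<xi> v + \<eta> v"]) (simp add: \<xi> \<eta> Lc_add Lr_add)
    next
      fix c f assume "A f"
      then obtain \<xi> where \<xi>: "\<forall>v. v \<notin> H \<longrightarrow> \<xi> v = 0" "\<forall>j<r. Lc \<xi> j = 0" "\<forall>i<5. Lr \<xi> (fst (sym_pairs ! i)) (snd (sym_pairs ! i)) = f i"
        unfolding A_def by blast
      show "A (\<lambda>i. c * f i)"
        unfolding A_def by (rule exI[of _ "\<lambda>v. c * \<xi> v"]) (simp add: \<xi> Lc_scale Lr_scale)
    next
      fix f g assume "A f" "\<And>i. i < 5 \<Longrightarrow> f i = g i"
      then show "A g" unfolding A_def by simp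
    next
      show "A (\<lambda>_. 0)" unfolding A_def by (rule exI[of _ "\<lambda>_. 0"]) (simp add: Lc_def Lr_def)
    qed
    obtain e where e: "\<And>j. j < r \<Longrightarrow> e j < 3 \<and> (e j, j) \<in> H" using deg by metis
    \<comment> \<open>One neighbour per column settles the column equations; the side effect on the
      rows is then corrected by \<open>\<xi>1\<close>, which does not disturb the columns.\<close>
    define \<xi>0 where "\<xi>0 = (\<lambda>(a, j). if j < r \<and> a = e j then \<gamma> j / (2 * p (a, j)) else 0)"
    have Lc0: "Lc \<xi>0 j = \<gamma> j" if j: "j < r" for j
    proof -
      have "Lc \<xi>0 j = (\<Sum>a<3. if a = e j then \<gamma> j else 0)"
        unfolding Lc_def using j pnz[of "e j" j] e[OF j] by (intro sum.cong refl) (auto simp: \<xi>0_def field_simps)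
      then show ?thesis using e[OF j] by simp
    qed
    obtain \<xi>1 where \<xi>1: "\<forall>v. v \<notin> H \<longrightarrow> \<xi>1 v = 0" "\<forall>j<r. Lc \<xi>1 j = 0"
      "\<forall>i<5. Lr \<xi>1 (fst (sym_pairs ! i)) (snd (sym_pairs ! i)) = \<Sigma> i - Lr \<xi>0 (fst (sym_pairs ! i)) (snd (sym_pairs ! i))"
      using A[of "\<lambda>i. \<Sigma> i - Lr \<xi>0 (fst (sym_pairs ! i)) (snd (sym_pairs ! i))"] unfolding A_def by blast
    show "\<exists>\<xi>. (\<forall>v. v \<notin> H \<longrightarrow> \<xi> v = 0) \<and>
       (\<forall>i<5. case sym_pairs ! i of (a, b) \<Rightarrow> (\<Sum>j<r. p (a, j) * \<xi> (b, j) + \<xi> (a, j) * p (b, j)) = \<Sigma> i) \<and>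
       (\<forall>j<r. (\<Sum>a<3. p (a, j) * \<xi> (a, j) + \<xi> (a, j) * p (a, j)) = \<gamma> j)"
    proof (rule exI[of _ "\<lambda>v. \<xi>0 v + \<xi>1 v"], intro conjI allI impI)
      fix v assume v: "v \<notin> H"
      have "\<xi>0 v = 0" using v e by (cases v) (auto simp: \<xi>0_def)
      moreover have "\<xi>1 v = 0" using \<xi>1(1) v by blast
      ultimately show "\<xi>0 v + \<xi>1 v = 0" by simp
    next
      fix i :: nat assume i: "i < 5"
      have "Lr (\<lambda>v. \<xi>0 v + \<xi>1 v) (fst (sym_pairs ! i)) (snd (sym_pairs ! i)) = \<Sigma> i"
        using \<xi>1(3) i by (simp add: Lr_add)
      then show "case sym_pairs ! i of (a, b) \<Rightarrow> (\<Sum>j<r. p (a, j) * (\<xi>0 (b, j) + \<xi>1 (b, j)) + (\<xi>0 (a, j) + \<xi>1 (a, j)) * p (b, j)) = \<Sigma> i"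
        by (simp add: Lr_def case_prod_unfold)
    next
      fix j assume j: "j < r"
      have "Lc (\<lambda>v. \<xi>0 v + \<xi>1 v) j = \<gamma> j" using \<xi>1(2) Lc0 j by (simp add: Lc_add)
      then show "(\<Sum>a<3. p (a, j) * (\<xi>0 (a, j) + \<xi>1 (a, j)) + (\<xi>0 (a, j) + \<xi>1 (a, j)) * p (a, j)) = \<gamma> j"
        by (simp add: Lc_def)
    qed
  qed
qed

section \<open>Connectivity and bases\<close>

text \<open>A path cannot leave a vertex set that no edge crosses, and the vertices reachable from a
  given one form such a set.\<close>

lemma connected_iff_no_cut:
  fixes G :: "'a pair_pre_digraph"
  assumes wf: "\<And>x y. (x, y) \<in> parcs G \<Longrightarrow> x \<in> pverts G \<and> y \<in> pverts G"
  shows "Digraph_Component.connected (with_proj G) \<longleftrightarrow> pverts G \<noteq> {} \<and>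
    (\<forall>C. C \<subseteq> pverts G \<and> C \<noteq> {} \<and> (\<forall>(x, y)\<in>parcs G. x \<in> C \<longleftrightarrow> y \<in> C) \<longrightarrow> C = pverts G)"
proof -
  define R where "R = parcs (mk_symmetric (with_proj G))"
  have R: "(x, y) \<in> R \<longleftrightarrow> (x, y) \<in> parcs G \<or> (y, x) \<in> parcs G" for x y
  proof -
    have "R = (\<Union>e\<in>parcs G. {(fst e, snd e), (snd e, fst e)})" by (simp add: R_def mk_symmetric_def)
    then show ?thesis by (auto intro: bexI[of _ "(x, y)"] bexI[of _ "(y, x)"])
  qed
  have conn: "Digraph_Component.connected (with_proj G) \<longleftrightarrow> pverts G \<noteq> {} \<and>
      (\<forall>u\<in>pverts G. \<forall>v\<in>pverts G. (u, v) \<in> rtrancl_on (pverts G) R)"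
    by (simp add: connected_def strongly_connected_def reachable_def R_def)
  show ?thesis
  proof
    assume c: "Digraph_Component.connected (with_proj G)"
    have "C = pverts G" if C: "C \<subseteq> pverts G" "C \<noteq> {}" "\<forall>(x, y)\<in>parcs G. x \<in> C \<longleftrightarrow> y \<in> C" for C
    proof -
      obtain u where u: "u \<in> C" using C(2) by blast
      have "v \<in> C" if "v \<in> pverts G" for v
      proof -
        have "(u, v) \<in> rtrancl_on (pverts G) R" using c u C(1) that unfolding conn by blast
        then show "v \<in> C"
        proof (induction rule: rtrancl_on_induct)
          case base
          show ?case by (rule u)
        next
          case (step y z)
          then show ?case using C(3) R[of y z] by auto
        qed
      qed
      with C(1) show ?thesis by blast
    qed
    with c show "pverts G \<noteq> {} \<and>
      (\<forall>C. C \<subseteq> pverts G \<and> C \<noteq> {} \<and> (\<forall>(x, y)\<in>parcs G. x \<in> C \<longleftrightarrow> y \<in> C) \<longrightarrow> C = pverts G)"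
      unfolding conn by blast
  next
    assume a: "pverts G \<noteq> {} \<and>
      (\<forall>C. C \<subseteq> pverts G \<and> C \<noteq> {} \<and> (\<forall>(x, y)\<in>parcs G. x \<in> C \<longleftrightarrow> y \<in> C) \<longrightarrow> C = pverts G)"
    have "(u, v) \<in> rtrancl_on (pverts G) R" if u: "u \<in> pverts G" and v: "v \<in> pverts G" for u v
    proof -
      define C where "C = {x \<in> pverts G. (u, x) \<in> rtrancl_on (pverts G) R}"
      have step: "y \<in> C" if "x \<in> C" "(x, y) \<in> R" for x y
        using that wf[of x y] wf[of y x] R[of x y] rtrancl_on_into_rtrancl_on[of u x "pverts G" R y] unfolding C_def by blast
      have "C \<subseteq> pverts G" "C \<noteq> {}" using u by (auto simp: C_def)
      moreover have "\<forall>(x, y)\<in>parcs G. x \<in> C \<longleftrightarrow> y \<in> C"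
        using step R by blast
      ultimately have "C = pverts G" using a by blast
      with v show ?thesis by (auto simp: C_def)
    qed
    with a show "Digraph_Component.connected (with_proj G)" unfolding conn by blast
  qed
qed

text \<open>Vertex sets are traded for pairs of a row set and a column set, over which the entries
  of a matrix can be summed.\<close>

lemma connected_complement_graph_iff:
  "Digraph_Component.connected (with_proj (complement_graph n r E)) \<longleftrightarrow> n + r > 0 \<and>
    (\<forall>A B. A \<subseteq> {..<n} \<and> B \<subseteq> {..<r} \<and> (A \<noteq> {} \<or> B \<noteq> {}) \<and> (\<forall>(i, j)\<in>index_grid n r - E. i \<in> A \<longleftrightarrow> j \<in> B) \<longrightarrow>
      A = {..<n} \<and> B = {..<r})"
  (is "_ \<longleftrightarrow> _ \<and> ?R")
proof -
  let ?G = "complement_graph n r E"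
  have wf: "x \<in> pverts ?G \<and> y \<in> pverts ?G" if "(x, y) \<in> parcs ?G" for x y
    using that by (auto simp: complement_graph_def)
  have pv: "pverts ?G = Inl ` {..<n} \<union> Inr ` {..<r}" by (simp add: complement_graph_def)
  have arcs: "(\<forall>(x, y)\<in>parcs ?G. x \<in> C \<longleftrightarrow> y \<in> C) \<longleftrightarrow> (\<forall>(i, j)\<in>index_grid n r - E. Inl i \<in> C \<longleftrightarrow> Inr j \<in> C)" for C
  proof
    assume a: "\<forall>(x, y)\<in>parcs ?G. x \<in> C \<longleftrightarrow> y \<in> C"
    show "\<forall>(i, j)\<in>index_grid n r - E. Inl i \<in> C \<longleftrightarrow> Inr j \<in> C"
    proof
      fix w assume w: "w \<in> index_grid n r - E"
      obtain i j where ij: "w = (i, j)" by force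
      then have "(Inl i, Inr j) \<in> parcs ?G" using w by (simp add: complement_graph_def)
      from bspec[OF a this] show "case w of (i, j) \<Rightarrow> Inl i \<in> C \<longleftrightarrow> Inr j \<in> C" by (simp add: ij)
    qed
  next
    assume a: "\<forall>(i, j)\<in>index_grid n r - E. Inl i \<in> C \<longleftrightarrow> Inr j \<in> C"
    show "\<forall>(x, y)\<in>parcs ?G. x \<in> C \<longleftrightarrow> y \<in> C"
    proof
      fix w assume "w \<in> parcs ?G"
      then obtain i j where ij: "w = (Inl i, Inr j)" "(i, j) \<in> index_grid n r - E"
        unfolding complement_graph_def by auto
      from bspec[OF a ij(2)] show "case w of (x, y) \<Rightarrow> x \<in> C \<longleftrightarrow> y \<in> C" by (simp add: ij(1))
    qed
  qed
  have "(\<forall>C. C \<subseteq> pverts ?G \<and> C \<noteq> {} \<and> (\<forall>(x, y)\<in>parcs ?G. x \<in> C \<longleftrightarrow> y \<in> C) \<longrightarrow> C = pverts ?G) \<longleftrightarrow> ?R"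
    unfolding arcs
  proof
    assume a: "\<forall>C. C \<subseteq> pverts ?G \<and> C \<noteq> {} \<and> (\<forall>(i, j)\<in>index_grid n r - E. Inl i \<in> C \<longleftrightarrow> Inr j \<in> C) \<longrightarrow> C = pverts ?G"
    show ?R
    proof (intro allI impI)
      fix A B assume AB: "A \<subseteq> {..<n} \<and> B \<subseteq> {..<r} \<and> (A \<noteq> {} \<or> B \<noteq> {}) \<and> (\<forall>(i, j)\<in>index_grid n r - E. i \<in> A \<longleftrightarrow> j \<in> B)"
      have "Inl ` A \<union> Inr ` B = pverts ?G"
      proof (rule a[rule_format], intro conjI)
        have "Inl i \<in> Inl ` A \<union> Inr ` B \<longleftrightarrow> i \<in> A" "Inr j \<in> Inl ` A \<union> Inr ` B \<longleftrightarrow> j \<in> B" for i j by auto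
        then show "\<forall>(i, j)\<in>index_grid n r - E. Inl i \<in> Inl ` A \<union> Inr ` B \<longleftrightarrow> Inr j \<in> Inl ` A \<union> Inr ` B"
          using AB by simp
      qed (use AB in \<open>auto simp: pv\<close>)
      have "Inl i \<in> Inl ` A \<union> Inr ` B" if "i < n" for i
        using that \<open>Inl ` A \<union> Inr ` B = pverts ?G\<close> by (auto simp: pv)
      moreover have "Inr j \<in> Inl ` A \<union> Inr ` B" if "j < r" for j
        using that \<open>Inl ` A \<union> Inr ` B = pverts ?G\<close> by (auto simp: pv)
      ultimately show "A = {..<n} \<and> B = {..<r}" using AB by auto
    qed
  next
    assume a: ?R
    show "\<forall>C. C \<subseteq> pverts ?G \<and> C \<noteq> {} \<and> (\<forall>(i, j)\<in>index_grid n r - E. Inl i \<in> C \<longleftrightarrow> Inr j \<in> C) \<longrightarrow> C = pverts ?G"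
    proof (intro allI impI)
      fix C assume C: "C \<subseteq> pverts ?G \<and> C \<noteq> {} \<and> (\<forall>(i, j)\<in>index_grid n r - E. Inl i \<in> C \<longleftrightarrow> Inr j \<in> C)"
      have CC: "C = Inl ` (Inl -` C) \<union> Inr ` (Inr -` C)" using C by (auto simp: pv)
      have "Inl -` C = {..<n} \<and> Inr -` C = {..<r}"
      proof (rule a[rule_format], intro conjI)
        show "Inl -` C \<subseteq> {..<n}" "Inr -` C \<subseteq> {..<r}" using C by (auto simp: pv)
        show "Inl -` C \<noteq> {} \<or> Inr -` C \<noteq> {}"
        proof (rule ccontr)
          assume "\<not> ?thesis"
          then have "Inl ` (Inl -` C) \<union> Inr ` (Inr -` C) = {}" by simp
          from trans[OF CC this] C show False by simp
        qed
        show "\<forall>(i, j)\<in>index_grid n r - E. i \<in> Inl -` C \<longleftrightarrow> j \<in> Inr -` C" using C by auto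
      qed
      with CC show "C = pverts ?G" by (simp add: pv)
    qed
  qed
  moreover have "pverts ?G \<noteq> {} \<longleftrightarrow> n + r > 0" by (auto simp: pv)
  ultimately show ?thesis using connected_iff_no_cut[of ?G, OF wf] by simp
qed

lemma independent_polyfun_zero:
  assumes "independent_in X S" "f \<in> polyfun S" "\<And>x. x \<in> X \<Longrightarrow> f x = 0"
  shows "f y = 0"
proof -
  obtain p where p: "p \<in> polys_in S" "f = (\<lambda>x. poly_eval x p)" using assms(2) by (auto simp: polyfun_def)
  have "poly_eval (restrict x S) p = 0" if "x \<in> X" for x
  proof -
    have "poly_eval (restrict x S) p = poly_eval x p" by (rule poly_eval_cong[OF p(1)]) simp
    then show ?thesis using assms(3)[OF that] p(2) by simp
  qed
  then have "p = 0" using assms(1) p(1) unfolding independent_in_def by blast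
  then show ?thesis by (simp add: p(2))
qed

text \<open>
  A cut of the graph yields the relation obtained by subtracting the squared norms of its columns
  from those of its rows: all entries inside the blocks of the cut cancel.
\<close>

lemma independent_imp_connected:
  assumes n: "n > 0" and r: "r > 0" and E: "E \<subseteq> index_grid n r"
    and ind: "independent_in (funtf_variety n r) E"
  shows "Digraph_Component.connected (with_proj (complement_graph n r E))"
  unfolding connected_complement_graph_iff
proof (intro conjI[of "n + r > 0"] allI impI)
  show "n + r > 0" using n by simp
  fix A B assume AB: "A \<subseteq> {..<n} \<and> B \<subseteq> {..<r} \<and> (A \<noteq> {} \<or> B \<noteq> {}) \<and> (\<forall>(i, j)\<in>index_grid n r - E. i \<in> A \<longleftrightarrow> j \<in> B)"
  define A' where "A' = {..<n} - A"
  define B' where "B' = {..<r} - B"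
  have fin: "finite A" "finite B" "finite A'" "finite B'"
    using AB finite_subset by (auto simp: A'_def B'_def)
  have E1: "(i, j) \<in> E" if "i \<in> A" "j \<in> B'" for i j using AB that by (auto simp: B'_def)
  have E2: "(i, j) \<in> E" if "i \<in> A'" "j \<in> B" for i j using AB that by (auto simp: A'_def)
  define c :: complex where "c = of_nat (card A) * (of_nat r / of_nat n) - of_nat (card B)"
  define f where "f x = (\<Sum>i\<in>A. \<Sum>j\<in>B'. x (i, j) * x (i, j)) - (\<Sum>j\<in>B. \<Sum>i\<in>A'. x (i, j) * x (i, j)) - c" for x :: "nat \<times> nat \<Rightarrow> complex"
  have "f \<in> polyfun E" unfolding f_def by (intro polyfun_intros E1 E2)
  moreover have "f x = 0" if x: "x \<in> funtf_variety n r" for x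
  proof -
    have rows: "(\<Sum>j<r. x (i, j) * x (i, j)) = of_nat r / of_nat n" if "i < n" for i
      using x that by (simp add: funtf_variety_iff)
    have cols: "(\<Sum>i<n. x (i, j) * x (i, j)) = 1" if "j < r" for j
      using x that by (simp add: funtf_variety_iff)
    have splitB: "(\<Sum>j<r. g j) = (\<Sum>j\<in>B. g j) + (\<Sum>j\<in>B'. g j)" for g :: "nat \<Rightarrow> complex"
      unfolding B'_def using AB by (subst sum.subset_diff[of B "{..<r}"]) auto
    have splitA: "(\<Sum>i<n. g i) = (\<Sum>i\<in>A. g i) + (\<Sum>i\<in>A'. g i)" for g :: "nat \<Rightarrow> complex"
      unfolding A'_def using AB by (subst sum.subset_diff[of A "{..<n}"]) auto
    have "of_nat (card A) * (of_nat r / of_nat n) = (\<Sum>i\<in>A. \<Sum>j<r. x (i, j) * x (i, j))"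
      using AB rows by (simp add: subset_iff)
    also have "\<dots> = (\<Sum>i\<in>A. \<Sum>j\<in>B. x (i, j) * x (i, j)) + (\<Sum>i\<in>A. \<Sum>j\<in>B'. x (i, j) * x (i, j))"
      by (simp only: splitB sum.distrib)
    also have "(\<Sum>i\<in>A. \<Sum>j\<in>B. x (i, j) * x (i, j)) = (\<Sum>j\<in>B. \<Sum>i\<in>A. x (i, j) * x (i, j))"
      by (rule sum.swap)
    finally have 1: "of_nat (card A) * (of_nat r / of_nat n) =
        (\<Sum>j\<in>B. \<Sum>i\<in>A. x (i, j) * x (i, j)) + (\<Sum>i\<in>A. \<Sum>j\<in>B'. x (i, j) * x (i, j))" .
    have "of_nat (card B) = (\<Sum>j\<in>B. \<Sum>i<n. x (i, j) * x (i, j))"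
      using AB cols by (simp add: subset_iff)
    also have "\<dots> = (\<Sum>j\<in>B. \<Sum>i\<in>A. x (i, j) * x (i, j)) + (\<Sum>j\<in>B. \<Sum>i\<in>A'. x (i, j) * x (i, j))"
      by (simp only: splitA sum.distrib)
    finally show ?thesis unfolding f_def c_def 1 by simp
  qed
  \<comment> \<open>By independence the relation is identically zero, so it may be evaluated at
    points outside the variety.\<close>
  ultimately have f0: "f x = 0" for x by (rule independent_polyfun_zero[OF ind])
  have c0: "c = 0" using f0[of "\<lambda>_. 0"] by (simp add: f_def)
  \<comment> \<open>Matrix units: evaluation at one of them isolates the coefficient of a single
    square and shows that both blocks of cross entries are empty.\<close>
  define \<epsilon> where "\<epsilon> i0 j0 = (\<lambda>v. if v = (i0, j0) then 1 else (0::complex))" for i0 j0 :: nat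
  have \<epsilon>: "(\<Sum>i\<in>S. \<Sum>j\<in>T. \<epsilon> i0 j0 (i, j) * \<epsilon> i0 j0 (i, j)) = (if i0 \<in> S \<and> j0 \<in> T then 1 else 0)"
    if "finite S" "finite T" for S T i0 j0
  proof -
    have "(\<Sum>i\<in>S. \<Sum>j\<in>T. \<epsilon> i0 j0 (i, j) * \<epsilon> i0 j0 (i, j)) = (\<Sum>i\<in>S. if i = i0 then (\<Sum>j\<in>T. if j = j0 then 1 else 0) else 0)"
      by (intro sum.cong refl) (auto simp: \<epsilon>_def intro!: sum.cong sum.neutral)
    then show ?thesis using that by simp
  qed
  have \<epsilon>': "(\<Sum>j\<in>T. \<Sum>i\<in>S. \<epsilon> i0 j0 (i, j) * \<epsilon> i0 j0 (i, j)) = (if i0 \<in> S \<and> j0 \<in> T then 1 else 0)"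
    if "finite S" "finite T" for S T i0 j0
    by (subst sum.swap) (rule \<epsilon>[OF that])
  have val: "(if i0 \<in> A \<and> j0 \<in> B' then 1 else 0) - (if i0 \<in> A' \<and> j0 \<in> B then 1 else 0) = (0::complex)" for i0 j0
    using f0[of "\<epsilon> i0 j0"] unfolding f_def \<epsilon>[OF fin(1,4)] \<epsilon>'[OF fin(3,2)] c0 by simp
  have "A = {} \<or> B' = {}"
  proof (rule ccontr)
    assume "\<not> ?thesis"
    then obtain i0 j0 where "i0 \<in> A" "j0 \<in> B'" by blast
    moreover from this have "i0 \<notin> A'" by (simp add: A'_def)
    ultimately show False using val[of i0 j0] by simp
  qed
  moreover have "A' = {} \<or> B = {}"
  proof (rule ccontr)
    assume "\<not> ?thesis"
    then obtain i0 j0 where "i0 \<in> A'" "j0 \<in> B" by blast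
    moreover from this have "i0 \<notin> A" by (simp add: A'_def)
    ultimately show False using val[of i0 j0] by simp
  qed
  ultimately show "A = {..<n} \<and> B = {..<r}" using AB n r by (auto simp: A'_def B'_def)
qed

text \<open>The quadratic forms of the frame equations: \<open>Inl i\<close> stands for the entry
  \<open>sym_pairs ! i\<close> of W W^T, \<open>Inr j\<close> for the squared norm of column
  \<open>j\<close>. The forms are not symmetrised; the linearisation contains both orders of the
  arguments.\<close>

definition gram_coeff :: "nat + nat \<Rightarrow> nat \<times> nat \<Rightarrow> nat \<times> nat \<Rightarrow> complex" where
  "gram_coeff k u v = (case k of
     Inl i \<Rightarrow> (if fst u = fst (sym_pairs ! i) \<and> fst v = snd (sym_pairs ! i) \<and> snd u = snd v then 1 else 0)
   | Inr j \<Rightarrow> (if u = v \<and> snd u = j then 1 else 0))"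

lemma sum_gram_coeff_Inl:
  assumes "sym_pairs ! i = (a, b)" "a < 3" "b < 3"
  shows "(\<Sum>u\<in>index_grid 3 r. \<Sum>v\<in>index_grid 3 r. gram_coeff (Inl i) u v * f u v) = (\<Sum>j<r. f (a, j) (b, j))"
proof -
  let ?I = "index_grid 3 r"
  have "(\<Sum>u\<in>?I. \<Sum>v\<in>?I. gram_coeff (Inl i) u v * f u v) = (\<Sum>w\<in>?I \<times> ?I. gram_coeff (Inl i) (fst w) (snd w) * f (fst w) (snd w))"
    by (simp add: sum.cartesian_product case_prod_unfold)
  also have "\<dots> = (\<Sum>w\<in>(\<lambda>j. ((a, j), (b, j))) ` {..<r}. gram_coeff (Inl i) (fst w) (snd w) * f (fst w) (snd w))"
    by (rule sum.mono_neutral_right) (use assms in \<open>auto simp: gram_coeff_def\<close>)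
  also have "\<dots> = (\<Sum>j<r. f (a, j) (b, j))"
    by (subst sum.reindex) (simp_all add: inj_on_def gram_coeff_def assms(1))
  finally show ?thesis .
qed

lemma sum_gram_coeff_Inr:
  assumes "j < r"
  shows "(\<Sum>u\<in>index_grid 3 r. \<Sum>v\<in>index_grid 3 r. gram_coeff (Inr j) u v * f u v) = (\<Sum>a<3. f (a, j) (a, j))"
proof -
  let ?I = "index_grid 3 r"
  have "(\<Sum>u\<in>?I. \<Sum>v\<in>?I. gram_coeff (Inr j) u v * f u v) = (\<Sum>w\<in>?I \<times> ?I. gram_coeff (Inr j) (fst w) (snd w) * f (fst w) (snd w))"
    by (simp add: sum.cartesian_product case_prod_unfold)
  also have "\<dots> = (\<Sum>w\<in>(\<lambda>a. ((a, j), (a, j))) ` {..<3}. gram_coeff (Inr j) (fst w) (snd w) * f (fst w) (snd w))"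
    by (rule sum.mono_neutral_right) (use assms in \<open>auto simp: gram_coeff_def\<close>)
  also have "\<dots> = (\<Sum>a<3. f (a, j) (a, j))"
    by (subst sum.reindex) (simp_all add: inj_on_def gram_coeff_def)
  finally show ?thesis .
qed

text \<open>The missing diagonal entry comes from the trace: the squared norms of the rows have the
  same sum as those of the columns, namely r.\<close>

lemma funtf_3_from_equations:
  assumes "x \<in> affine_space (index_grid 3 r)"
    and rows: "\<And>i a b. i < 5 \<Longrightarrow> sym_pairs ! i = (a, b) \<Longrightarrow> (\<Sum>j<r. x (a, j) * x (b, j)) = (if a = b then of_nat r / 3 else 0)"
    and cols: "\<And>j. j < r \<Longrightarrow> (\<Sum>a<3. x (a, j) * x (a, j)) = 1"
  shows "x \<in> funtf_variety 3 r"
proof -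
  define g where "g a b = (\<Sum>j<r. x (a, j) * x (b, j))" for a b
  have sym: "g a b = g b a" for a b by (simp add: g_def mult.commute)
  have g: "g 0 0 = of_nat r / 3" "g 1 1 = of_nat r / 3" "g 0 1 = 0" "g 0 2 = 0" "g 1 2 = 0"
    using rows[of 0 0 0] rows[of 1 1 1] rows[of 2 0 1] rows[of 3 0 2] rows[of 4 1 2]
    by (simp_all add: sym_pairs_def g_def)
  have "g 0 0 + g 1 1 + g 2 2 = (\<Sum>j<r. \<Sum>a<3. x (a, j) * x (a, j))"
    by (simp add: g_def sum_lessThan_3 sum.distrib)
  also have "\<dots> = of_nat r" using cols by simp
  finally have "g 2 2 = of_nat r - g 0 0 - g 1 1" by (simp add: algebra_simps)
  then have g22: "g 2 2 = of_nat r / 3" by (simp only: g) (simp add: field_simps)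
  have "g a b = (if a = b then of_nat r / 3 else 0)" if "a < 3" "b < 3" for a b
    using that g g22 sym[of 1 0] sym[of 2 0] sym[of 2 1] by (auto simp: less_3_cases)
  then show ?thesis using assms(1) cols by (simp add: funtf_variety_iff g_def)
qed

text \<open>Both dimensions compared by \<open>spanning_in\<close> turn out to be
  \<open>card E\<close>: one because the projection contains a polydisc, the other by the section
  from below and the count 2r - 5 from above.\<close>

lemma connected_imp_basis_3:
  assumes r: "r \<ge> 5" and E: "E \<subseteq> index_grid 3 r" "card E = 2 * r - 5"
    and conn: "Digraph_Component.connected (with_proj (complement_graph 3 r E))"
  shows "basis_of (index_grid 3 r) (funtf_variety 3 r) E"
proof -
  let ?I = "index_grid 3 r"
  let ?X = "funtf_variety 3 r"
  define H where "H = ?I - E"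
  have cut: "A = {..<3} \<and> B = {..<r}"
    if "A \<subseteq> {..<3}" "B \<subseteq> {..<r}" "A \<noteq> {} \<or> B \<noteq> {}" "\<And>i j. (i, j) \<in> H \<Longrightarrow> i \<in> A \<longleftrightarrow> j \<in> B" for A B
  proof (rule conjunct2[OF conn[unfolded connected_complement_graph_iff], rule_format], intro conjI)
    show "\<forall>(i, j)\<in>index_grid 3 r - E. i \<in> A \<longleftrightarrow> j \<in> B" using that(4) by (auto simp: H_def)
  qed (fact that)+
  have finE: "finite E" using E(1) finite_subset by fastforce
  have "card H = 3 * r - (2 * r - 5)"
    unfolding H_def using E by (simp add: card_Diff_subset[OF finE] card_cartesian_product)
  then have H: "H \<subseteq> ?I" "card H = r + 5" using r by (auto simp: H_def)
  \<comment> \<open>A column without edges would be a component by itself.\<close>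
  have deg: "\<exists>a<3. (a, j) \<in> H" if "j < r" for j
  proof (rule ccontr)
    assume "\<not> ?thesis"
    then have "{} = {..<3::nat} \<and> {j} = {..<r}" using that H(1) by (intro cut) auto
    then show False by (metis lessThan_empty_iff zero_neq_numeral)
  qed
  \<comment> \<open>If every column meeting row \<open>l\<close> had degree 1, that row and these
    columns would form a component without the other two rows.\<close>
  have mix: "\<exists>j<r. (l, j) \<in> H \<and> (\<exists>a<3. a \<noteq> l \<and> (a, j) \<in> H)" if l: "l < 3" for l
  proof (rule ccontr)
    assume neg: "\<not> ?thesis"
    have "{l} = {..<3::nat} \<and> {j. j < r \<and> (l, j) \<in> H} = {..<r}"
    proof (rule cut)
      fix i j assume ij: "(i, j) \<in> H"
      then have "i < 3" "j < r" using H(1) by auto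
      then show "i \<in> {l} \<longleftrightarrow> j \<in> {j. j < r \<and> (l, j) \<in> H}" using neg ij by auto
    qed (use l in auto)
    then have "card {l} = card {..<3::nat}" by simp
    then show False by simp
  qed
  obtain p where p_rows: "\<And>a b. a < 3 \<Longrightarrow> b < 3 \<Longrightarrow> (\<Sum>j<r. p (a, j) * p (b, j)) = (if a = b then of_nat r / 3 else (0::complex))"
    and p_cols: "\<And>j. j < r \<Longrightarrow> (\<Sum>a<3. p (a, j) * p (a, j)) = 1"
    and p_lin: "\<And>\<Sigma> \<gamma>. \<exists>\<xi>. (\<forall>v. v \<notin> H \<longrightarrow> \<xi> v = 0) \<and>
       (\<forall>i<5. case sym_pairs ! i of (a, b) \<Rightarrow> (\<Sum>j<r. p (a, j) * \<xi> (b, j) + \<xi> (a, j) * p (b, j)) = \<Sigma> i) \<and>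
       (\<forall>j<r. (\<Sum>a<3. p (a, j) * \<xi> (a, j) + \<xi> (a, j) * p (a, j)) = \<gamma> j)"
    by (rule funtf_point_exists[OF r H deg mix]) (assumption | rule that)+
  define K :: "(nat + nat) set" where "K = Inl ` {..<5} \<union> Inr ` {..<r}"
  have prs: "\<exists>a b. sym_pairs ! i = (a, b) \<and> a < 3 \<and> b < 3" if "i < 5" for i
  proof -
    have "sym_pairs ! i \<in> set sym_pairs" using that by (intro nth_mem) (simp add: sym_pairs_def)
    then show ?thesis by (auto simp: sym_pairs_def)
  qed
  define d :: "nat + nat \<Rightarrow> complex" where
    "d k = (case k of Inl i \<Rightarrow> (if fst (sym_pairs ! i) = snd (sym_pairs ! i) then of_nat r / 3 else 0) | Inr j \<Rightarrow> 1)" for k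
  \<comment> \<open>For each equation a displacement on \<open>H\<close> that changes this equation
    alone to first order: the right inverse needed for the section.\<close>
  have "\<forall>k. \<exists>\<xi>. (\<forall>v. v \<notin> H \<longrightarrow> \<xi> v = 0) \<and> (\<forall>k'\<in>K. (\<Sum>u\<in>?I. \<Sum>v\<in>?I. gram_coeff k' u v * (p u * \<xi> v + \<xi> u * p v)) = (if k' = k then 1 else 0))"
  proof
    fix k
    obtain \<xi> where \<xi>: "\<forall>v. v \<notin> H \<longrightarrow> \<xi> v = 0"
       "\<forall>i<5. case sym_pairs ! i of (a, b) \<Rightarrow> (\<Sum>j<r. p (a, j) * \<xi> (b, j) + \<xi> (a, j) * p (b, j)) = (if Inl i = k then 1 else 0)"
       "\<forall>j<r. (\<Sum>a<3. p (a, j) * \<xi> (a, j) + \<xi> (a, j) * p (a, j)) = (if Inr j = k then 1 else 0)"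
      using p_lin[of "\<lambda>i. if Inl i = k then 1 else 0" "\<lambda>j. if Inr j = k then 1 else 0"] by blast
    have "(\<Sum>u\<in>?I. \<Sum>v\<in>?I. gram_coeff k' u v * (p u * \<xi> v + \<xi> u * p v)) = (if k' = k then 1 else 0)" if k': "k' \<in> K" for k'
    proof -
      consider i where "k' = Inl i" "i < 5" | j where "k' = Inr j" "j < r" using k' by (auto simp: K_def)
      then show ?thesis
      proof cases
        case 1
        then obtain a b where ab: "sym_pairs ! i = (a, b)" "a < 3" "b < 3" using prs by blast
        show ?thesis unfolding 1(1) sum_gram_coeff_Inl[OF ab] using \<xi>(2) 1(2) ab(1) by auto
      next
        case 2
        show ?thesis unfolding 2(1) sum_gram_coeff_Inr[OF 2(2)] using \<xi>(3) 2(2) by auto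
      qed
    qed
    with \<xi>(1) show "\<exists>\<xi>. (\<forall>v. v \<notin> H \<longrightarrow> \<xi> v = 0) \<and> (\<forall>k'\<in>K. (\<Sum>u\<in>?I. \<Sum>v\<in>?I. gram_coeff k' u v * (p u * \<xi> v + \<xi> u * p v)) = (if k' = k then 1 else 0))"
      by blast
  qed
  from choice[OF this] obtain b where "\<forall>k. (\<forall>v. v \<notin> H \<longrightarrow> b k v = 0) \<and>
      (\<forall>k'\<in>K. (\<Sum>u\<in>?I. \<Sum>v\<in>?I. gram_coeff k' u v * (p u * b k v + b k u * p v)) = (if k' = k then 1 else 0))"
    by (elim exE) (rule that)
  then have b: "\<And>k v. v \<notin> H \<Longrightarrow> b k v = 0"
    "\<And>k k'. k' \<in> K \<Longrightarrow> (\<Sum>u\<in>?I. \<Sum>v\<in>?I. gram_coeff k' u v * (p u * b k v + b k u * p v)) = (if k' = k then 1 else 0)"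
    by blast+
  have root: "(\<Sum>u\<in>?I. \<Sum>v\<in>?I. gram_coeff k u v * (p u * p v)) = d k" if k: "k \<in> K" for k
  proof -
    consider i where "k = Inl i" "i < 5" | j where "k = Inr j" "j < r" using k by (auto simp: K_def)
    then show ?thesis
    proof cases
      case 1
      then obtain a b where ab: "sym_pairs ! i = (a, b)" "a < 3" "b < 3" using prs by blast
      show ?thesis unfolding 1(1) sum_gram_coeff_Inl[OF ab] using p_rows ab by (simp add: d_def)
    next
      case 2
      show ?thesis unfolding 2(1) sum_gram_coeff_Inr[OF 2(2)] using p_cols 2(2) by (simp add: d_def)
    qed
  qed
  have finI: "finite ?I" and finK: "finite K" by (simp_all add: K_def)
  have bE: "b k v = 0" if "v \<in> E" for k v using b(1) that by (simp add: H_def)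
  obtain \<delta> \<phi> where \<delta>: "\<delta> > 0"
    and \<phi>: "\<And>s. s \<in> polydisc E p \<delta> \<Longrightarrow> \<phi> s \<in> affine_space ?I"
      "\<And>s v. s \<in> polydisc E p \<delta> \<Longrightarrow> v \<in> E \<Longrightarrow> \<phi> s v = s v"
      "\<And>s k. s \<in> polydisc E p \<delta> \<Longrightarrow> k \<in> K \<Longrightarrow> (\<Sum>u\<in>?I. \<Sum>v\<in>?I. gram_coeff k u v * (\<phi> s u * \<phi> s v)) = d k"
      "\<And>v. v \<in> ?I \<Longrightarrow> holomorphic_on_lines E p \<delta> (\<lambda>s. \<phi> s v)"
    by (rule quadratic_implicit_section[OF finI finK E(1) root bE b(2)]) (assumption | rule that)+
  have \<phi>X: "\<phi> s \<in> ?X" if s: "s \<in> polydisc E p \<delta>" for s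
  proof (rule funtf_3_from_equations[OF \<phi>(1)[OF s]])
    fix i a b assume i: "i < 5" "sym_pairs ! i = (a, b)"
    then have "a < 3" "b < 3" using prs[OF i(1)] by auto
    from sum_gram_coeff_Inl[OF i(2) this, where r = r and f = "\<lambda>u v. \<phi> s u * \<phi> s v"] \<phi>(3)[OF s, of "Inl i"] i
    show "(\<Sum>j<r. \<phi> s (a, j) * \<phi> s (b, j)) = (if a = b then of_nat r / 3 else 0)"
      by (simp add: K_def d_def)
  next
    fix j assume j: "j < r"
    from sum_gram_coeff_Inr[OF j, where f = "\<lambda>u v. \<phi> s u * \<phi> s v"] \<phi>(3)[OF s, of "Inr j"] j
    show "(\<Sum>a<3. \<phi> s (a, j) * \<phi> s (a, j)) = 1" by (simp add: K_def d_def)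
  qed
  have dense: "\<exists>x\<in>?X. \<forall>v\<in>E. x v = s v" if "s \<in> polydisc E p \<delta>" for s
    using \<phi>X[OF that] \<phi>(2)[OF that] by blast
  have "variety_dim ?I ?X = enat (card E)"
  proof (rule antisym)
    show "variety_dim ?I ?X \<le> enat (card E)" using variety_dim_funtf_3_le[OF r] E(2) by simp
    show "enat (card E) \<le> variety_dim ?I ?X"
      by (rule variety_dim_ge[OF finE E(1) funtf_variety_subset \<delta> \<phi>X \<phi>(2) \<phi>(4)])
  qed
  moreover have "variety_dim E (coord_proj E ` ?X) = enat (card E)"
    by (rule variety_dim_dense_projection[OF finE \<delta> dense])
  moreover have "independent_in ?X E" by (rule independent_in_polydisc[OF finE \<delta> dense])
  ultimately show ?thesis by (simp add: basis_of_def spanning_in_def)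
qed

theorem theorem4p2:
  fixes n r :: nat and E :: "(nat \<times> nat) set"
  assumes "r \<ge> n + 2" and "n + 2 > 4"
    and "E \<subseteq> index_grid n r"
    and "int (card E) = int n * int r - int ((n + 1) choose 2) - int r + 1"
  shows "(basis_of (index_grid n r) (funtf_variety n r) E \<longrightarrow>
            Digraph_Component.connected (with_proj (complement_graph n r E))) \<and>
         (n = 3 \<longrightarrow>
            Digraph_Component.connected (with_proj (complement_graph n r E)) \<longrightarrow>
            basis_of (index_grid n r) (funtf_variety n r) E)"
proof (intro conjI impI)
  assume "basis_of (index_grid n r) (funtf_variety n r) E"
  then show "Digraph_Component.connected (with_proj (complement_graph n r E))"
    using assms by (intro independent_imp_connected) (auto simp: basis_of_def)
next
  assume n: "n = 3" and conn: "Digraph_Component.connected (with_proj (complement_graph n r E))"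
  have "(3 + 1) choose 2 = (6::nat)" by (simp add: numeral_eq_Suc)
  then have "card E = 2 * r - 5" using assms(4) assms(1) unfolding n by linarith
  then show "basis_of (index_grid n r) (funtf_variety n r) E"
    using connected_imp_basis_3[of r E] assms(1,3) conn unfolding n by simp
qed

end
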